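(* Let $\mathcal{V}$ be a closed monoidal category (not assumed symmetric) and let $\mathcal{S}$ be a category. (1) If $\mathcal{S}$ is a tensor-closed $\mathcal{V}$-module, equipped with its canonical $\mathcal{V}$-structure, then the $\mathcal{V}$-category associated with $\mathcal{S}$ is tensored; therefore $\mathcal{S}$ has cylinder. (2) The correspondence in (1), sending a tensor-closed $\mathcal{V}$-module structure on $\mathcal{S}$ to its canonical $\mathcal{V}$-structure with the resulting cylinder, is a bijection from the set of tensor-closed $\mathcal{V}$-module structures on $\mathcal{S}$ to the set of $\mathcal{V}$-structures with cylinder on $\mathcal{S}$.
   Context: Composition of morphisms is written $g\cdot f$. A monoidal category $\mathcal{V}=(\mathcal{V},\otimes,I,a,l,r)$ has structure isomorphisms $a_{X,Y,Z}:(X\otimes Y)\otimes Z\to X\otimes(Y\otimes Z)$, $l_X:I\otimes X\to X$, $r_X:X\otimes I\to X$. It is closed if for every $Y$ the functor $-\otimes Y$ has a right adjoint $\underline{\mathcal{V}}(Y,-)$; the adjunction bijection is $\pi_{X,Y,Z}:\mathcal{V}(X\otimes Y,Z)\to\mathcal{V}(X,\underline{\mathcal{V}}(Y,Z))$, with counit $\epsilon_Z:\underline{\mathcal{V}}(Y,Z)\otimes Y\to Z$. The bijection $\varpi_{X,Y}:\mathcal{V}(X,Y)\to\mathcal{V}(I,\underline{\mathcal{V}}(X,Y))$ is $\varpi(f)=\pi_{I,X,Y}(f\cdot l_X)$. A (left) $\mathcal{V}$-module structure on $\mathcal{S}$: a functor $-\otimes-:\mathcal{V}\times\mathcal{S}\to\mathcal{S}$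 and isomorphisms $a_{K,L,X}:(K\otimes L)\otimes X\to K\otimes(L\otimes X)$ natural in $K,L\in\mathcal{V}$, $X\in\mathcal{S}$, and $l_X:I\otimes X\to X$ natural in $X$, satisfying the pentagon $a_{K,L,M\otimes X}\cdot a_{K\otimes L,M,X}=(1\otimes a_{L,M,X})\cdot a_{K,L\otimes M,X}\cdot(a_{K,L,M}\otimes1)$ and the triangle $(1\otimes l_X)\cdot a_{K,I,X}=r_K\otimes1$. A tensor-closed $\mathcal{V}$-module structure consists of a $\mathcal{V}$-module structure together with a functor $\underline{\mathcal{S}}(-,-):\mathcal{S}^{\mathrm{op}}\times\mathcal{S}\to\mathcal{V}$ and bijections $\phi_{K,X,Y}:\mathcal{S}(K\otimes X,Y)\to\mathcal{V}(K,\underline{\mathcal{S}}(X,Y))$ natural in $K,X,Y$; the counit of $\phi_{-,X,-}$ is $\epsilon_Y:\underline{\mathcal{S}}(X,Y)\otimes X\to Y$. A $\mathcal{V}$-structure on $\mathcal{S}$ consists of: a functor $\underline{\mathcal{S}}(-,-):\mathcal{S}^{\mathrm{op}}\times\mathcal{S}\to\mathcal{V}$; morphisms $\underline{\bullet}_{X,Y,Z}:\underline{\mathcal{S}}(Y,Z)\otimes\underline{\mathcal{S}}(X,Y)\to\underline{\mathcal{S}}(X,Z)$ of $\mathcal{V}$; and a natural isomorphism $\varphi:\mathcal{S}(-,-)\to\mathcal{V}(I,\underline{\mathcal{S}}(-,-))$; such that (i) $\underline{\bullet}\cdot(\underline{\bullet}\otimes1)=\underline{\bullet}\cdot(1\otimes\underline{\bullet})\cdot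 a$; (ii) for $f\in\mathcal{S}(X,Y)$, $\underline{\mathcal{S}}(f,Z)=\underline{\bullet}\cdot(1\otimes\varphi(f))\cdot r^{-1}$; (iii) for $g\in\mathcal{S}(Y,Z)$, $\underline{\mathcal{S}}(X,g)=\underline{\bullet}\cdot(\varphi(g)\otimes1)\cdot l^{-1}$. The canonical $\mathcal{V}$-structure of a tensor-closed $\mathcal{V}$-module is given by its functor $\underline{\mathcal{S}}(-,-)$, by $\underline{\bullet}_{X,Y,Z}=\phi_{\underline{\mathcal{S}}(Y,Z)\otimes\underline{\mathcal{S}}(X,Y),X,Z}(\epsilon_Z\cdot(1\otimes\epsilon_Y)\cdot a)$, and by $\varphi_{X,Y}(f)=\phi_{I,X,Y}(f\cdot l_X)$. The $\mathcal{V}$-category associated with a category with $\mathcal{V}$-structure has the same objects, hom-objects $\underline{\mathcal{S}}(A,B)$, composition $\underline{\bullet}$, and units $j_A=\varphi(1_A)$. $\mathcal{V}$ itself is a $\mathcal{V}$-category with hom-objects $\underline{\mathcal{V}}(X,Y)$, composition $\pi(\epsilon_Z\cdot(1\otimes\epsilon_Y)\cdot a)$ and units $\varpi(1_X)$. A $\mathcal{V}$-category $\mathcal{S}$ is tensored if for all $K\in\operatorname{ob}\mathcal{V}$, $X\in\operatorname{ob}\mathcal{S}$ there is an object $K\otimes X$ of $\mathcal{S}$ and for all $K,X,Y$ an isomorphism $\underline\phi_{K,X,Y}:\underline{\mathcal{S}}(K\otimes X,Y)\to\underline{\mathcal{V}}(K,\underline{\mathcal{S}}(X,Y))$ of $\mathcal{V}$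 that is $\mathcal{V}$-natural in $Y$, i.e. the family $\varpi(\underline\phi_{K,X,Y})$ is a $\mathcal{V}$-natural transformation from $\underline{\mathcal{S}}(K\otimes X,-)$ to $\underline{\mathcal{V}}(K,-)\cdot\underline{\mathcal{S}}(X,-)$. (For a $\mathcal{V}$-category $\mathcal{A}$, the $\mathcal{V}$-functor $\underline{\mathcal{A}}(A,-):\mathcal{A}\to\mathcal{V}$ is given by $\pi(\underline{\bullet}_{A,B,C}):\underline{\mathcal{A}}(B,C)\to\underline{\mathcal{V}}(\underline{\mathcal{A}}(A,B),\underline{\mathcal{A}}(A,C))$; a $\mathcal{V}$-natural transformation $S\to T:\mathcal{A}\to\mathcal{B}$ is a family $\alpha_A:I\to\underline{\mathcal{B}}(SA,TA)$ with $\underline{\bullet}\cdot(\alpha_B\otimes S_{A,B})\cdot l^{-1}=\underline{\bullet}\cdot(T_{A,B}\otimes\alpha_A)\cdot r^{-1}$.) A cylinder on a category $\mathcal{S}$ with $\mathcal{V}$-structure consists of, for all $K\in\operatorname{ob}\mathcal{V}$, $X\in\operatorname{ob}\mathcal{S}$, an object $K\otimes X$ of $\mathcal{S}$, a morphism $\alpha_{K,X}:K\to\underline{\mathcal{S}}(X,K\otimes X)$ of $\mathcal{V}$, and for all $Y$ an isomorphism $\underline\phi_{K,X,Y}:\underline{\mathcal{S}}(K\otimes X,Y)\to\underline{\mathcal{V}}(K,\underline{\mathcal{S}}(X,Y))$ such that $\epsilon_{\underline{\mathcal{S}}(X,Y)}\cdot(\underline\phi_{K,X,Y}\otimes1)=\underline{\bullet}\cdot(1\otimes\alpha_{K,X})$.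 A $\mathcal{V}$-structure with cylinder means a $\mathcal{V}$-structure together with such data. The correspondence in (1): for a tensor-closed $\mathcal{V}$-module, the tensor $K\otimes X$ is the value of the module functor; $\underline\phi_{K,X,Y}$ is the unique morphism with $\mathcal{V}(L,\underline\phi_{K,X,Y})\cdot\phi_{L,K\otimes X,Y}=\pi_{L,K,\underline{\mathcal{S}}(X,Y)}\cdot\phi_{L\otimes K,X,Y}\cdot a_{L,K,X}^*$ as maps $\mathcal{S}(L\otimes(K\otimes X),Y)\to\mathcal{V}(L,\underline{\mathcal{V}}(K,\underline{\mathcal{S}}(X,Y)))$ for all $L\in\operatorname{ob}\mathcal{V}$ (where $a^*$ is precomposition with $a$); and $\alpha_{K,X}=\varpi^{-1}(\underline\phi_{K,X,K\otimes X}\cdot j_{K\otimes X})$. *)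

theory Defs
  imports Main "HOL-Library.FuncSet"
begin

text \<open>
  Families and functions are elements of (iterated) extensional function spaces \<open>\<Pi>\<^sub>E\<close>: they
  are \<open>undefined\<close> off their index sets.  Hence two structures on the same category that agree
  on their index sets are equal as records, so that ``the set of all structures'' is meaningful.
\<close>

section \<open>Categories and functors\<close>

record ('o, 'm) cat =
  Obj :: "'o set"
  Arr :: "'m set"
  Dom :: "'m \<Rightarrow> 'o"
  Cod :: "'m \<Rightarrow> 'o"
  Ident :: "'o \<Rightarrow> 'm"
  Comp :: "'m \<Rightarrow> 'm \<Rightarrow> 'm"  (infixl "\<cdot>\<index>" 70)

definition hom :: "('o, 'm, 'z) cat_scheme \<Rightarrow> 'o \<Rightarrow> 'o \<Rightarrow> 'm set" where
  "hom C X Y = {f \<in> Arr C. Dom C f = X \<and> Cod C f = Y}"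

locale category =
  fixes C :: "('o, 'm, 'z) cat_scheme" (structure)
  assumes dom_cod: "f \<in> Arr C \<Longrightarrow> Dom C f \<in> Obj C \<and> Cod C f \<in> Obj C"
    and ident_hom: "X \<in> Obj C \<Longrightarrow> Ident C X \<in> hom C X X"
    and comp_hom: "\<lbrakk>f \<in> hom C X Y; g \<in> hom C Y Z\<rbrakk> \<Longrightarrow> g \<cdot> f \<in> hom C X Z"
    and ident_left: "f \<in> hom C X Y \<Longrightarrow> Ident C Y \<cdot> f = f"
    and ident_right: "f \<in> hom C X Y \<Longrightarrow> f \<cdot> Ident C X = f"
    and comp_assoc: "\<lbrakk>f \<in> hom C W X; g \<in> hom C X Y; h \<in> hom C Y Z\<rbrakk>
                       \<Longrightarrow> (h \<cdot> g) \<cdot> f = h \<cdot> (g \<cdot> f)"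

definition op_cat :: "('o, 'm, 'z) cat_scheme \<Rightarrow> ('o, 'm) cat" where
  "op_cat C = \<lparr>Obj = Obj C, Arr = Arr C, Dom = Cod C, Cod = Dom C, Ident = Ident C,
               Comp = (\<lambda>g f. f \<cdot>\<^bsub>C\<^esub> g)\<rparr>"

definition inverse_arrows :: "('o, 'm, 'z) cat_scheme \<Rightarrow> 'm \<Rightarrow> 'm \<Rightarrow> bool" where
  "inverse_arrows C f g \<longleftrightarrow>
     f \<in> Arr C \<and> g \<in> hom C (Cod C f) (Dom C f) \<and>
     g \<cdot>\<^bsub>C\<^esub> f = Ident C (Dom C f) \<and> f \<cdot>\<^bsub>C\<^esub> g = Ident C (Cod C f)"

definition isos :: "('o, 'm, 'z) cat_scheme \<Rightarrow> 'o \<Rightarrow> 'o \<Rightarrow> 'm set" where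
  "isos C X Y = {f \<in> hom C X Y. \<exists>g. inverse_arrows C f g}"

definition cinv :: "('o, 'm, 'z) cat_scheme \<Rightarrow> 'm \<Rightarrow> 'm" where
  "cinv C f = (THE g. inverse_arrows C f g)"

definition is_functor ::
  "('o, 'm, 'z) cat_scheme \<Rightarrow> ('p, 'n, 'y) cat_scheme \<Rightarrow> ('o \<Rightarrow> 'p) \<Rightarrow> ('m \<Rightarrow> 'n) \<Rightarrow> bool" where
  "is_functor C D Fo Fa \<longleftrightarrow>
     Fo \<in> Obj C \<rightarrow>\<^sub>E Obj D \<and>
     Fa \<in> Arr C \<rightarrow>\<^sub>E Arr D \<and>
     (\<forall>X Y. \<forall>f \<in> hom C X Y. Fa f \<in> hom D (Fo X) (Fo Y)) \<and>
     (\<forall>X \<in> Obj C. Fa (Ident C X) = Ident D (Fo X)) \<and>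
     (\<forall>X Y Z. \<forall>f \<in> hom C X Y. \<forall>g \<in> hom C Y Z. Fa (g \<cdot>\<^bsub>C\<^esub> f) = Fa g \<cdot>\<^bsub>D\<^esub> Fa f)"

text \<open>A functor from the product category of \<open>C\<close> and \<open>D\<close> to \<open>E\<close>, in curried form.\<close>

definition bifunctor ::
  "('o, 'm, 'z) cat_scheme \<Rightarrow> ('p, 'n, 'y) cat_scheme \<Rightarrow> ('q, 'k, 'x) cat_scheme
     \<Rightarrow> ('o \<Rightarrow> 'p \<Rightarrow> 'q) \<Rightarrow> ('m \<Rightarrow> 'n \<Rightarrow> 'k) \<Rightarrow> bool" where
  "bifunctor C D E Fo Fa \<longleftrightarrow>
     Fo \<in> Obj C \<rightarrow>\<^sub>E (Obj D \<rightarrow>\<^sub>E Obj E) \<and>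
     Fa \<in> Arr C \<rightarrow>\<^sub>E (Arr D \<rightarrow>\<^sub>E Arr E) \<and>
     (\<forall>X X' Y Y'. \<forall>f \<in> hom C X X'. \<forall>g \<in> hom D Y Y'. Fa f g \<in> hom E (Fo X Y) (Fo X' Y')) \<and>
     (\<forall>X \<in> Obj C. \<forall>Y \<in> Obj D. Fa (Ident C X) (Ident D Y) = Ident E (Fo X Y)) \<and>
     (\<forall>X X' X'' Y Y' Y''.
        \<forall>f \<in> hom C X X'. \<forall>f' \<in> hom C X' X''. \<forall>g \<in> hom D Y Y'. \<forall>g' \<in> hom D Y' Y''.
          Fa (f' \<cdot>\<^bsub>C\<^esub> f) (g' \<cdot>\<^bsub>D\<^esub> g) = Fa f' g' \<cdot>\<^bsub>E\<^esub> Fa f g)"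


section \<open>Closed monoidal categories\<close>

text \<open>\<open>\<otimes>\<close> and \<open>\<boxtimes>\<close> are the tensor product on objects and on morphisms; \<open>IHom V Y\<close> and
  \<open>IHomA V Y\<close> are the object and morphism parts of the right adjoint of \<open>- \<otimes> Y\<close>, and
  \<open>Cur V X Y Z\<close> is the adjunction bijection \<open>\<pi>\<close>.\<close>

record ('o, 'm) cmcat = "('o, 'm) cat" +
  UnitObj :: 'o
  Tens :: "'o \<Rightarrow> 'o \<Rightarrow> 'o"  (infixl "\<otimes>\<index>" 75)
  TensA :: "'m \<Rightarrow> 'm \<Rightarrow> 'm"  (infixl "\<boxtimes>\<index>" 75)
  Assoc :: "'o \<Rightarrow> 'o \<Rightarrow> 'o \<Rightarrow> 'm"
  LUnit :: "'o \<Rightarrow> 'm"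
  RUnit :: "'o \<Rightarrow> 'm"
  IHom :: "'o \<Rightarrow> 'o \<Rightarrow> 'o"
  IHomA :: "'o \<Rightarrow> 'm \<Rightarrow> 'm"
  Cur :: "'o \<Rightarrow> 'o \<Rightarrow> 'o \<Rightarrow> 'm \<Rightarrow> 'm"

locale monoidal_category = category V for V :: "('o, 'm) cmcat" (structure) +
  assumes unit_obj: "UnitObj V \<in> Obj V"
    and tens_bifunctor: "bifunctor V V V (Tens V) (TensA V)"
    and assoc_iso:
      "Assoc V \<in> (\<Pi>\<^sub>E X \<in> Obj V. \<Pi>\<^sub>E Y \<in> Obj V. \<Pi>\<^sub>E Z \<in> Obj V.
                     isos V ((X \<otimes> Y) \<otimes> Z) (X \<otimes> (Y \<otimes> Z)))"
    and assoc_natural: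
      "\<lbrakk>f \<in> hom V X X'; g \<in> hom V Y Y'; h \<in> hom V Z Z'\<rbrakk>
         \<Longrightarrow> Assoc V X' Y' Z' \<cdot> ((f \<boxtimes> g) \<boxtimes> h) = (f \<boxtimes> (g \<boxtimes> h)) \<cdot> Assoc V X Y Z"
    and lunit_iso: "LUnit V \<in> (\<Pi>\<^sub>E X \<in> Obj V. isos V (UnitObj V \<otimes> X) X)"
    and lunit_natural:
      "f \<in> hom V X X' \<Longrightarrow> LUnit V X' \<cdot> (Ident V (UnitObj V) \<boxtimes> f) = f \<cdot> LUnit V X"
    and runit_iso: "RUnit V \<in> (\<Pi>\<^sub>E X \<in> Obj V. isos V (X \<otimes> UnitObj V) X)"
    and runit_natural:
      "f \<in> hom V X X' \<Longrightarrow> RUnit V X' \<cdot> (f \<boxtimes> Ident V (UnitObj V)) = f \<cdot> RUnit V X"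
    and pentagon:
      "\<lbrakk>W \<in> Obj V; X \<in> Obj V; Y \<in> Obj V; Z \<in> Obj V\<rbrakk>
         \<Longrightarrow> Assoc V W X (Y \<otimes> Z) \<cdot> Assoc V (W \<otimes> X) Y Z
           = (Ident V W \<boxtimes> Assoc V X Y Z) \<cdot> Assoc V W (X \<otimes> Y) Z
               \<cdot> (Assoc V W X Y \<boxtimes> Ident V Z)"
    and triangle:
      "\<lbrakk>X \<in> Obj V; Y \<in> Obj V\<rbrakk>
         \<Longrightarrow> (Ident V X \<boxtimes> LUnit V Y) \<cdot> Assoc V X (UnitObj V) Y = RUnit V X \<boxtimes> Ident V Y"

locale closed_monoidal_category = monoidal_category +
  assumes ihom_functor: "Y \<in> Obj V \<Longrightarrow> is_functor V V (IHom V Y) (IHomA V Y)"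
    and cur_hom:
      "Cur V \<in> (\<Pi>\<^sub>E X \<in> Obj V. \<Pi>\<^sub>E Y \<in> Obj V. \<Pi>\<^sub>E Z \<in> Obj V.
                   hom V (X \<otimes> Y) Z \<rightarrow>\<^sub>E hom V X (IHom V Y Z))"
    and cur_bij:
      "\<lbrakk>X \<in> Obj V; Y \<in> Obj V; Z \<in> Obj V\<rbrakk>
         \<Longrightarrow> bij_betw (Cur V X Y Z) (hom V (X \<otimes> Y) Z) (hom V X (IHom V Y Z))"
    and cur_natural:
      "\<lbrakk>h \<in> hom V X' X; Y \<in> Obj V; g \<in> hom V Z Z'; f \<in> hom V (X \<otimes> Y) Z\<rbrakk>
         \<Longrightarrow> Cur V X' Y Z' (g \<cdot> f \<cdot> (h \<boxtimes> Ident V Y)) = IHomA V Y g \<cdot> Cur V X Y Z f \<cdot> h"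

definition ev :: "('o, 'm) cmcat \<Rightarrow> 'o \<Rightarrow> 'o \<Rightarrow> 'm" where
  "ev V Y Z = inv_into (hom V (IHom V Y Z \<otimes>\<^bsub>V\<^esub> Y) Z) (Cur V (IHom V Y Z) Y Z)
                (Ident V (IHom V Y Z))"

definition varpi :: "('o, 'm) cmcat \<Rightarrow> 'o \<Rightarrow> 'o \<Rightarrow> 'm \<Rightarrow> 'm" where
  "varpi V X Y f = Cur V (UnitObj V) X Y (f \<cdot>\<^bsub>V\<^esub> LUnit V X)"

definition varpi_inv :: "('o, 'm) cmcat \<Rightarrow> 'o \<Rightarrow> 'o \<Rightarrow> 'm \<Rightarrow> 'm" where
  "varpi_inv V X Y = inv_into (hom V X Y) (varpi V X Y)"


section \<open>Tensor-closed modules\<close>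

text \<open>The hom functor \<open>S\<^sup>o\<^sup>p \<times> S \<rightarrow> V\<close>, shared by tensor-closed modules and V-structures.\<close>

record ('o, 'm, 'p, 'n) hom_data =
  SHom :: "'p \<Rightarrow> 'p \<Rightarrow> 'o"
  SHomA :: "'n \<Rightarrow> 'n \<Rightarrow> 'm"

record ('o, 'm, 'p, 'n) tcmod = "('o, 'm, 'p, 'n) hom_data" +
  MTens :: "'o \<Rightarrow> 'p \<Rightarrow> 'p"  (infixl "\<odot>\<index>" 75)
  MTensA :: "'m \<Rightarrow> 'n \<Rightarrow> 'n"  (infixl "\<boxdot>\<index>" 75)
  MAssoc :: "'o \<Rightarrow> 'o \<Rightarrow> 'p \<Rightarrow> 'n"
  MLUnit :: "'p \<Rightarrow> 'n"
  MPhi :: "'o \<Rightarrow> 'p \<Rightarrow> 'p \<Rightarrow> 'n \<Rightarrow> 'm"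

locale v_module = V: closed_monoidal_category V + S: category S
  for V :: "('o, 'm) cmcat" and S :: "('p, 'n) cat" +
  fixes M :: "('o, 'm, 'p, 'n) tcmod"
  assumes mtens_bifunctor: "bifunctor V S S (MTens M) (MTensA M)"
    and massoc_iso:
      "MAssoc M \<in> (\<Pi>\<^sub>E K \<in> Obj V. \<Pi>\<^sub>E L \<in> Obj V. \<Pi>\<^sub>E X \<in> Obj S.
                      isos S ((K \<otimes>\<^bsub>V\<^esub> L) \<odot>\<^bsub>M\<^esub> X) (K \<odot>\<^bsub>M\<^esub> (L \<odot>\<^bsub>M\<^esub> X)))"
    and massoc_natural:
      "\<lbrakk>k \<in> hom V K K'; l \<in> hom V L L'; x \<in> hom S X X'\<rbrakk>
         \<Longrightarrow> MAssoc M K' L' X' \<cdot>\<^bsub>S\<^esub> ((k \<boxtimes>\<^bsub>V\<^esub> l) \<boxdot>\<^bsub>M\<^esub> x)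
           = (k \<boxdot>\<^bsub>M\<^esub> (l \<boxdot>\<^bsub>M\<^esub> x)) \<cdot>\<^bsub>S\<^esub> MAssoc M K L X"
    and mlunit_iso: "MLUnit M \<in> (\<Pi>\<^sub>E X \<in> Obj S. isos S (UnitObj V \<odot>\<^bsub>M\<^esub> X) X)"
    and mlunit_natural:
      "x \<in> hom S X X'
         \<Longrightarrow> MLUnit M X' \<cdot>\<^bsub>S\<^esub> (Ident V (UnitObj V) \<boxdot>\<^bsub>M\<^esub> x) = x \<cdot>\<^bsub>S\<^esub> MLUnit M X"
    and mpentagon:
      "\<lbrakk>K \<in> Obj V; L \<in> Obj V; N \<in> Obj V; X \<in> Obj S\<rbrakk>
         \<Longrightarrow> MAssoc M K L (N \<odot>\<^bsub>M\<^esub> X) \<cdot>\<^bsub>S\<^esub> MAssoc M (K \<otimes>\<^bsub>V\<^esub> L) N X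
           = (Ident V K \<boxdot>\<^bsub>M\<^esub> MAssoc M L N X) \<cdot>\<^bsub>S\<^esub> MAssoc M K (L \<otimes>\<^bsub>V\<^esub> N) X
               \<cdot>\<^bsub>S\<^esub> (Assoc V K L N \<boxdot>\<^bsub>M\<^esub> Ident S X)"
    and mtriangle:
      "\<lbrakk>K \<in> Obj V; X \<in> Obj S\<rbrakk>
         \<Longrightarrow> (Ident V K \<boxdot>\<^bsub>M\<^esub> MLUnit M X) \<cdot>\<^bsub>S\<^esub> MAssoc M K (UnitObj V) X
           = RUnit V K \<boxdot>\<^bsub>M\<^esub> Ident S X"

locale tensor_closed_module = v_module +
  assumes shom_bifunctor: "bifunctor (op_cat S) S V (SHom M) (SHomA M)"
    and mphi_hom:
      "MPhi M \<in> (\<Pi>\<^sub>E K \<in> Obj V. \<Pi>\<^sub>E X \<in> Obj S. \<Pi>\<^sub>E Y \<in> Obj S.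
                    hom S (K \<odot>\<^bsub>M\<^esub> X) Y \<rightarrow>\<^sub>E hom V K (SHom M X Y))"
    and mphi_bij:
      "\<lbrakk>K \<in> Obj V; X \<in> Obj S; Y \<in> Obj S\<rbrakk>
         \<Longrightarrow> bij_betw (MPhi M K X Y) (hom S (K \<odot>\<^bsub>M\<^esub> X) Y) (hom V K (SHom M X Y))"
    and mphi_natural:
      "\<lbrakk>k \<in> hom V K' K; x \<in> hom S X' X; y \<in> hom S Y Y'; f \<in> hom S (K \<odot>\<^bsub>M\<^esub> X) Y\<rbrakk>
         \<Longrightarrow> MPhi M K' X' Y' (y \<cdot>\<^bsub>S\<^esub> f \<cdot>\<^bsub>S\<^esub> (k \<boxdot>\<^bsub>M\<^esub> x))
           = SHomA M x y \<cdot>\<^bsub>V\<^esub> MPhi M K X Y f \<cdot>\<^bsub>V\<^esub> k"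

definition mev ::
  "('o, 'm) cmcat \<Rightarrow> ('p, 'n) cat \<Rightarrow> ('o, 'm, 'p, 'n) tcmod \<Rightarrow> 'p \<Rightarrow> 'p \<Rightarrow> 'n" where
  "mev V S M X Y = inv_into (hom S (SHom M X Y \<odot>\<^bsub>M\<^esub> X) Y) (MPhi M (SHom M X Y) X Y)
                     (Ident V (SHom M X Y))"


section \<open>V-structures\<close>

text \<open>\<open>VComp A X Y Z\<close> is the composition and \<open>VPhi A X Y\<close> the bijection \<open>\<phi>\<close> from
  \<open>S(X,Y)\<close> to the morphisms from the unit object to the hom object.\<close>

record ('o, 'm, 'p, 'n) vstruct = "('o, 'm, 'p, 'n) hom_data" +
  VComp :: "'p \<Rightarrow> 'p \<Rightarrow> 'p \<Rightarrow> 'm"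
  VPhi :: "'p \<Rightarrow> 'p \<Rightarrow> 'n \<Rightarrow> 'm"

locale v_structure = V: closed_monoidal_category V + S: category S
  for V :: "('o, 'm) cmcat" and S :: "('p, 'n) cat" +
  fixes A :: "('o, 'm, 'p, 'n, 'z) vstruct_scheme"
  assumes shom_bifunctor: "bifunctor (op_cat S) S V (SHom A) (SHomA A)"
    and vcomp_hom:
      "VComp A \<in> (\<Pi>\<^sub>E X \<in> Obj S. \<Pi>\<^sub>E Y \<in> Obj S. \<Pi>\<^sub>E Z \<in> Obj S.
                     hom V (SHom A Y Z \<otimes>\<^bsub>V\<^esub> SHom A X Y) (SHom A X Z))"
    and vphi_hom:
      "VPhi A \<in> (\<Pi>\<^sub>E X \<in> Obj S. \<Pi>\<^sub>E Y \<in> Obj S. hom S X Y \<rightarrow>\<^sub>E hom V (UnitObj V) (SHom A X Y))"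
    and vphi_bij:
      "\<lbrakk>X \<in> Obj S; Y \<in> Obj S\<rbrakk>
         \<Longrightarrow> bij_betw (VPhi A X Y) (hom S X Y) (hom V (UnitObj V) (SHom A X Y))"
    and vphi_natural:
      "\<lbrakk>x \<in> hom S X' X; y \<in> hom S Y Y'; f \<in> hom S X Y\<rbrakk>
         \<Longrightarrow> VPhi A X' Y' (y \<cdot>\<^bsub>S\<^esub> f \<cdot>\<^bsub>S\<^esub> x) = SHomA A x y \<cdot>\<^bsub>V\<^esub> VPhi A X Y f"
    and vcomp_assoc:
      "\<lbrakk>W \<in> Obj S; X \<in> Obj S; Y \<in> Obj S; Z \<in> Obj S\<rbrakk>
         \<Longrightarrow> VComp A W X Z \<cdot>\<^bsub>V\<^esub> (VComp A X Y Z \<boxtimes>\<^bsub>V\<^esub> Ident V (SHom A W X))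
           = VComp A W Y Z \<cdot>\<^bsub>V\<^esub> (Ident V (SHom A Y Z) \<boxtimes>\<^bsub>V\<^esub> VComp A W X Y)
               \<cdot>\<^bsub>V\<^esub> Assoc V (SHom A Y Z) (SHom A X Y) (SHom A W X)"
    and shoma_left:
      "\<lbrakk>f \<in> hom S X Y; Z \<in> Obj S\<rbrakk>
         \<Longrightarrow> SHomA A f (Ident S Z)
           = VComp A X Y Z \<cdot>\<^bsub>V\<^esub> (Ident V (SHom A Y Z) \<boxtimes>\<^bsub>V\<^esub> VPhi A X Y f)
               \<cdot>\<^bsub>V\<^esub> cinv V (RUnit V (SHom A Y Z))"
    and shoma_right:
      "\<lbrakk>X \<in> Obj S; g \<in> hom S Y Z\<rbrakk>
         \<Longrightarrow> SHomA A (Ident S X) g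
           = VComp A X Y Z \<cdot>\<^bsub>V\<^esub> (VPhi A Y Z g \<boxtimes>\<^bsub>V\<^esub> Ident V (SHom A X Y))
               \<cdot>\<^bsub>V\<^esub> cinv V (LUnit V (SHom A X Y))"

definition canonical ::
  "('o, 'm) cmcat \<Rightarrow> ('p, 'n) cat \<Rightarrow> ('o, 'm, 'p, 'n) tcmod \<Rightarrow> ('o, 'm, 'p, 'n) vstruct" where
  "canonical V S M =
     \<lparr>SHom = SHom M, SHomA = SHomA M,
      VComp = (\<lambda>X \<in> Obj S. \<lambda>Y \<in> Obj S. \<lambda>Z \<in> Obj S.
        MPhi M (SHom M Y Z \<otimes>\<^bsub>V\<^esub> SHom M X Y) X Z
          (mev V S M Y Z \<cdot>\<^bsub>S\<^esub> (Ident V (SHom M Y Z) \<boxdot>\<^bsub>M\<^esub> mev V S M X Y)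
             \<cdot>\<^bsub>S\<^esub> MAssoc M (SHom M Y Z) (SHom M X Y) X)),
      VPhi = (\<lambda>X \<in> Obj S. \<lambda>Y \<in> Obj S. \<lambda>f \<in> hom S X Y.
        MPhi M (UnitObj V) X Y (f \<cdot>\<^bsub>S\<^esub> MLUnit M X))\<rparr>"


section \<open>V-categories\<close>

record ('o, 'm, 'p) vcat =
  VObj :: "'p set"
  VHom :: "'p \<Rightarrow> 'p \<Rightarrow> 'o"
  VCmp :: "'p \<Rightarrow> 'p \<Rightarrow> 'p \<Rightarrow> 'm"
  VUnit :: "'p \<Rightarrow> 'm"

definition v_category :: "('o, 'm) cmcat \<Rightarrow> ('o, 'm, 'p) vcat \<Rightarrow> bool" where
  "v_category V A \<longleftrightarrow>
     (\<forall>X \<in> VObj A. \<forall>Y \<in> VObj A. VHom A X Y \<in> Obj V) \<and>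
     (\<forall>X \<in> VObj A. \<forall>Y \<in> VObj A. \<forall>Z \<in> VObj A.
        VCmp A X Y Z \<in> hom V (VHom A Y Z \<otimes>\<^bsub>V\<^esub> VHom A X Y) (VHom A X Z)) \<and>
     (\<forall>X \<in> VObj A. VUnit A X \<in> hom V (UnitObj V) (VHom A X X)) \<and>
     (\<forall>W \<in> VObj A. \<forall>X \<in> VObj A. \<forall>Y \<in> VObj A. \<forall>Z \<in> VObj A.
        VCmp A W X Z \<cdot>\<^bsub>V\<^esub> (VCmp A X Y Z \<boxtimes>\<^bsub>V\<^esub> Ident V (VHom A W X))
          = VCmp A W Y Z \<cdot>\<^bsub>V\<^esub> (Ident V (VHom A Y Z) \<boxtimes>\<^bsub>V\<^esub> VCmp A W X Y)
              \<cdot>\<^bsub>V\<^esub> Assoc V (VHom A Y Z) (VHom A X Y) (VHom A W X)) \<and>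
     (\<forall>X \<in> VObj A. \<forall>Y \<in> VObj A.
        VCmp A X Y Y \<cdot>\<^bsub>V\<^esub> (VUnit A Y \<boxtimes>\<^bsub>V\<^esub> Ident V (VHom A X Y)) = LUnit V (VHom A X Y) \<and>
        VCmp A X X Y \<cdot>\<^bsub>V\<^esub> (Ident V (VHom A X Y) \<boxtimes>\<^bsub>V\<^esub> VUnit A X) = RUnit V (VHom A X Y))"

definition associated_vcat ::
  "('p, 'n) cat \<Rightarrow> ('o, 'm, 'p, 'n, 'z) vstruct_scheme \<Rightarrow> ('o, 'm, 'p) vcat" where
  "associated_vcat S A =
     \<lparr>VObj = Obj S, VHom = SHom A, VCmp = VComp A, VUnit = (\<lambda>X. VPhi A X X (Ident S X))\<rparr>"

text \<open>\<open>V\<close> as a V-category.\<close>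

definition self_vcat :: "('o, 'm) cmcat \<Rightarrow> ('o, 'm, 'o) vcat" where
  "self_vcat V =
     \<lparr>VObj = Obj V, VHom = IHom V,
      VCmp = (\<lambda>X Y Z. Cur V (IHom V Y Z \<otimes>\<^bsub>V\<^esub> IHom V X Y) X Z
        (ev V Y Z \<cdot>\<^bsub>V\<^esub> (Ident V (IHom V Y Z) \<boxtimes>\<^bsub>V\<^esub> ev V X Y)
           \<cdot>\<^bsub>V\<^esub> Assoc V (IHom V Y Z) (IHom V X Y) X)),
      VUnit = (\<lambda>X. varpi V X X (Ident V X))\<rparr>"

record ('m, 'p, 'q) vfunctor =
  FObj :: "'p \<Rightarrow> 'q"
  FHom :: "'p \<Rightarrow> 'p \<Rightarrow> 'm"

definition v_functor ::
  "('o, 'm) cmcat \<Rightarrow> ('o, 'm, 'p) vcat \<Rightarrow> ('o, 'm, 'q) vcat \<Rightarrow> ('m, 'p, 'q) vfunctor \<Rightarrow> bool" where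
  "v_functor V A B F \<longleftrightarrow>
     v_category V A \<and> v_category V B \<and>
     (\<forall>X \<in> VObj A. FObj F X \<in> VObj B) \<and>
     (\<forall>X \<in> VObj A. \<forall>Y \<in> VObj A.
        FHom F X Y \<in> hom V (VHom A X Y) (VHom B (FObj F X) (FObj F Y))) \<and>
     (\<forall>X \<in> VObj A. \<forall>Y \<in> VObj A. \<forall>Z \<in> VObj A.
        FHom F X Z \<cdot>\<^bsub>V\<^esub> VCmp A X Y Z
          = VCmp B (FObj F X) (FObj F Y) (FObj F Z) \<cdot>\<^bsub>V\<^esub> (FHom F Y Z \<boxtimes>\<^bsub>V\<^esub> FHom F X Y)) \<and>
     (\<forall>X \<in> VObj A. FHom F X X \<cdot>\<^bsub>V\<^esub> VUnit A X = VUnit B (FObj F X))"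

definition vfunctor_comp ::
  "('o, 'm) cmcat \<Rightarrow> ('m, 'q, 'r) vfunctor \<Rightarrow> ('m, 'p, 'q) vfunctor \<Rightarrow> ('m, 'p, 'r) vfunctor" where
  "vfunctor_comp V G F =
     \<lparr>FObj = (\<lambda>X. FObj G (FObj F X)),
      FHom = (\<lambda>X Y. FHom G (FObj F X) (FObj F Y) \<cdot>\<^bsub>V\<^esub> FHom F X Y)\<rparr>"

text \<open>The V-functor \<open>A(X,-)\<close> from \<open>A\<close> to \<open>V\<close>.\<close>

definition representable ::
  "('o, 'm) cmcat \<Rightarrow> ('o, 'm, 'p) vcat \<Rightarrow> 'p \<Rightarrow> ('m, 'p, 'o) vfunctor" where
  "representable V A X =
     \<lparr>FObj = VHom A X,
      FHom = (\<lambda>Y Z. Cur V (VHom A Y Z) (VHom A X Y) (VHom A X Z) (VCmp A X Y Z))\<rparr>"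

definition v_natural ::
  "('o, 'm) cmcat \<Rightarrow> ('o, 'm, 'p) vcat \<Rightarrow> ('o, 'm, 'q) vcat
     \<Rightarrow> ('m, 'p, 'q) vfunctor \<Rightarrow> ('m, 'p, 'q) vfunctor \<Rightarrow> ('p \<Rightarrow> 'm) \<Rightarrow> bool" where
  "v_natural V A B F G \<alpha> \<longleftrightarrow>
     v_functor V A B F \<and> v_functor V A B G \<and>
     (\<forall>X \<in> VObj A. \<alpha> X \<in> hom V (UnitObj V) (VHom B (FObj F X) (FObj G X))) \<and>
     (\<forall>X \<in> VObj A. \<forall>Y \<in> VObj A.
        VCmp B (FObj F X) (FObj F Y) (FObj G Y) \<cdot>\<^bsub>V\<^esub> (\<alpha> Y \<boxtimes>\<^bsub>V\<^esub> FHom F X Y)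
            \<cdot>\<^bsub>V\<^esub> cinv V (LUnit V (VHom A X Y))
          = VCmp B (FObj F X) (FObj G X) (FObj G Y) \<cdot>\<^bsub>V\<^esub> (FHom G X Y \<boxtimes>\<^bsub>V\<^esub> \<alpha> X)
              \<cdot>\<^bsub>V\<^esub> cinv V (RUnit V (VHom A X Y)))"

text \<open>\<open>T K X\<close> is the tensor of \<open>K\<close> and \<open>X\<close>, and \<open>\<Phi> K X Y\<close> the isomorphism from
  \<open>A(T K X, Y)\<close> to \<open>V(K, A(X,Y))\<close>.\<close>

definition tensoring ::
  "('o, 'm) cmcat \<Rightarrow> ('o, 'm, 'p) vcat \<Rightarrow> ('o \<Rightarrow> 'p \<Rightarrow> 'p) \<Rightarrow> ('o \<Rightarrow> 'p \<Rightarrow> 'p \<Rightarrow> 'm) \<Rightarrow> bool" where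
  "tensoring V A T \<Phi> \<longleftrightarrow>
     (\<forall>K \<in> Obj V. \<forall>X \<in> VObj A.
        T K X \<in> VObj A \<and>
        (\<forall>Y \<in> VObj A. \<Phi> K X Y \<in> isos V (VHom A (T K X) Y) (IHom V K (VHom A X Y))) \<and>
        v_natural V A (self_vcat V)
          (representable V A (T K X))
          (vfunctor_comp V (representable V (self_vcat V) K) (representable V A X))
          (\<lambda>Y. varpi V (VHom A (T K X) Y) (IHom V K (VHom A X Y)) (\<Phi> K X Y)))"

definition tensored :: "('o, 'm) cmcat \<Rightarrow> ('o, 'm, 'p) vcat \<Rightarrow> bool" where
  "tensored V A \<longleftrightarrow> v_category V A \<and> (\<exists>T \<Phi>. tensoring V A T \<Phi>)"


section \<open>Cylinders\<close>

definition is_cylinder ::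
  "('o, 'm) cmcat \<Rightarrow> ('p, 'n) cat \<Rightarrow> ('o, 'm, 'p, 'n, 'z) vstruct_scheme
     \<Rightarrow> ('o \<Rightarrow> 'p \<Rightarrow> 'p) \<Rightarrow> ('o \<Rightarrow> 'p \<Rightarrow> 'm) \<Rightarrow> ('o \<Rightarrow> 'p \<Rightarrow> 'p \<Rightarrow> 'm) \<Rightarrow> bool" where
  "is_cylinder V S A T \<alpha> \<Phi> \<longleftrightarrow>
     T \<in> Obj V \<rightarrow>\<^sub>E (Obj S \<rightarrow>\<^sub>E Obj S) \<and>
     \<alpha> \<in> (\<Pi>\<^sub>E K \<in> Obj V. \<Pi>\<^sub>E X \<in> Obj S. hom V K (SHom A X (T K X))) \<and>
     \<Phi> \<in> (\<Pi>\<^sub>E K \<in> Obj V. \<Pi>\<^sub>E X \<in> Obj S. \<Pi>\<^sub>E Y \<in> Obj S.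
            isos V (SHom A (T K X) Y) (IHom V K (SHom A X Y))) \<and>
     (\<forall>K \<in> Obj V. \<forall>X \<in> Obj S. \<forall>Y \<in> Obj S.
        ev V K (SHom A X Y) \<cdot>\<^bsub>V\<^esub> (\<Phi> K X Y \<boxtimes>\<^bsub>V\<^esub> Ident V K)
          = VComp A X (T K X) Y \<cdot>\<^bsub>V\<^esub> (Ident V (SHom A (T K X) Y) \<boxtimes>\<^bsub>V\<^esub> \<alpha> K X))"

definition has_cylinder ::
  "('o, 'm) cmcat \<Rightarrow> ('p, 'n) cat \<Rightarrow> ('o, 'm, 'p, 'n, 'z) vstruct_scheme \<Rightarrow> bool" where
  "has_cylinder V S A \<longleftrightarrow> (\<exists>T \<alpha> \<Phi>. is_cylinder V S A T \<alpha> \<Phi>)"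

record ('o, 'm, 'p, 'n) cylstruct = "('o, 'm, 'p, 'n) vstruct" +
  CTens :: "'o \<Rightarrow> 'p \<Rightarrow> 'p"
  CAlpha :: "'o \<Rightarrow> 'p \<Rightarrow> 'm"
  CPhi :: "'o \<Rightarrow> 'p \<Rightarrow> 'p \<Rightarrow> 'm"

definition v_structure_with_cylinder ::
  "('o, 'm) cmcat \<Rightarrow> ('p, 'n) cat \<Rightarrow> ('o, 'm, 'p, 'n) cylstruct \<Rightarrow> bool" where
  "v_structure_with_cylinder V S A \<longleftrightarrow>
     v_structure V S A \<and> is_cylinder V S A (CTens A) (CAlpha A) (CPhi A)"


section \<open>From tensor-closed modules to V-structures with cylinder\<close>

definition is_uphi ::
  "('o, 'm) cmcat \<Rightarrow> ('p, 'n) cat \<Rightarrow> ('o, 'm, 'p, 'n) tcmod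
     \<Rightarrow> 'o \<Rightarrow> 'p \<Rightarrow> 'p \<Rightarrow> 'm \<Rightarrow> bool" where
  "is_uphi V S M K X Y p \<longleftrightarrow>
     p \<in> hom V (SHom M (K \<odot>\<^bsub>M\<^esub> X) Y) (IHom V K (SHom M X Y)) \<and>
     (\<forall>L \<in> Obj V. \<forall>h \<in> hom S (L \<odot>\<^bsub>M\<^esub> (K \<odot>\<^bsub>M\<^esub> X)) Y.
        p \<cdot>\<^bsub>V\<^esub> MPhi M L (K \<odot>\<^bsub>M\<^esub> X) Y h
          = Cur V L K (SHom M X Y) (MPhi M (L \<otimes>\<^bsub>V\<^esub> K) X Y (h \<cdot>\<^bsub>S\<^esub> MAssoc M L K X)))"

definition uphi ::
  "('o, 'm) cmcat \<Rightarrow> ('p, 'n) cat \<Rightarrow> ('o, 'm, 'p, 'n) tcmod \<Rightarrow> 'o \<Rightarrow> 'p \<Rightarrow> 'p \<Rightarrow> 'm" where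
  "uphi V S M = (\<lambda>K \<in> Obj V. \<lambda>X \<in> Obj S. \<lambda>Y \<in> Obj S. THE p. is_uphi V S M K X Y p)"

definition ualpha ::
  "('o, 'm) cmcat \<Rightarrow> ('p, 'n) cat \<Rightarrow> ('o, 'm, 'p, 'n) tcmod \<Rightarrow> 'o \<Rightarrow> 'p \<Rightarrow> 'm" where
  "ualpha V S M = (\<lambda>K \<in> Obj V. \<lambda>X \<in> Obj S.
     varpi_inv V K (SHom M X (K \<odot>\<^bsub>M\<^esub> X))
       (uphi V S M K X (K \<odot>\<^bsub>M\<^esub> X)
          \<cdot>\<^bsub>V\<^esub> VUnit (associated_vcat S (canonical V S M)) (K \<odot>\<^bsub>M\<^esub> X)))"

definition canonical_with_cylinder ::
  "('o, 'm) cmcat \<Rightarrow> ('p, 'n) cat \<Rightarrow> ('o, 'm, 'p, 'n) tcmod \<Rightarrow> ('o, 'm, 'p, 'n) cylstruct" where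
  "canonical_with_cylinder V S M =
     vstruct.extend (canonical V S M)
       (cylstruct.fields (MTens M) (ualpha V S M) (uphi V S M))"

end

theory Submission
  imports Defs
begin

text \<open>
  For \<open>u : P \<rightarrow> S(Y,Z)\<close> and \<open>v : Q \<rightarrow> S(X,Y)\<close> write \<open>u \<circ> v : P \<otimes> Q \<rightarrow> S(X,Z)\<close> for their composite with
  the composition of a V-structure.  This operation is associative up to \<open>a\<close>, and the laws (ii) and
  (iii), with the coherence isomorphisms cancelled, let a morphism of \<open>S\<close> be moved freely across it.

  In a tensor-closed module, \<open>\<phi>(f) \<circ> \<phi>(g) = \<phi>(f \<cdot> (1 \<otimes> g) \<cdot> a)\<close>; this gives the V-structure axioms, and
  the cylinder turns out to be \<open>\<alpha> = \<phi>(1)\<close>.  Invertibility of \<open>\<Phi>\<close> is the Yoneda lemma.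

  Conversely, for a cylinder, \<open>\<Phi> \<cdot> u\<close> is the transpose of \<open>u \<circ> \<alpha>\<close>.  So \<open>f \<mapsto> S(1,f) \<cdot> \<alpha>\<close> is a bijection
  from \<open>S(K \<otimes> X, Y)\<close> to \<open>V(K, S(X,Y))\<close>, i.e. \<open>\<alpha>\<close> is universal, and the module structure is forced:
  its data are the unique morphisms with \<open>S(1,k \<otimes> x) \<cdot> \<alpha> = S(x,1) \<cdot> \<alpha> \<cdot> k\<close>, \<open>S(1,a) \<cdot> \<alpha> = \<alpha> \<circ> \<alpha>\<close> and
  \<open>S(1,l) \<cdot> \<alpha> = j\<close>.  Every module axiom is then checked after applying this bijection.
\<close>

section \<open>Categories, monoidal categories and their actions\<close>

text \<open>The monoidal category V acts on itself by its own tensor product, so the composition of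
  V as a V-category and the composition of a tensor-closed module are two instances of one
  construction. The calculus of transposes is therefore developed once, for an abstract closed
  action, in which transposition is only asked to be natural in the first variable K: V comes with a
  right adjoint of each functor - \<otimes> Y separately, not with a hom functor of two variables.
  In the absence of a symmetry, left and right units need separate coherence laws. The identity for
  l holds for every action; its mirror image for r makes sense for V only and gets its own proof.
  Both are used, since law (iii) brings in l and law (ii) brings in r. The two passages are inverse
  on the nose because, in any tensor-closed module, phi(f) = S(1,f) . phi(1). Hence \<alpha> =
  phi(1) already remembers phi, and the injectivity of phi identifies all the remaining data.
  Equality of the records then follows by extensionality of families over their index sets.\<close>

lemma in_hom_iff: "f \<in> hom C X Y \<longleftrightarrow> f \<in> Arr C \<and> Dom C f = X \<and> Cod C f = Y"
  by (auto simp: hom_def)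

text \<open>Typing is phrased through \<open>Dom\<close> and \<open>Cod\<close> rather than
  hom-sets, so that the simplifier can compute it. The last rule is oriented to merge two
  consecutive arrows into one.\<close>

lemma bifunctorD:
  assumes "bifunctor C D E Fo Fa"
  shows "\<lbrakk>X \<in> Obj C; Y \<in> Obj D\<rbrakk> \<Longrightarrow> Fo X Y \<in> Obj E"
    and "\<lbrakk>f \<in> Arr C; g \<in> Arr D\<rbrakk> \<Longrightarrow> Fa f g \<in> Arr E"
    and "\<lbrakk>f \<in> Arr C; g \<in> Arr D\<rbrakk> \<Longrightarrow> Dom E (Fa f g) = Fo (Dom C f) (Dom D g)"
    and "\<lbrakk>f \<in> Arr C; g \<in> Arr D\<rbrakk> \<Longrightarrow> Cod E (Fa f g) = Fo (Cod C f) (Cod D g)"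
    and "\<lbrakk>X \<in> Obj C; Y \<in> Obj D\<rbrakk> \<Longrightarrow> Fa (Ident C X) (Ident D Y) = Ident E (Fo X Y)"
    and "\<lbrakk>f \<in> Arr C; f' \<in> Arr C; Dom C f' = Cod C f; g \<in> Arr D; g' \<in> Arr D; Dom D g' = Cod D g\<rbrakk>
      \<Longrightarrow> Fa f' g' \<cdot>\<^bsub>E\<^esub> Fa f g = Fa (f' \<cdot>\<^bsub>C\<^esub> f) (g' \<cdot>\<^bsub>D\<^esub> g)"
proof -
  note b = assms[unfolded bifunctor_def]
  have hm: "Fa f g \<in> hom E (Fo X Y) (Fo X' Y')" if "f \<in> hom C X X'" "g \<in> hom D Y Y'" for f g X Y X' Y'
    using b that by blast
  show "\<lbrakk>X \<in> Obj C; Y \<in> Obj D\<rbrakk> \<Longrightarrow> Fo X Y \<in> Obj E" using b by auto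
  show "\<lbrakk>f \<in> Arr C; g \<in> Arr D\<rbrakk> \<Longrightarrow> Fa f g \<in> Arr E"
    and "\<lbrakk>f \<in> Arr C; g \<in> Arr D\<rbrakk> \<Longrightarrow> Dom E (Fa f g) = Fo (Dom C f) (Dom D g)"
    and "\<lbrakk>f \<in> Arr C; g \<in> Arr D\<rbrakk> \<Longrightarrow> Cod E (Fa f g) = Fo (Cod C f) (Cod D g)"
    using hm[of f "Dom C f" "Cod C f" g "Dom D g" "Cod D g"] by (auto simp: in_hom_iff)
  show "\<lbrakk>X \<in> Obj C; Y \<in> Obj D\<rbrakk> \<Longrightarrow> Fa (Ident C X) (Ident D Y) = Ident E (Fo X Y)"
    using b by auto
  have cmp: "\<forall>X X' X'' Y Y' Y''.
        \<forall>f \<in> hom C X X'. \<forall>f' \<in> hom C X' X''. \<forall>g \<in> hom D Y Y'. \<forall>g' \<in> hom D Y' Y''.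
          Fa (f' \<cdot>\<^bsub>C\<^esub> f) (g' \<cdot>\<^bsub>D\<^esub> g) = Fa f' g' \<cdot>\<^bsub>E\<^esub> Fa f g"
    using b by (elim conjE)
  show "Fa f' g' \<cdot>\<^bsub>E\<^esub> Fa f g = Fa (f' \<cdot>\<^bsub>C\<^esub> f) (g' \<cdot>\<^bsub>D\<^esub> g)"
    if "f \<in> Arr C" "f' \<in> Arr C" "Dom C f' = Cod C f" "g \<in> Arr D" "g' \<in> Arr D" "Dom D g' = Cod D g"
    using cmp that
      bspec[OF bspec[OF bspec[OF bspec[OF cmp[THEN spec, THEN spec, THEN spec, THEN spec, THEN spec, THEN spec]]]],
        of f "Dom C f" "Cod C f" f' "Cod C f'" g "Dom D g" "Cod D g" g' "Cod D g'"]
    by (auto simp: in_hom_iff)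
qed

lemma PiE2_mem: "f \<in> (\<Pi>\<^sub>E x \<in> A. \<Pi>\<^sub>E y \<in> B x. C x y) \<Longrightarrow> x \<in> A \<Longrightarrow> y \<in> B x \<Longrightarrow> f x y \<in> C x y"
  by (meson PiE_mem)

lemma PiE3_mem:
  "f \<in> (\<Pi>\<^sub>E x \<in> A. \<Pi>\<^sub>E y \<in> B. \<Pi>\<^sub>E z \<in> C. D x y z) \<Longrightarrow> x \<in> A \<Longrightarrow> y \<in> B \<Longrightarrow> z \<in> C \<Longrightarrow> f x y z \<in> D x y z"
  by (meson PiE_mem)

section \<open>Calculus of composites and isomorphisms in a category\<close>

context category
begin

lemma arr_simps [simp]:
  assumes "f \<in> Arr C"
  shows "Dom C f \<in> Obj C" "Cod C f \<in> Obj C"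
  using dom_cod[OF assms] by auto

lemma hom_facts:
  assumes "f \<in> hom C X Y"
  shows "f \<in> Arr C" "Dom C f = X" "Cod C f = Y" "X \<in> Obj C" "Y \<in> Obj C"
  using assms dom_cod by (auto simp: hom_def)

lemma ident_simps [simp]:
  assumes "X \<in> Obj C"
  shows "Ident C X \<in> Arr C" "Dom C (Ident C X) = X" "Cod C (Ident C X) = X"
  using ident_hom[OF assms] by (auto simp: hom_def)

lemma comp_simps [simp]:
  assumes "f \<in> Arr C" "g \<in> Arr C" "Dom C g = Cod C f"
  shows "g \<cdot> f \<in> Arr C" "Dom C (g \<cdot> f) = Dom C f" "Cod C (g \<cdot> f) = Cod C g"
  using comp_hom[of f "Dom C f" "Cod C f" g "Cod C g"] assms by (auto simp: hom_def)

lemma ident_comp [simp]: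
  assumes "f \<in> Arr C"
  shows "Cod C f = X \<Longrightarrow> Ident C X \<cdot> f = f" "Dom C f = X \<Longrightarrow> f \<cdot> Ident C X = f"
  using ident_left[of f "Dom C f"] ident_right[of f _ "Cod C f"] assms by (auto simp: hom_def)

lemma assoc [simp]:
  assumes "f \<in> Arr C" "g \<in> Arr C" "h \<in> Arr C" "Dom C g = Cod C f" "Dom C h = Cod C g"
  shows "(h \<cdot> g) \<cdot> f = h \<cdot> (g \<cdot> f)"
  using comp_assoc[of f "Dom C f" "Cod C f" g "Cod C g" h "Cod C h"] assms by (auto simp: hom_def)

text \<open>With \<open>assoc\<close> as a rewrite rule, composites are nested to the right, and an
  equation between two-factor composites no longer matches once a further factor follows. This is
  the form that does.\<close>

lemma reassoc:
  assumes "g \<cdot> f = g' \<cdot> f'"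
    and "f \<in> Arr C" "g \<in> Arr C" "Dom C g = Cod C f"
    and "f' \<in> Arr C" "g' \<in> Arr C" "Dom C g' = Cod C f'"
    and "h \<in> Arr C" "Dom C f = Cod C h" "Dom C f' = Cod C h"
  shows "g \<cdot> (f \<cdot> h) = g' \<cdot> (f' \<cdot> h)"
proof -
  have "g \<cdot> (f \<cdot> h) = (g \<cdot> f) \<cdot> h" using assms(2-) by (intro assoc[symmetric]) auto
  also have "\<dots> = g' \<cdot> (f' \<cdot> h)" unfolding assms(1) using assms(2-) by (intro assoc) auto
  finally show ?thesis .
qed

lemma inverse_arrows_unique:
  assumes "inverse_arrows C f g" "inverse_arrows C f h"
  shows "g = h"
proof -
  have *: "f \<in> Arr C" "g \<in> Arr C" "h \<in> Arr C" "Dom C g = Cod C f" "Cod C g = Dom C f"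
    "Dom C h = Cod C f" "Cod C h = Dom C f"
    "g \<cdot> f = Ident C (Dom C f)" "f \<cdot> g = Ident C (Cod C f)"
    "h \<cdot> f = Ident C (Dom C f)" "f \<cdot> h = Ident C (Cod C f)"
    using assms by (auto simp: inverse_arrows_def in_hom_iff)
  have "g = g \<cdot> (f \<cdot> h)" using * by (metis ident_comp(2))
  also have "\<dots> = (g \<cdot> f) \<cdot> h" using * by (intro assoc[symmetric]) auto
  also have "\<dots> = h" using * by simp
  finally show ?thesis .
qed

lemma cinv_inverse: "inverse_arrows C f g \<Longrightarrow> inverse_arrows C f (cinv C f)"
  unfolding cinv_def by (rule theI) (auto intro: inverse_arrows_unique)

lemma iso_facts:
  assumes "f \<in> isos C X Y"
  shows "f \<in> Arr C" "Dom C f = X" "Cod C f = Y"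
    "cinv C f \<in> Arr C" "Dom C (cinv C f) = Y" "Cod C (cinv C f) = X"
    "cinv C f \<cdot> f = Ident C X" "f \<cdot> cinv C f = Ident C Y" "X \<in> Obj C" "Y \<in> Obj C"
proof -
  show a: "f \<in> Arr C" "Dom C f = X" "Cod C f = Y" using assms by (auto simp: isos_def in_hom_iff)
  obtain g where "inverse_arrows C f g" using assms by (auto simp: isos_def)
  note i = cinv_inverse[OF this]
  show "cinv C f \<in> Arr C" "Dom C (cinv C f) = Y" "Cod C (cinv C f) = X"
    "cinv C f \<cdot> f = Ident C X" "f \<cdot> cinv C f = Ident C Y"
    using i a by (auto simp: inverse_arrows_def in_hom_iff)
  show "X \<in> Obj C" "Y \<in> Obj C" using a by auto
qed

lemma isoI:
  assumes "f \<in> hom C X Y" "g \<in> hom C Y X" "g \<cdot> f = Ident C X" "f \<cdot> g = Ident C Y"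
  shows "f \<in> isos C X Y"
  using assms by (auto simp: isos_def inverse_arrows_def in_hom_iff)

lemma iso_cancel_right:
  assumes "e \<in> isos C X Y" "f \<in> Arr C" "g \<in> Arr C" "Dom C f = Y" "Dom C g = Y" "f \<cdot> e = g \<cdot> e"
  shows "f = g"
proof -
  note [simp] = iso_facts[OF assms(1)]
  have "f \<cdot> (e \<cdot> cinv C e) = g \<cdot> (e \<cdot> cinv C e)"
    by (rule reassoc[OF assms(6)]) (use assms(2-5) in auto)
  then show ?thesis using assms(2-5) by simp
qed

lemma iso_cancel_left:
  assumes "e \<in> isos C X Y" "f \<in> Arr C" "g \<in> Arr C" "Cod C f = X" "Cod C g = X" "e \<cdot> f = e \<cdot> g"
  shows "f = g"
proof -
  note [simp] = iso_facts[OF assms(1)]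
  have "(cinv C e \<cdot> e) \<cdot> f = cinv C e \<cdot> (e \<cdot> f)"
    using assms(2,4) by (intro assoc) auto
  also have "\<dots> = (cinv C e \<cdot> e) \<cdot> g"
    unfolding assms(6) using assms(3,5) by (intro assoc[symmetric]) auto
  finally show ?thesis using assms(2-5) by simp
qed

lemma iso_tail:
  assumes "e \<in> isos C X Y"
  shows "\<lbrakk>h \<in> Arr C; Cod C h = X\<rbrakk> \<Longrightarrow> cinv C e \<cdot> (e \<cdot> h) = h"
    and "\<lbrakk>h \<in> Arr C; Cod C h = Y\<rbrakk> \<Longrightarrow> e \<cdot> (cinv C e \<cdot> h) = h"
  using iso_facts[OF assms] by (simp_all flip: assoc)

lemma isos_comp:
  assumes "f \<in> isos C X Y" "g \<in> isos C Y Z"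
  shows "g \<cdot> f \<in> isos C X Z"
proof (rule isoI)
  note [simp] = iso_facts[OF assms(1)] iso_facts[OF assms(2)]
  show "g \<cdot> f \<in> hom C X Z" "cinv C f \<cdot> cinv C g \<in> hom C Z X" by (auto simp: in_hom_iff)
  have "cinv C g \<cdot> (g \<cdot> f) = f" "f \<cdot> (cinv C f \<cdot> cinv C g) = cinv C g"
    by (simp_all flip: assoc)
  then show "cinv C f \<cdot> cinv C g \<cdot> (g \<cdot> f) = Ident C X" "g \<cdot> f \<cdot> (cinv C f \<cdot> cinv C g) = Ident C Z"
    by simp_all
qed

text \<open>Yoneda: a preimage of the identity of Y is a right inverse g, and injectivity on the
  endomorphisms of X, applied to \<open>g \<cdot> f\<close> and the identity, makes it a left
  inverse. It yields the invertibility of \<open>uphi\<close>.\<close>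

lemma iso_if_postcomp_bij:
  assumes f: "f \<in> hom C X Y"
    and bij: "\<And>Z. Z \<in> Obj C \<Longrightarrow> bij_betw (\<lambda>g. f \<cdot> g) (hom C Z X) (hom C Z Y)"
  shows "f \<in> isos C X Y"
proof -
  note [simp] = hom_facts[OF f]
  have "Ident C Y \<in> (\<lambda>g. f \<cdot> g) ` hom C Y X"
    using bij[of Y] by (simp add: bij_betw_def in_hom_iff)
  then obtain g where g: "g \<in> hom C Y X" "f \<cdot> g = Ident C Y" by auto
  note [simp] = hom_facts[OF g(1)]
  have "f \<cdot> (g \<cdot> f) = f \<cdot> Ident C X"
    using g(2) by (simp flip: assoc)
  moreover have "g \<cdot> f \<in> hom C X X" "Ident C X \<in> hom C X X" by (auto simp: in_hom_iff)
  ultimately have "g \<cdot> f = Ident C X"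
    using bij[of X] by (auto simp: bij_betw_def inj_on_def)
  with f g show ?thesis by (intro isoI)
qed

text \<open>The dual Yoneda argument. It yields the invertibility of the associativity and unit
  constraints built from a cylinder.\<close>

lemma iso_if_precomp_bij:
  assumes f: "f \<in> hom C X Y"
    and bij: "\<And>Z. Z \<in> Obj C \<Longrightarrow> bij_betw (\<lambda>g. g \<cdot> f) (hom C Y Z) (hom C X Z)"
  shows "f \<in> isos C X Y"
proof -
  note [simp] = hom_facts[OF f]
  have "Ident C X \<in> (\<lambda>g. g \<cdot> f) ` hom C Y X"
    using bij[of X] by (simp add: bij_betw_def in_hom_iff)
  then obtain g where g: "g \<in> hom C Y X" "g \<cdot> f = Ident C X" by auto
  note [simp] = hom_facts[OF g(1)]
  have "(f \<cdot> g) \<cdot> f = Ident C Y \<cdot> f"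
    using g(2) by simp
  moreover have "f \<cdot> g \<in> hom C Y Y" "Ident C Y \<in> hom C Y Y" by (auto simp: in_hom_iff)
  ultimately have "f \<cdot> g = Ident C Y"
    using bij[of Y] by (simp add: bij_betw_def inj_on_def)
  with f g show ?thesis by (intro isoI)
qed

lemma iso_postcomp_bij:
  assumes e: "e \<in> isos C X Y"
  shows "bij_betw (\<lambda>g. e \<cdot> g) (hom C Z X) (hom C Z Y)"
proof (rule bij_betw_byWitness[where f' = "\<lambda>g. cinv C e \<cdot> g"])
  note [simp] = iso_facts[OF e]
  show "\<forall>g\<in>hom C Z X. cinv C e \<cdot> (e \<cdot> g) = g" "\<forall>g\<in>hom C Z Y. e \<cdot> (cinv C e \<cdot> g) = g"
    by (auto simp: in_hom_iff simp flip: assoc)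
  show "(\<lambda>g. e \<cdot> g) ` hom C Z X \<subseteq> hom C Z Y" "(\<lambda>g. cinv C e \<cdot> g) ` hom C Z Y \<subseteq> hom C Z X"
    by (auto simp: in_hom_iff)
qed

lemma iso_precomp_bij:
  assumes e: "e \<in> isos C X Y"
  shows "bij_betw (\<lambda>g. g \<cdot> e) (hom C Y Z) (hom C X Z)"
proof (rule bij_betw_byWitness[where f' = "\<lambda>g. g \<cdot> cinv C e"])
  note [simp] = iso_facts[OF e]
  show "\<forall>g\<in>hom C Y Z. g \<cdot> e \<cdot> cinv C e = g" "\<forall>g\<in>hom C X Z. g \<cdot> cinv C e \<cdot> e = g"
    by (auto simp: in_hom_iff)
  show "(\<lambda>g. g \<cdot> e) ` hom C Y Z \<subseteq> hom C X Z" "(\<lambda>g. g \<cdot> cinv C e) ` hom C X Z \<subseteq> hom C Y Z"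
    by (auto simp: in_hom_iff)
qed

end

section \<open>Rewriting in a monoidal category\<close>

context monoidal_category
begin

lemma tens_simps [simp]:
  shows "UnitObj V \<in> Obj V"
    and "\<lbrakk>X \<in> Obj V; Y \<in> Obj V\<rbrakk> \<Longrightarrow> X \<otimes> Y \<in> Obj V"
    and "\<lbrakk>f \<in> Arr V; g \<in> Arr V\<rbrakk> \<Longrightarrow> f \<boxtimes> g \<in> Arr V"
    and "\<lbrakk>f \<in> Arr V; g \<in> Arr V\<rbrakk> \<Longrightarrow> Dom V (f \<boxtimes> g) = Dom V f \<otimes> Dom V g"
    and "\<lbrakk>f \<in> Arr V; g \<in> Arr V\<rbrakk> \<Longrightarrow> Cod V (f \<boxtimes> g) = Cod V f \<otimes> Cod V g"
    and "\<lbrakk>X \<in> Obj V; Y \<in> Obj V\<rbrakk> \<Longrightarrow> Ident V X \<boxtimes> Ident V Y = Ident V (X \<otimes> Y)"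
    and "\<lbrakk>f \<in> Arr V; f' \<in> Arr V; Dom V f' = Cod V f; g \<in> Arr V; g' \<in> Arr V; Dom V g' = Cod V g\<rbrakk>
      \<Longrightarrow> (f' \<boxtimes> g') \<cdot> (f \<boxtimes> g) = (f' \<cdot> f) \<boxtimes> (g' \<cdot> g)"
  using unit_obj bifunctorD[OF tens_bifunctor] by auto

lemma interchange_tail [simp]:
  assumes "f \<in> Arr V" "f' \<in> Arr V" "Dom V f' = Cod V f" "g \<in> Arr V" "g' \<in> Arr V" "Dom V g' = Cod V g"
    and "h \<in> Arr V" "Cod V h = Dom V f \<otimes> Dom V g"
  shows "(f' \<boxtimes> g') \<cdot> ((f \<boxtimes> g) \<cdot> h) = ((f' \<cdot> f) \<boxtimes> (g' \<cdot> g)) \<cdot> h"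
  using assms by (simp flip: assoc)

lemma assoc_isos: "\<lbrakk>X \<in> Obj V; Y \<in> Obj V; Z \<in> Obj V\<rbrakk>
    \<Longrightarrow> Assoc V X Y Z \<in> isos V ((X \<otimes> Y) \<otimes> Z) (X \<otimes> (Y \<otimes> Z))"
  using PiE3_mem[OF assoc_iso] .

lemma lunit_isos: "X \<in> Obj V \<Longrightarrow> LUnit V X \<in> isos V (UnitObj V \<otimes> X) X"
  using lunit_iso by auto

lemma runit_isos: "X \<in> Obj V \<Longrightarrow> RUnit V X \<in> isos V (X \<otimes> UnitObj V) X"
  using runit_iso by auto

lemmas assoc_simps [simp] = iso_facts(1-8)[OF assoc_isos]
lemmas lunit_simps [simp] = iso_facts(1-8)[OF lunit_isos]
lemmas runit_simps [simp] = iso_facts(1-8)[OF runit_isos]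

lemmas lunit_tail [simp] = iso_tail[OF lunit_isos]
lemmas runit_tail [simp] = iso_tail[OF runit_isos]

lemma tens_iso_ident:
  assumes "e \<in> isos V X Y" "Z \<in> Obj V"
  shows "e \<boxtimes> Ident V Z \<in> isos V (X \<otimes> Z) (Y \<otimes> Z)"
proof -
  note [simp] = iso_facts[OF assms(1)]
  show ?thesis
    by (rule isoI[where g = "cinv V e \<boxtimes> Ident V Z"]) (use assms(2) in \<open>auto simp: in_hom_iff\<close>)
qed

end

text \<open>The operations are plain parameters instead of record fields, so that the locale can be
  interpreted both by V acting on itself and by a module whose data live in a \<open>tcmod\<close>
  record.\<close>

locale action = V: monoidal_category V + S: category S
  for V :: "('o, 'm) cmcat" and S :: "('p, 'n, 'z) cat_scheme" +
  fixes T :: "'o \<Rightarrow> 'p \<Rightarrow> 'p"  (infixl "\<star>" 75)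
    and TA :: "'m \<Rightarrow> 'n \<Rightarrow> 'n"  (infixl "\<bullet>" 75)
    and As :: "'o \<Rightarrow> 'o \<Rightarrow> 'p \<Rightarrow> 'n"
    and LU :: "'p \<Rightarrow> 'n"
  assumes act_bifunctor: "bifunctor V S S T TA"
    and act_assoc_iso: "\<lbrakk>K \<in> Obj V; L \<in> Obj V; X \<in> Obj S\<rbrakk>
      \<Longrightarrow> As K L X \<in> isos S ((K \<otimes>\<^bsub>V\<^esub> L) \<star> X) (K \<star> (L \<star> X))"
    and act_assoc_natural: "\<lbrakk>k \<in> hom V K K'; l \<in> hom V L L'; x \<in> hom S X X'\<rbrakk>
      \<Longrightarrow> As K' L' X' \<cdot>\<^bsub>S\<^esub> ((k \<boxtimes>\<^bsub>V\<^esub> l) \<bullet> x) = (k \<bullet> (l \<bullet> x)) \<cdot>\<^bsub>S\<^esub> As K L X"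
    and act_lunit_iso: "X \<in> Obj S \<Longrightarrow> LU X \<in> isos S (UnitObj V \<star> X) X"
    and act_lunit_natural: "x \<in> hom S X X'
      \<Longrightarrow> LU X' \<cdot>\<^bsub>S\<^esub> (Ident V (UnitObj V) \<bullet> x) = x \<cdot>\<^bsub>S\<^esub> LU X"
    and act_pentagon: "\<lbrakk>K \<in> Obj V; L \<in> Obj V; N \<in> Obj V; X \<in> Obj S\<rbrakk>
      \<Longrightarrow> As K L (N \<star> X) \<cdot>\<^bsub>S\<^esub> As (K \<otimes>\<^bsub>V\<^esub> L) N X
        = (Ident V K \<bullet> As L N X) \<cdot>\<^bsub>S\<^esub> As K (L \<otimes>\<^bsub>V\<^esub> N) X \<cdot>\<^bsub>S\<^esub> (Assoc V K L N \<bullet> Ident S X)"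
    and act_triangle: "\<lbrakk>K \<in> Obj V; X \<in> Obj S\<rbrakk>
      \<Longrightarrow> (Ident V K \<bullet> LU X) \<cdot>\<^bsub>S\<^esub> As K (UnitObj V) X = RUnit V K \<bullet> Ident S X"
begin

lemma act_simps [simp]:
  shows "\<lbrakk>K \<in> Obj V; X \<in> Obj S\<rbrakk> \<Longrightarrow> K \<star> X \<in> Obj S"
    and "\<lbrakk>f \<in> Arr V; g \<in> Arr S\<rbrakk> \<Longrightarrow> f \<bullet> g \<in> Arr S"
    and "\<lbrakk>f \<in> Arr V; g \<in> Arr S\<rbrakk> \<Longrightarrow> Dom S (f \<bullet> g) = Dom V f \<star> Dom S g"
    and "\<lbrakk>f \<in> Arr V; g \<in> Arr S\<rbrakk> \<Longrightarrow> Cod S (f \<bullet> g) = Cod V f \<star> Cod S g"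
    and "\<lbrakk>K \<in> Obj V; X \<in> Obj S\<rbrakk> \<Longrightarrow> Ident V K \<bullet> Ident S X = Ident S (K \<star> X)"
    and "\<lbrakk>f \<in> Arr V; f' \<in> Arr V; Dom V f' = Cod V f; g \<in> Arr S; g' \<in> Arr S; Dom S g' = Cod S g\<rbrakk>
      \<Longrightarrow> (f' \<bullet> g') \<cdot>\<^bsub>S\<^esub> (f \<bullet> g) = (f' \<cdot>\<^bsub>V\<^esub> f) \<bullet> (g' \<cdot>\<^bsub>S\<^esub> g)"
  using bifunctorD[OF act_bifunctor] by auto

lemma act_interchange_tail [simp]:
  assumes "f \<in> Arr V" "f' \<in> Arr V" "Dom V f' = Cod V f" "g \<in> Arr S" "g' \<in> Arr S" "Dom S g' = Cod S g"
    and "h \<in> Arr S" "Cod S h = Dom V f \<star> Dom S g"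
  shows "(f' \<bullet> g') \<cdot>\<^bsub>S\<^esub> ((f \<bullet> g) \<cdot>\<^bsub>S\<^esub> h) = ((f' \<cdot>\<^bsub>V\<^esub> f) \<bullet> (g' \<cdot>\<^bsub>S\<^esub> g)) \<cdot>\<^bsub>S\<^esub> h"
  using assms by (simp flip: S.assoc)

lemmas act_assoc_simps [simp] = S.iso_facts(1-8)[OF act_assoc_iso]
lemmas act_lunit_simps [simp] = S.iso_facts(1-8)[OF act_lunit_iso]

lemma act_iso_ident:
  assumes "e \<in> isos V K L" "X \<in> Obj S"
  shows "e \<bullet> Ident S X \<in> isos S (K \<star> X) (L \<star> X)"
proof -
  note [simp] = V.iso_facts[OF assms(1)]
  show ?thesis
    by (rule S.isoI[where g = "cinv V e \<bullet> Ident S X"]) (use assms(2) in \<open>auto simp: in_hom_iff\<close>)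
qed

text \<open>Naturality of \<open>LU\<close> exhibits f as the conjugate of its image under the unit
  object by invertible arrows.\<close>

lemma unit_act_faithful:
  assumes "f \<in> hom S X Y" "g \<in> hom S X Y" "Ident V (UnitObj V) \<bullet> f = Ident V (UnitObj V) \<bullet> g"
  shows "f = g"
proof (rule S.iso_cancel_right)
  show "LU X \<in> isos S (UnitObj V \<star> X) X"
    using S.hom_facts[OF assms(1)] by (simp add: act_lunit_iso)
  show "f \<cdot>\<^bsub>S\<^esub> LU X = g \<cdot>\<^bsub>S\<^esub> LU X"
    using act_lunit_natural[OF assms(1)] act_lunit_natural[OF assms(2)] assms(3) by simp
qed (use S.hom_facts[OF assms(1)] S.hom_facts[OF assms(2)] in auto)

text \<open>Kelly's redundant coherence axiom: after acting with the unit object on both sides, it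
  follows from the pentagon and the triangle.\<close>

lemma act_lunit_assoc:
  assumes [simp]: "K \<in> Obj V" "X \<in> Obj S"
  shows "LU (K \<star> X) \<cdot>\<^bsub>S\<^esub> As (UnitObj V) K X = LUnit V K \<bullet> Ident S X"
proof (rule unit_act_faithful)
  let ?I = "UnitObj V" let ?i = "Ident V (UnitObj V)"
  let ?e = "As ?I (?I \<otimes>\<^bsub>V\<^esub> K) X \<cdot>\<^bsub>S\<^esub> (Assoc V ?I ?I K \<bullet> Ident S X)"
  show "LU (K \<star> X) \<cdot>\<^bsub>S\<^esub> As ?I K X \<in> hom S ((?I \<otimes>\<^bsub>V\<^esub> K) \<star> X) (K \<star> X)"
    and "LUnit V K \<bullet> Ident S X \<in> hom S ((?I \<otimes>\<^bsub>V\<^esub> K) \<star> X) (K \<star> X)"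
    by (auto simp: in_hom_iff)
  show "?i \<bullet> (LU (K \<star> X) \<cdot>\<^bsub>S\<^esub> As ?I K X) = ?i \<bullet> (LUnit V K \<bullet> Ident S X)"
  proof (rule S.iso_cancel_right)
    show "?e \<in> isos S (((?I \<otimes>\<^bsub>V\<^esub> ?I) \<otimes>\<^bsub>V\<^esub> K) \<star> X) (?I \<star> ((?I \<otimes>\<^bsub>V\<^esub> K) \<star> X))"
      by (intro S.isos_comp[OF act_iso_ident act_assoc_iso] V.assoc_isos) auto
    have "(?i \<bullet> (LU (K \<star> X) \<cdot>\<^bsub>S\<^esub> As ?I K X)) \<cdot>\<^bsub>S\<^esub> ?e
        = (?i \<bullet> LU (K \<star> X)) \<cdot>\<^bsub>S\<^esub> ((?i \<bullet> As ?I K X) \<cdot>\<^bsub>S\<^esub> As ?I (?I \<otimes>\<^bsub>V\<^esub> K) X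
            \<cdot>\<^bsub>S\<^esub> (Assoc V ?I ?I K \<bullet> Ident S X))"
      by (simp flip: S.assoc)
    also have "\<dots> = (?i \<bullet> LU (K \<star> X)) \<cdot>\<^bsub>S\<^esub> (As ?I ?I (K \<star> X) \<cdot>\<^bsub>S\<^esub> As (?I \<otimes>\<^bsub>V\<^esub> ?I) K X)"
      by (subst act_pentagon) auto
    also have "\<dots> = ((?i \<bullet> LU (K \<star> X)) \<cdot>\<^bsub>S\<^esub> As ?I ?I (K \<star> X)) \<cdot>\<^bsub>S\<^esub> As (?I \<otimes>\<^bsub>V\<^esub> ?I) K X"
      by simp
    also have "\<dots> = (RUnit V ?I \<bullet> (Ident V K \<bullet> Ident S X)) \<cdot>\<^bsub>S\<^esub> As (?I \<otimes>\<^bsub>V\<^esub> ?I) K X"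
      by (subst act_triangle) auto
    also have "(RUnit V ?I \<bullet> (Ident V K \<bullet> Ident S X)) \<cdot>\<^bsub>S\<^esub> As (?I \<otimes>\<^bsub>V\<^esub> ?I) K X
        = As ?I K X \<cdot>\<^bsub>S\<^esub> ((RUnit V ?I \<boxtimes>\<^bsub>V\<^esub> Ident V K) \<bullet> Ident S X)"
      by (rule act_assoc_natural[symmetric]) (auto simp: in_hom_iff)
    also have "\<dots> = As ?I K X \<cdot>\<^bsub>S\<^esub> ((?i \<boxtimes>\<^bsub>V\<^esub> LUnit V K) \<bullet> Ident S X)
        \<cdot>\<^bsub>S\<^esub> (Assoc V ?I ?I K \<bullet> Ident S X)"
      by (simp add: V.triangle)
    also have "\<dots> = (?i \<bullet> (LUnit V K \<bullet> Ident S X)) \<cdot>\<^bsub>S\<^esub> As ?I (?I \<otimes>\<^bsub>V\<^esub> K) X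
        \<cdot>\<^bsub>S\<^esub> (Assoc V ?I ?I K \<bullet> Ident S X)"
      by (subst act_assoc_natural) (auto simp: in_hom_iff)
    finally show "(?i \<bullet> (LU (K \<star> X) \<cdot>\<^bsub>S\<^esub> As ?I K X)) \<cdot>\<^bsub>S\<^esub> ?e
        = (?i \<bullet> (LUnit V K \<bullet> Ident S X)) \<cdot>\<^bsub>S\<^esub> ?e" by simp
  qed auto
qed

end

section \<open>Closed actions\<close>

context monoidal_category
begin

text \<open>In particular \<open>self.act_lunit_assoc\<close> is the coherence law for l in V
  itself.\<close>

sublocale self: action V V "Tens V" "TensA V" "Assoc V" "LUnit V"
  by unfold_locales
    (simp_all add: tens_bifunctor assoc_isos assoc_natural lunit_isos lunit_natural pentagon triangle
      del: assoc)

text \<open>The mirror image of \<open>act_lunit_assoc\<close>: the unit object now stands on the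
  right, so it is no instance of a law of left actions. Both sides are compared after tensoring with
  the unit object on the right and composing with an associativity isomorphism; naturality of r then
  removes the extra tensor factor.\<close>

lemma runit_assoc:
  assumes [simp]: "X \<in> Obj V" "Y \<in> Obj V"
  shows "(Ident V X \<boxtimes> RUnit V Y) \<cdot> Assoc V X Y (UnitObj V) = RUnit V (X \<otimes> Y)"
proof -
  let ?I = "UnitObj V" let ?i = "Ident V (UnitObj V)"
  let ?f = "(Ident V X \<boxtimes> RUnit V Y) \<cdot> Assoc V X Y ?I"
  have "Assoc V X Y ?I \<cdot> (?f \<boxtimes> ?i)
      = (Assoc V X Y ?I \<cdot> ((Ident V X \<boxtimes> RUnit V Y) \<boxtimes> ?i)) \<cdot> (Assoc V X Y ?I \<boxtimes> ?i)"
    by simp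
  also have "\<dots> = ((Ident V X \<boxtimes> (RUnit V Y \<boxtimes> ?i)) \<cdot> Assoc V X (Y \<otimes> ?I) ?I) \<cdot> (Assoc V X Y ?I \<boxtimes> ?i)"
    by (subst assoc_natural) (auto simp: in_hom_iff)
  \<comment> \<open>The triangle is used backwards: r is traded for l and an associativity arrow,
    which completes one side of the pentagon.\<close>
  also have "\<dots> = (Ident V X \<boxtimes> (Ident V Y \<boxtimes> LUnit V ?I))
      \<cdot> ((Ident V X \<boxtimes> Assoc V Y ?I ?I) \<cdot> Assoc V X (Y \<otimes> ?I) ?I \<cdot> (Assoc V X Y ?I \<boxtimes> ?i))"
    by (simp flip: triangle assoc)
  also have "\<dots> = (Ident V X \<boxtimes> (Ident V Y \<boxtimes> LUnit V ?I))
      \<cdot> (Assoc V X Y (?I \<otimes> ?I) \<cdot> Assoc V (X \<otimes> Y) ?I ?I)"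
    by (subst pentagon) auto
  also have "\<dots> = ((Ident V X \<boxtimes> (Ident V Y \<boxtimes> LUnit V ?I)) \<cdot> Assoc V X Y (?I \<otimes> ?I))
      \<cdot> Assoc V (X \<otimes> Y) ?I ?I"
    by simp
  also have "\<dots> = (Assoc V X Y ?I \<cdot> ((Ident V X \<boxtimes> Ident V Y) \<boxtimes> LUnit V ?I))
      \<cdot> Assoc V (X \<otimes> Y) ?I ?I"
    by (subst assoc_natural) (auto simp: in_hom_iff)
  also have "\<dots> = Assoc V X Y ?I \<cdot> ((Ident V (X \<otimes> Y) \<boxtimes> LUnit V ?I) \<cdot> Assoc V (X \<otimes> Y) ?I ?I)"
    by simp
  also have "\<dots> = Assoc V X Y ?I \<cdot> (RUnit V (X \<otimes> Y) \<boxtimes> ?i)"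
    by (subst triangle) auto
  finally have "Assoc V X Y ?I \<cdot> (?f \<boxtimes> ?i) = Assoc V X Y ?I \<cdot> (RUnit V (X \<otimes> Y) \<boxtimes> ?i)" .
  then have "?f \<boxtimes> ?i = RUnit V (X \<otimes> Y) \<boxtimes> ?i"
    by (rule iso_cancel_left[OF assoc_isos[of X Y ?I], rotated -1]) auto
  moreover have "RUnit V (X \<otimes> Y) \<cdot> (?f \<boxtimes> ?i) = ?f \<cdot> RUnit V ((X \<otimes> Y) \<otimes> ?I)"
    and "RUnit V (X \<otimes> Y) \<cdot> (RUnit V (X \<otimes> Y) \<boxtimes> ?i) = RUnit V (X \<otimes> Y) \<cdot> RUnit V ((X \<otimes> Y) \<otimes> ?I)"
    by (rule runit_natural, simp add: in_hom_iff)+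
  ultimately have "?f \<cdot> RUnit V ((X \<otimes> Y) \<otimes> ?I) = RUnit V (X \<otimes> Y) \<cdot> RUnit V ((X \<otimes> Y) \<otimes> ?I)"
    by metis
  then show ?thesis
    by (rule iso_cancel_right[OF runit_isos[of "(X \<otimes> Y) \<otimes> ?I"], rotated -1]) auto
qed

end

text \<open>Naturality of \<open>Phi\<close> is required in K alone. This is what V and a
  tensor-closed module both provide; functoriality of the hom objects enters later, where it is
  available.\<close>

locale closed_action = action V S T TA As LU
  for V :: "('o, 'm) cmcat" and S :: "('p, 'n, 'z) cat_scheme"
    and T :: "'o \<Rightarrow> 'p \<Rightarrow> 'p"  (infixl "\<star>" 75)
    and TA :: "'m \<Rightarrow> 'n \<Rightarrow> 'n"  (infixl "\<bullet>" 75)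
    and As :: "'o \<Rightarrow> 'o \<Rightarrow> 'p \<Rightarrow> 'n"
    and LU :: "'p \<Rightarrow> 'n" +
  fixes H :: "'p \<Rightarrow> 'p \<Rightarrow> 'o"
    and Phi :: "'o \<Rightarrow> 'p \<Rightarrow> 'p \<Rightarrow> 'n \<Rightarrow> 'm"
  assumes H_obj [simp]: "\<lbrakk>X \<in> Obj S; Y \<in> Obj S\<rbrakk> \<Longrightarrow> H X Y \<in> Obj V"
    and phi_bij: "\<lbrakk>K \<in> Obj V; X \<in> Obj S; Y \<in> Obj S\<rbrakk>
      \<Longrightarrow> bij_betw (Phi K X Y) (hom S (K \<star> X) Y) (hom V K (H X Y))"
    and phi_natural: "\<lbrakk>k \<in> hom V K' K; X \<in> Obj S; f \<in> hom S (K \<star> X) Y\<rbrakk>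
      \<Longrightarrow> Phi K' X Y (f \<cdot>\<^bsub>S\<^esub> (k \<bullet> Ident S X)) = Phi K X Y f \<cdot>\<^bsub>V\<^esub> k"
begin

text \<open>The counit, in the same form as \<open>ev\<close> and \<open>mev\<close>, so that it
  unfolds to each of them under the corresponding interpretation.\<close>

definition eps :: "'p \<Rightarrow> 'p \<Rightarrow> 'n" where
  "eps X Y = inv_into (hom S (H X Y \<star> X) Y) (Phi (H X Y) X Y) (Ident V (H X Y))"

definition cmp :: "'p \<Rightarrow> 'p \<Rightarrow> 'p \<Rightarrow> 'm" where
  "cmp X Y Z = Phi (H Y Z \<otimes>\<^bsub>V\<^esub> H X Y) X Z
     (eps Y Z \<cdot>\<^bsub>S\<^esub> (Ident V (H Y Z) \<bullet> eps X Y) \<cdot>\<^bsub>S\<^esub> As (H Y Z) (H X Y) X)"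

lemma phi_simps [simp]:
  assumes "f \<in> Arr S" "Dom S f = K \<star> X" "Cod S f = Y" "K \<in> Obj V" "X \<in> Obj S"
  shows "Phi K X Y f \<in> Arr V" "Dom V (Phi K X Y f) = K" "Cod V (Phi K X Y f) = H X Y"
proof -
  have "Phi K X Y f \<in> hom V K (H X Y)"
    using bij_betwE[OF phi_bij, of K X Y] assms by (auto simp: in_hom_iff)
  then show "Phi K X Y f \<in> Arr V" "Dom V (Phi K X Y f) = K" "Cod V (Phi K X Y f) = H X Y"
    by (auto simp: in_hom_iff)
qed

lemma eps_simps [simp]:
  assumes "X \<in> Obj S" "Y \<in> Obj S"
  shows "eps X Y \<in> Arr S" "Dom S (eps X Y) = H X Y \<star> X" "Cod S (eps X Y) = Y"
    "Phi (H X Y) X Y (eps X Y) = Ident V (H X Y)"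
proof -
  have "Ident V (H X Y) \<in> Phi (H X Y) X Y ` hom S (H X Y \<star> X) Y"
    using phi_bij[of "H X Y" X Y] assms by (auto simp: bij_betw_def in_hom_iff)
  from inv_into_into[OF this] f_inv_into_f[OF this]
  show "eps X Y \<in> Arr S" "Dom S (eps X Y) = H X Y \<star> X" "Cod S (eps X Y) = Y"
    "Phi (H X Y) X Y (eps X Y) = Ident V (H X Y)"
    by (auto simp: in_hom_iff eps_def)
qed

lemma cmp_simps [simp]:
  assumes "X \<in> Obj S" "Y \<in> Obj S" "Z \<in> Obj S"
  shows "cmp X Y Z \<in> Arr V" "Dom V (cmp X Y Z) = H Y Z \<otimes>\<^bsub>V\<^esub> H X Y" "Cod V (cmp X Y Z) = H X Z"
  using assms by (auto simp: cmp_def)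

lemma phi_eps:
  assumes "u \<in> hom V K (H X Y)" and [simp]: "X \<in> Obj S" "Y \<in> Obj S"
  shows "Phi K X Y (eps X Y \<cdot>\<^bsub>S\<^esub> (u \<bullet> Ident S X)) = u"
  using phi_natural[OF assms(1), of X "eps X Y" Y] V.hom_facts[OF assms(1)] by (simp add: in_hom_iff)

lemma phi_inject:
  assumes "Phi K X Y f = Phi K X Y g" "f \<in> hom S (K \<star> X) Y" "g \<in> hom S (K \<star> X) Y"
    "K \<in> Obj V" "X \<in> Obj S"
  shows "f = g"
  using phi_bij[of K X Y] assms S.hom_facts(5)[OF assms(2)] by (auto simp: bij_betw_def inj_on_def)

lemma eps_phi:
  assumes f: "f \<in> hom S (K \<star> X) Y" and [simp]: "K \<in> Obj V" "X \<in> Obj S"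
  shows "eps X Y \<cdot>\<^bsub>S\<^esub> (Phi K X Y f \<bullet> Ident S X) = f"
proof (rule phi_inject)
  note [simp] = S.hom_facts[OF f]
  show "Phi K X Y (eps X Y \<cdot>\<^bsub>S\<^esub> (Phi K X Y f \<bullet> Ident S X)) = Phi K X Y f"
    by (rule phi_eps) (auto simp: in_hom_iff)
qed (use S.hom_facts[OF f] in \<open>auto simp: in_hom_iff\<close>)

text \<open>Each of f and g is the counit after its own transpose; naturality of the associativity
  constraint gathers the two transposes into one tensor arrow, and naturality of \<open>Phi\<close>
  takes that arrow outside. Equations about composition in V thereby become equations about arrows
  of S.\<close>

lemma cmp_phi:
  assumes f: "f \<in> hom S (P \<star> Y) Z" and g: "g \<in> hom S (Q \<star> X) Y"
    and [simp]: "P \<in> Obj V" "Q \<in> Obj V" "X \<in> Obj S"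
  shows "cmp X Y Z \<cdot>\<^bsub>V\<^esub> (Phi P Y Z f \<boxtimes>\<^bsub>V\<^esub> Phi Q X Y g)
    = Phi (P \<otimes>\<^bsub>V\<^esub> Q) X Z (f \<cdot>\<^bsub>S\<^esub> (Ident V P \<bullet> g) \<cdot>\<^bsub>S\<^esub> As P Q X)"
proof -
  note [simp] = S.hom_facts[OF f] S.hom_facts[OF g]
  let ?u = "Phi P Y Z f" let ?v = "Phi Q X Y g"
  have "f \<cdot>\<^bsub>S\<^esub> (Ident V P \<bullet> g) \<cdot>\<^bsub>S\<^esub> As P Q X
      = (eps Y Z \<cdot>\<^bsub>S\<^esub> (?u \<bullet> Ident S Y)) \<cdot>\<^bsub>S\<^esub> (Ident V P \<bullet> (eps X Y \<cdot>\<^bsub>S\<^esub> (?v \<bullet> Ident S X))) \<cdot>\<^bsub>S\<^esub> As P Q X"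
    by (simp only: eps_phi[OF f] eps_phi[OF g] assms(3-) \<open>Y \<in> Obj S\<close>)
  also have "\<dots> = eps Y Z \<cdot>\<^bsub>S\<^esub> (Ident V (H Y Z) \<bullet> eps X Y)
      \<cdot>\<^bsub>S\<^esub> ((?u \<bullet> (?v \<bullet> Ident S X)) \<cdot>\<^bsub>S\<^esub> As P Q X)"
    by simp
  also have "\<dots> = eps Y Z \<cdot>\<^bsub>S\<^esub> (Ident V (H Y Z) \<bullet> eps X Y)
      \<cdot>\<^bsub>S\<^esub> (As (H Y Z) (H X Y) X \<cdot>\<^bsub>S\<^esub> ((?u \<boxtimes>\<^bsub>V\<^esub> ?v) \<bullet> Ident S X))"
    by (subst act_assoc_natural) (auto simp: in_hom_iff)
  also have "\<dots> = (eps Y Z \<cdot>\<^bsub>S\<^esub> (Ident V (H Y Z) \<bullet> eps X Y) \<cdot>\<^bsub>S\<^esub> As (H Y Z) (H X Y) X)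
      \<cdot>\<^bsub>S\<^esub> ((?u \<boxtimes>\<^bsub>V\<^esub> ?v) \<bullet> Ident S X)"
    by simp
  finally show ?thesis
    unfolding cmp_def by (subst phi_natural[symmetric]) (auto simp: in_hom_iff)
qed

text \<open>Both sides are transposes of a threefold evaluation, formed in the two possible
  bracketings; the pentagon relates them.\<close>

lemma cmp_assoc:
  assumes [simp]: "W \<in> Obj S" "X \<in> Obj S" "Y \<in> Obj S" "Z \<in> Obj S"
  shows "cmp W X Z \<cdot>\<^bsub>V\<^esub> (cmp X Y Z \<boxtimes>\<^bsub>V\<^esub> Ident V (H W X))
    = cmp W Y Z \<cdot>\<^bsub>V\<^esub> (Ident V (H Y Z) \<boxtimes>\<^bsub>V\<^esub> cmp W X Y) \<cdot>\<^bsub>V\<^esub> Assoc V (H Y Z) (H X Y) (H W X)"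
proof -
  let ?P = "H Y Z" let ?Q = "H X Y" let ?R = "H W X"
  let ?f = "eps Y Z" let ?g = "eps X Y" let ?h = "eps W X"
  \<comment> \<open>The identity of a hom object is the transpose of the counit, which brings the
    left side into the shape of \<open>cmp_phi\<close>.\<close>
  have "cmp W X Z \<cdot>\<^bsub>V\<^esub> (cmp X Y Z \<boxtimes>\<^bsub>V\<^esub> Ident V ?R)
      = cmp W X Z \<cdot>\<^bsub>V\<^esub> (Phi (?P \<otimes>\<^bsub>V\<^esub> ?Q) X Z (?f \<cdot>\<^bsub>S\<^esub> (Ident V ?P \<bullet> ?g) \<cdot>\<^bsub>S\<^esub> As ?P ?Q X)
          \<boxtimes>\<^bsub>V\<^esub> Phi ?R W X ?h)"
    by (simp add: cmp_def)
  also have "\<dots> = Phi ((?P \<otimes>\<^bsub>V\<^esub> ?Q) \<otimes>\<^bsub>V\<^esub> ?R) W Z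
      ((?f \<cdot>\<^bsub>S\<^esub> (Ident V ?P \<bullet> ?g) \<cdot>\<^bsub>S\<^esub> As ?P ?Q X) \<cdot>\<^bsub>S\<^esub> (Ident V (?P \<otimes>\<^bsub>V\<^esub> ?Q) \<bullet> ?h) \<cdot>\<^bsub>S\<^esub> As (?P \<otimes>\<^bsub>V\<^esub> ?Q) ?R W)"
    by (rule cmp_phi) (auto simp: in_hom_iff)
  also have "(?f \<cdot>\<^bsub>S\<^esub> (Ident V ?P \<bullet> ?g) \<cdot>\<^bsub>S\<^esub> As ?P ?Q X) \<cdot>\<^bsub>S\<^esub> (Ident V (?P \<otimes>\<^bsub>V\<^esub> ?Q) \<bullet> ?h) \<cdot>\<^bsub>S\<^esub> As (?P \<otimes>\<^bsub>V\<^esub> ?Q) ?R W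
      = ?f \<cdot>\<^bsub>S\<^esub> (Ident V ?P \<bullet> ?g)
          \<cdot>\<^bsub>S\<^esub> (As ?P ?Q X \<cdot>\<^bsub>S\<^esub> ((Ident V ?P \<boxtimes>\<^bsub>V\<^esub> Ident V ?Q) \<bullet> ?h)) \<cdot>\<^bsub>S\<^esub> As (?P \<otimes>\<^bsub>V\<^esub> ?Q) ?R W"
    by simp
  also have "\<dots> = ?f \<cdot>\<^bsub>S\<^esub> (Ident V ?P \<bullet> ?g)
      \<cdot>\<^bsub>S\<^esub> ((Ident V ?P \<bullet> (Ident V ?Q \<bullet> ?h)) \<cdot>\<^bsub>S\<^esub> As ?P ?Q (?R \<star> W)) \<cdot>\<^bsub>S\<^esub> As (?P \<otimes>\<^bsub>V\<^esub> ?Q) ?R W"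
    by (subst act_assoc_natural) (auto simp: in_hom_iff)
  also have "\<dots> = ?f \<cdot>\<^bsub>S\<^esub> (Ident V ?P \<bullet> ?g)
      \<cdot>\<^bsub>S\<^esub> (Ident V ?P \<bullet> (Ident V ?Q \<bullet> ?h)) \<cdot>\<^bsub>S\<^esub> (As ?P ?Q (?R \<star> W) \<cdot>\<^bsub>S\<^esub> As (?P \<otimes>\<^bsub>V\<^esub> ?Q) ?R W)"
    by simp
  also have "\<dots> = ?f \<cdot>\<^bsub>S\<^esub> (Ident V ?P \<bullet> ?g)
      \<cdot>\<^bsub>S\<^esub> (Ident V ?P \<bullet> (Ident V ?Q \<bullet> ?h)) \<cdot>\<^bsub>S\<^esub> ((Ident V ?P \<bullet> As ?Q ?R W)
        \<cdot>\<^bsub>S\<^esub> As ?P (?Q \<otimes>\<^bsub>V\<^esub> ?R) W \<cdot>\<^bsub>S\<^esub> (Assoc V ?P ?Q ?R \<bullet> Ident S W))"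
    by (subst act_pentagon) auto
  also have "\<dots> = (?f \<cdot>\<^bsub>S\<^esub> (Ident V ?P \<bullet> (?g \<cdot>\<^bsub>S\<^esub> (Ident V ?Q \<bullet> ?h) \<cdot>\<^bsub>S\<^esub> As ?Q ?R W))
      \<cdot>\<^bsub>S\<^esub> As ?P (?Q \<otimes>\<^bsub>V\<^esub> ?R) W) \<cdot>\<^bsub>S\<^esub> (Assoc V ?P ?Q ?R \<bullet> Ident S W)"
    by simp
  also have "Phi ((?P \<otimes>\<^bsub>V\<^esub> ?Q) \<otimes>\<^bsub>V\<^esub> ?R) W Z \<dots>
      = Phi (?P \<otimes>\<^bsub>V\<^esub> (?Q \<otimes>\<^bsub>V\<^esub> ?R)) W Z (?f \<cdot>\<^bsub>S\<^esub> (Ident V ?P \<bullet> (?g \<cdot>\<^bsub>S\<^esub> (Ident V ?Q \<bullet> ?h) \<cdot>\<^bsub>S\<^esub> As ?Q ?R W))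
          \<cdot>\<^bsub>S\<^esub> As ?P (?Q \<otimes>\<^bsub>V\<^esub> ?R) W) \<cdot>\<^bsub>V\<^esub> Assoc V ?P ?Q ?R"
    by (rule phi_natural) (auto simp: in_hom_iff)
  also have "\<dots> = (cmp W Y Z \<cdot>\<^bsub>V\<^esub> (Phi ?P Y Z ?f \<boxtimes>\<^bsub>V\<^esub> cmp W X Y)) \<cdot>\<^bsub>V\<^esub> Assoc V ?P ?Q ?R"
    unfolding cmp_def[of W X Y] by (subst cmp_phi) (auto simp: in_hom_iff)
  finally show ?thesis by simp
qed

text \<open>After \<open>cmp_phi\<close>, naturality of \<open>LU\<close> moves g past the unit
  constraint, and \<open>act_lunit_assoc\<close> absorbs the associativity arrow. With g the counit
  this becomes law (iii) in a module and the left unit law in V.\<close>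

lemma cmp_unit_left:
  assumes h: "h \<in> hom S Y Z" and g: "g \<in> hom S (Q \<star> X) Y" and [simp]: "Q \<in> Obj V" "X \<in> Obj S"
  shows "cmp X Y Z \<cdot>\<^bsub>V\<^esub> (Phi (UnitObj V) Y Z (h \<cdot>\<^bsub>S\<^esub> LU Y) \<boxtimes>\<^bsub>V\<^esub> Phi Q X Y g)
    = Phi Q X Z (h \<cdot>\<^bsub>S\<^esub> g) \<cdot>\<^bsub>V\<^esub> LUnit V Q"
proof -
  note [simp] = S.hom_facts[OF h] S.hom_facts[OF g]
  have "cmp X Y Z \<cdot>\<^bsub>V\<^esub> (Phi (UnitObj V) Y Z (h \<cdot>\<^bsub>S\<^esub> LU Y) \<boxtimes>\<^bsub>V\<^esub> Phi Q X Y g)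
      = Phi (UnitObj V \<otimes>\<^bsub>V\<^esub> Q) X Z (h \<cdot>\<^bsub>S\<^esub> (LU Y \<cdot>\<^bsub>S\<^esub> (Ident V (UnitObj V) \<bullet> g)) \<cdot>\<^bsub>S\<^esub> As (UnitObj V) Q X)"
    by (subst cmp_phi) (auto simp: in_hom_iff)
  also have "\<dots> = Phi (UnitObj V \<otimes>\<^bsub>V\<^esub> Q) X Z (h \<cdot>\<^bsub>S\<^esub> g \<cdot>\<^bsub>S\<^esub> (LU (Q \<star> X) \<cdot>\<^bsub>S\<^esub> As (UnitObj V) Q X))"
    by (subst act_lunit_natural[OF g]) simp
  also have "\<dots> = Phi Q X Z (h \<cdot>\<^bsub>S\<^esub> g) \<cdot>\<^bsub>V\<^esub> LUnit V Q"
    by (subst act_lunit_assoc, simp, simp, rule phi_natural) (auto simp: in_hom_iff)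
  finally show ?thesis .
qed

text \<open>Here the triangle absorbs the associativity arrow. With f the counit this becomes law
  (ii) in a module and the right unit law in V.\<close>

lemma cmp_unit_right:
  assumes f: "f \<in> hom S (P \<star> Y) Z" and h: "h \<in> hom S X Y" and [simp]: "P \<in> Obj V"
  shows "cmp X Y Z \<cdot>\<^bsub>V\<^esub> (Phi P Y Z f \<boxtimes>\<^bsub>V\<^esub> Phi (UnitObj V) X Y (h \<cdot>\<^bsub>S\<^esub> LU X))
    = Phi P X Z (f \<cdot>\<^bsub>S\<^esub> (Ident V P \<bullet> h)) \<cdot>\<^bsub>V\<^esub> RUnit V P"
proof -
  note [simp] = S.hom_facts[OF h] S.hom_facts[OF f]
  have "cmp X Y Z \<cdot>\<^bsub>V\<^esub> (Phi P Y Z f \<boxtimes>\<^bsub>V\<^esub> Phi (UnitObj V) X Y (h \<cdot>\<^bsub>S\<^esub> LU X))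
      = Phi (P \<otimes>\<^bsub>V\<^esub> UnitObj V) X Z (f \<cdot>\<^bsub>S\<^esub> (Ident V P \<bullet> (h \<cdot>\<^bsub>S\<^esub> LU X)) \<cdot>\<^bsub>S\<^esub> As P (UnitObj V) X)"
    by (subst cmp_phi) (auto simp: in_hom_iff)
  also have "\<dots> = Phi (P \<otimes>\<^bsub>V\<^esub> UnitObj V) X Z ((f \<cdot>\<^bsub>S\<^esub> (Ident V P \<bullet> h)) \<cdot>\<^bsub>S\<^esub> ((Ident V P \<bullet> LU X) \<cdot>\<^bsub>S\<^esub> As P (UnitObj V) X))"
    by simp
  also have "\<dots> = Phi P X Z (f \<cdot>\<^bsub>S\<^esub> (Ident V P \<bullet> h)) \<cdot>\<^bsub>V\<^esub> RUnit V P"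
    by (subst act_triangle, simp, simp, rule phi_natural) (auto simp: in_hom_iff)
  finally show ?thesis .
qed

end

section \<open>V as a category enriched in itself\<close>

context closed_monoidal_category
begin

sublocale self: closed_action V V "Tens V" "TensA V" "Assoc V" "LUnit V" "IHom V" "Cur V"
proof
  fix X Y assume "X \<in> Obj V" "Y \<in> Obj V"
  then show "IHom V X Y \<in> Obj V"
    using ihom_functor[of X] by (auto simp: is_functor_def)
next
  fix k K' K X f Y assume a: "k \<in> hom V K' K" "X \<in> Obj V" "f \<in> hom V (K \<otimes> X) Y"
  note [simp] = hom_facts[OF a(1)] hom_facts[OF a(3)] a(2)
  \<comment> \<open>Setting the second variable to an identity leaves naturality in K.\<close>
  have "IHomA V X (Ident V Y) = Ident V (IHom V X Y)"
    using ihom_functor[of X] by (auto simp: is_functor_def)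
  moreover have "Cur V K X Y f \<in> hom V K (IHom V X Y)"
    using cur_bij[of K X Y] a(3) by (auto simp: bij_betw_def)
  note hom_facts[OF this, simp]
  ultimately show "Cur V K' X Y (f \<cdot> (k \<boxtimes> Ident V X)) = Cur V K X Y f \<cdot> k"
    using cur_natural[OF a(1,2) ident_hom a(3), of] by simp
qed (simp_all add: cur_bij)

lemma self_eps: "self.eps = ev V"
  by (intro ext) (simp add: self.eps_def ev_def)

lemma self_vcat_simps [simp]:
  "VObj (self_vcat V) = Obj V" "VHom (self_vcat V) = IHom V" "VCmp (self_vcat V) = self.cmp"
  "VUnit (self_vcat V) = (\<lambda>X. varpi V X X (Ident V X))"
  by (auto simp: self_vcat_def self.cmp_def self_eps fun_eq_iff)

lemma varpi_simps [simp]: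
  assumes "f \<in> Arr V" "Dom V f = X" "Cod V f = Y"
  shows "varpi V X Y f \<in> Arr V" "Dom V (varpi V X Y f) = UnitObj V"
    "Cod V (varpi V X Y f) = IHom V X Y"
  using assms by (auto simp: varpi_def)

text \<open>Since \<open>varpi\<close> is transposition from the unit object, composing with it
  amounts to composing inside a transpose. This and its right-hand version translate V-naturality
  into ordinary equations.\<close>

lemma self_cmp_varpi_left:
  assumes g: "g \<in> hom V Y Z" and u: "u \<in> hom V (Q \<otimes> X) Y" and [simp]: "Q \<in> Obj V" "X \<in> Obj V"
  shows "self.cmp X Y Z \<cdot> (varpi V Y Z g \<boxtimes> Cur V Q X Y u) = Cur V Q X Z (g \<cdot> u) \<cdot> LUnit V Q"
  unfolding varpi_def using self.cmp_unit_left[OF assms] .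

lemma self_cmp_varpi_right:
  assumes u: "u \<in> hom V (P \<otimes> Y) Z" and g: "g \<in> hom V X Y" and [simp]: "P \<in> Obj V"
  shows "self.cmp X Y Z \<cdot> (Cur V P Y Z u \<boxtimes> varpi V X Y g)
    = Cur V P X Z (u \<cdot> (Ident V P \<boxtimes> g)) \<cdot> RUnit V P"
  unfolding varpi_def using self.cmp_unit_right[OF assms] .

lemma v_category_self: "v_category V (self_vcat V)"
  unfolding v_category_def
proof (intro conjI ballI; unfold self_vcat_simps)
  fix W X Y Z assume [simp]: "W \<in> Obj V" "X \<in> Obj V" "Y \<in> Obj V" "Z \<in> Obj V"
  show "self.cmp W X Z \<cdot> (self.cmp X Y Z \<boxtimes> Ident V (IHom V W X))
    = self.cmp W Y Z \<cdot> (Ident V (IHom V Y Z) \<boxtimes> self.cmp W X Y) \<cdot> Assoc V (IHom V Y Z) (IHom V X Y) (IHom V W X)"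
    by (rule self.cmp_assoc) auto
next
  fix X Y assume [simp]: "X \<in> Obj V" "Y \<in> Obj V"
  show "self.cmp X Y Y \<cdot> (varpi V Y Y (Ident V Y) \<boxtimes> Ident V (IHom V X Y)) = LUnit V (IHom V X Y)"
    using self_cmp_varpi_left[of "Ident V Y" Y Y "self.eps X Y" "IHom V X Y" X]
    by (simp add: in_hom_iff)
  show "self.cmp X X Y \<cdot> (Ident V (IHom V X Y) \<boxtimes> varpi V X X (Ident V X)) = RUnit V (IHom V X Y)"
    using self_cmp_varpi_right[of "self.eps X Y" "IHom V X Y" X Y "Ident V X" X]
    by (simp add: in_hom_iff)
qed (auto simp: in_hom_iff)

end

section \<open>V-structures and cylinders\<close>

context closed_monoidal_category
begin

text \<open>Under transposition, preservation of composition is associativity in A (through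
  \<open>self.cmp_phi\<close>), and preservation of units is the left unit law of A.\<close>

lemma v_functor_representable:
  assumes A: "v_category V A" and [simp]: "X \<in> VObj A"
  shows "v_functor V A (self_vcat V) (representable V A X)"
proof -
  have [simp]: "VHom A Y Z \<in> Obj V" if "Y \<in> VObj A" "Z \<in> VObj A" for Y Z
    using A that by (auto simp: v_category_def)
  have [simp]: "VCmp A W Y Z \<in> Arr V" "Dom V (VCmp A W Y Z) = VHom A Y Z \<otimes> VHom A W Y"
    "Cod V (VCmp A W Y Z) = VHom A W Z"
    if "W \<in> VObj A" "Y \<in> VObj A" "Z \<in> VObj A" for W Y Z
    using A that by (auto simp: v_category_def in_hom_iff)
  have [simp]: "VUnit A W \<in> Arr V" "Dom V (VUnit A W) = UnitObj V" "Cod V (VUnit A W) = VHom A W W"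
    if "W \<in> VObj A" for W
    using A that by (auto simp: v_category_def in_hom_iff)
  let ?F = "\<lambda>Y Z. Cur V (VHom A Y Z) (VHom A X Y) (VHom A X Z) (VCmp A X Y Z)"
  have "?F W Z \<cdot> VCmp A W Y Z = self.cmp (VHom A X W) (VHom A X Y) (VHom A X Z) \<cdot> (?F Y Z \<boxtimes> ?F W Y)"
    if [simp]: "W \<in> VObj A" "Y \<in> VObj A" "Z \<in> VObj A" for W Y Z
  proof -
    have "?F W Z \<cdot> VCmp A W Y Z
        = Cur V (VHom A Y Z \<otimes> VHom A W Y) (VHom A X W) (VHom A X Z)
            (VCmp A X W Z \<cdot> (VCmp A W Y Z \<boxtimes> Ident V (VHom A X W)))"
      by (rule self.phi_natural[symmetric]) (auto simp: in_hom_iff)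
    also have "VCmp A X W Z \<cdot> (VCmp A W Y Z \<boxtimes> Ident V (VHom A X W))
        = VCmp A X Y Z \<cdot> (Ident V (VHom A Y Z) \<boxtimes> VCmp A X W Y)
            \<cdot> Assoc V (VHom A Y Z) (VHom A W Y) (VHom A X W)"
      using A that by (auto simp: v_category_def)
    also have "Cur V (VHom A Y Z \<otimes> VHom A W Y) (VHom A X W) (VHom A X Z) \<dots>
        = self.cmp (VHom A X W) (VHom A X Y) (VHom A X Z) \<cdot> (?F Y Z \<boxtimes> ?F W Y)"
      by (subst self.cmp_phi) (auto simp: in_hom_iff)
    finally show ?thesis .
  qed
  moreover have "?F Y Y \<cdot> VUnit A Y = varpi V (VHom A X Y) (VHom A X Y) (Ident V (VHom A X Y))"
    if [simp]: "Y \<in> VObj A" for Y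
  proof -
    have "?F Y Y \<cdot> VUnit A Y = Cur V (UnitObj V) (VHom A X Y) (VHom A X Y)
        (VCmp A X Y Y \<cdot> (VUnit A Y \<boxtimes> Ident V (VHom A X Y)))"
      by (rule self.phi_natural[symmetric]) (auto simp: in_hom_iff)
    also have "VCmp A X Y Y \<cdot> (VUnit A Y \<boxtimes> Ident V (VHom A X Y)) = LUnit V (VHom A X Y)"
      using A by (auto simp: v_category_def)
    finally show ?thesis by (simp add: varpi_def)
  qed
  ultimately show ?thesis
    unfolding v_functor_def using A v_category_self by (auto simp: representable_def in_hom_iff)
qed

lemma v_functor_comp:
  assumes "v_functor V A B F" "v_functor V B C G"
  shows "v_functor V A C (vfunctor_comp V G F)"
proof -
  have A: "v_category V A" and B: "v_category V B" and C: "v_category V C"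
    using assms by (auto simp: v_functor_def)
  have [simp]: "FObj F X \<in> VObj B" if "X \<in> VObj A" for X
    using assms that by (auto simp: v_functor_def)
  have [simp]: "FObj G X \<in> VObj C" if "X \<in> VObj B" for X
    using assms that by (auto simp: v_functor_def)
  have [simp]: "FHom F X Y \<in> Arr V" "Dom V (FHom F X Y) = VHom A X Y"
    "Cod V (FHom F X Y) = VHom B (FObj F X) (FObj F Y)" if "X \<in> VObj A" "Y \<in> VObj A" for X Y
    using assms(1) that by (auto simp: v_functor_def in_hom_iff)
  have [simp]: "FHom G X Y \<in> Arr V" "Dom V (FHom G X Y) = VHom B X Y"
    "Cod V (FHom G X Y) = VHom C (FObj G X) (FObj G Y)" if "X \<in> VObj B" "Y \<in> VObj B" for X Y
    using assms(2) that by (auto simp: v_functor_def in_hom_iff)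
  have [simp]: "VCmp A X Y Z \<in> Arr V" "Dom V (VCmp A X Y Z) = VHom A Y Z \<otimes> VHom A X Y"
    "Cod V (VCmp A X Y Z) = VHom A X Z"
    if "X \<in> VObj A" "Y \<in> VObj A" "Z \<in> VObj A" for X Y Z
    using A that by (auto simp: v_category_def in_hom_iff)
  have [simp]: "VUnit A X \<in> Arr V" "Dom V (VUnit A X) = UnitObj V" "Cod V (VUnit A X) = VHom A X X"
    if "X \<in> VObj A" for X
    using A that by (auto simp: v_category_def in_hom_iff)
  have [simp]: "VCmp B X Y Z \<in> Arr V" "Dom V (VCmp B X Y Z) = VHom B Y Z \<otimes> VHom B X Y"
    "Cod V (VCmp B X Y Z) = VHom B X Z"
    if "X \<in> VObj B" "Y \<in> VObj B" "Z \<in> VObj B" for X Y Z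
    using B that by (auto simp: v_category_def in_hom_iff)
  have [simp]: "VCmp C X Y Z \<in> Arr V" "Dom V (VCmp C X Y Z) = VHom C Y Z \<otimes> VHom C X Y"
    "Cod V (VCmp C X Y Z) = VHom C X Z"
    if "X \<in> VObj C" "Y \<in> VObj C" "Z \<in> VObj C" for X Y Z
    using C that by (auto simp: v_category_def in_hom_iff)
  let ?f = "FObj F" and ?gf = "\<lambda>X. FObj G (FObj F X)"
  have "(FHom G (?f X) (?f Z) \<cdot> FHom F X Z) \<cdot> VCmp A X Y Z
      = VCmp C (?gf X) (?gf Y) (?gf Z)
        \<cdot> ((FHom G (?f Y) (?f Z) \<cdot> FHom F Y Z) \<boxtimes> (FHom G (?f X) (?f Y) \<cdot> FHom F X Y))"
    if [simp]: "X \<in> VObj A" "Y \<in> VObj A" "Z \<in> VObj A" for X Y Z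
  proof -
    have "FHom F X Z \<cdot> VCmp A X Y Z = VCmp B (?f X) (?f Y) (?f Z) \<cdot> (FHom F Y Z \<boxtimes> FHom F X Y)"
      using assms(1) that by (simp add: v_functor_def)
    then have "(FHom G (?f X) (?f Z) \<cdot> FHom F X Z) \<cdot> VCmp A X Y Z
        = FHom G (?f X) (?f Z) \<cdot> (VCmp B (?f X) (?f Y) (?f Z) \<cdot> (FHom F Y Z \<boxtimes> FHom F X Y))"
      by simp
    also have "\<dots> = VCmp C (?gf X) (?gf Y) (?gf Z)
        \<cdot> ((FHom G (?f Y) (?f Z) \<boxtimes> FHom G (?f X) (?f Y)) \<cdot> (FHom F Y Z \<boxtimes> FHom F X Y))"
      by (rule reassoc) (use assms(2) that in \<open>auto simp: v_functor_def\<close>)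
    finally show ?thesis by simp
  qed
  moreover have "(FHom G (?f X) (?f X) \<cdot> FHom F X X) \<cdot> VUnit A X = VUnit C (?gf X)"
    if [simp]: "X \<in> VObj A" for X
  proof -
    have "FHom F X X \<cdot> VUnit A X = VUnit B (?f X)"
      and "FHom G (?f X) (?f X) \<cdot> VUnit B (?f X) = VUnit C (?gf X)"
      using assms that by (auto simp: v_functor_def)
    then show ?thesis by simp
  qed
  ultimately show ?thesis
    unfolding v_functor_def using A C by (auto simp: vfunctor_comp_def in_hom_iff)
qed

end

text \<open>The opposite category is unfolded here once and for all: the first variable composes in
  reverse order.\<close>

lemma hom_bifunctorD:
  assumes "bifunctor (op_cat S) S E H HA"
  shows "\<lbrakk>X \<in> Obj S; Y \<in> Obj S\<rbrakk> \<Longrightarrow> H X Y \<in> Obj E"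
    and "\<lbrakk>f \<in> Arr S; g \<in> Arr S\<rbrakk> \<Longrightarrow> HA f g \<in> Arr E"
    and "\<lbrakk>f \<in> Arr S; g \<in> Arr S\<rbrakk> \<Longrightarrow> Dom E (HA f g) = H (Cod S f) (Dom S g)"
    and "\<lbrakk>f \<in> Arr S; g \<in> Arr S\<rbrakk> \<Longrightarrow> Cod E (HA f g) = H (Dom S f) (Cod S g)"
    and "\<lbrakk>X \<in> Obj S; Y \<in> Obj S\<rbrakk> \<Longrightarrow> HA (Ident S X) (Ident S Y) = Ident E (H X Y)"
    and "\<lbrakk>f \<in> Arr S; f' \<in> Arr S; Dom S f = Cod S f'; g \<in> Arr S; g' \<in> Arr S; Dom S g' = Cod S g\<rbrakk>
      \<Longrightarrow> HA f' g' \<cdot>\<^bsub>E\<^esub> HA f g = HA (f \<cdot>\<^bsub>S\<^esub> f') (g' \<cdot>\<^bsub>S\<^esub> g)"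
  using bifunctorD[OF assms] by (auto simp: op_cat_def)

section \<open>Moving arrows of S across the composition of a V-structure\<close>

context v_structure
begin

lemma shom_simps [simp]:
  shows "\<lbrakk>X \<in> Obj S; Y \<in> Obj S\<rbrakk> \<Longrightarrow> SHom A X Y \<in> Obj V"
    and "\<lbrakk>f \<in> Arr S; g \<in> Arr S\<rbrakk> \<Longrightarrow> SHomA A f g \<in> Arr V"
    and "\<lbrakk>f \<in> Arr S; g \<in> Arr S\<rbrakk> \<Longrightarrow> Dom V (SHomA A f g) = SHom A (Cod S f) (Dom S g)"
    and "\<lbrakk>f \<in> Arr S; g \<in> Arr S\<rbrakk> \<Longrightarrow> Cod V (SHomA A f g) = SHom A (Dom S f) (Cod S g)"
    and "\<lbrakk>X \<in> Obj S; Y \<in> Obj S\<rbrakk> \<Longrightarrow> SHomA A (Ident S X) (Ident S Y) = Ident V (SHom A X Y)"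
    and "\<lbrakk>f \<in> Arr S; f' \<in> Arr S; Dom S f = Cod S f'; g \<in> Arr S; g' \<in> Arr S; Dom S g' = Cod S g\<rbrakk>
      \<Longrightarrow> SHomA A f' g' \<cdot>\<^bsub>V\<^esub> SHomA A f g = SHomA A (f \<cdot>\<^bsub>S\<^esub> f') (g' \<cdot>\<^bsub>S\<^esub> g)"
  using hom_bifunctorD[OF shom_bifunctor] by auto

lemma shom_tail [simp]:
  assumes "f \<in> Arr S" "f' \<in> Arr S" "Dom S f = Cod S f'" "g \<in> Arr S" "g' \<in> Arr S" "Dom S g' = Cod S g"
    and "h \<in> Arr V" "Cod V h = SHom A (Cod S f) (Dom S g)"
  shows "SHomA A f' g' \<cdot>\<^bsub>V\<^esub> (SHomA A f g \<cdot>\<^bsub>V\<^esub> h) = SHomA A (f \<cdot>\<^bsub>S\<^esub> f') (g' \<cdot>\<^bsub>S\<^esub> g) \<cdot>\<^bsub>V\<^esub> h"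
  using assms by (simp flip: V.assoc)

lemma vcomp_simps [simp]:
  assumes "X \<in> Obj S" "Y \<in> Obj S" "Z \<in> Obj S"
  shows "VComp A X Y Z \<in> Arr V"
    "Dom V (VComp A X Y Z) = SHom A Y Z \<otimes>\<^bsub>V\<^esub> SHom A X Y"
    "Cod V (VComp A X Y Z) = SHom A X Z"
  using PiE3_mem[OF vcomp_hom assms] by (auto simp: in_hom_iff)

lemma vphi_simps [simp]:
  assumes "f \<in> Arr S" "Dom S f = X" "Cod S f = Y"
  shows "VPhi A X Y f \<in> Arr V" "Dom V (VPhi A X Y f) = UnitObj V" "Cod V (VPhi A X Y f) = SHom A X Y"
proof -
  have "VPhi A X Y f \<in> hom V (UnitObj V) (SHom A X Y)"
    using bij_betwE[OF vphi_bij, of X Y] assms by (auto simp: in_hom_iff)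
  then show "VPhi A X Y f \<in> Arr V" "Dom V (VPhi A X Y f) = UnitObj V" "Cod V (VPhi A X Y f) = SHom A X Y"
    by (auto simp: in_hom_iff)
qed

text \<open>Composition of generalised elements of hom objects, with arbitrary domains;
  \<open>cmp\<close> of a closed action is instead the composition morphism itself.\<close>

definition cmp :: "'p \<Rightarrow> 'p \<Rightarrow> 'p \<Rightarrow> 'm \<Rightarrow> 'm \<Rightarrow> 'm" where
  "cmp X Y Z u v = VComp A X Y Z \<cdot>\<^bsub>V\<^esub> (u \<boxtimes>\<^bsub>V\<^esub> v)"

lemma cmp_simps [simp]:
  assumes "X \<in> Obj S" "Y \<in> Obj S" "Z \<in> Obj S" "u \<in> Arr V" "v \<in> Arr V"
    "Cod V u = SHom A Y Z" "Cod V v = SHom A X Y"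
  shows "cmp X Y Z u v \<in> Arr V" "Dom V (cmp X Y Z u v) = Dom V u \<otimes>\<^bsub>V\<^esub> Dom V v"
    "Cod V (cmp X Y Z u v) = SHom A X Z"
  using assms by (auto simp: cmp_def)

lemma cmp_comp:
  assumes "X \<in> Obj S" "Y \<in> Obj S" "Z \<in> Obj S" "u \<in> Arr V" "v \<in> Arr V"
    "Cod V u = SHom A Y Z" "Cod V v = SHom A X Y"
    "p \<in> Arr V" "q \<in> Arr V" "Dom V u = Cod V p" "Dom V v = Cod V q"
  shows "cmp X Y Z u v \<cdot>\<^bsub>V\<^esub> (p \<boxtimes>\<^bsub>V\<^esub> q) = cmp X Y Z (u \<cdot>\<^bsub>V\<^esub> p) (v \<cdot>\<^bsub>V\<^esub> q)"
  using assms by (simp add: cmp_def)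

lemma cmp_comp_tail:
  assumes "X \<in> Obj S" "Y \<in> Obj S" "Z \<in> Obj S" "u \<in> Arr V" "v \<in> Arr V"
    "Cod V u = SHom A Y Z" "Cod V v = SHom A X Y"
    "p \<in> Arr V" "q \<in> Arr V" "Dom V u = Cod V p" "Dom V v = Cod V q"
    "h \<in> Arr V" "Cod V h = Dom V p \<otimes>\<^bsub>V\<^esub> Dom V q"
  shows "cmp X Y Z u v \<cdot>\<^bsub>V\<^esub> ((p \<boxtimes>\<^bsub>V\<^esub> q) \<cdot>\<^bsub>V\<^esub> h) = cmp X Y Z (u \<cdot>\<^bsub>V\<^esub> p) (v \<cdot>\<^bsub>V\<^esub> q) \<cdot>\<^bsub>V\<^esub> h"
  using assms by (simp add: cmp_comp flip: V.assoc)

lemma cmp_assoc: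
  assumes u: "u \<in> hom V P (SHom A Y Z)" and v: "v \<in> hom V Q (SHom A X Y)"
    and w: "w \<in> hom V R (SHom A W X)"
    and [simp]: "W \<in> Obj S" "X \<in> Obj S" "Y \<in> Obj S" "Z \<in> Obj S"
  shows "cmp W X Z (cmp X Y Z u v) w = cmp W Y Z u (cmp W X Y v w) \<cdot>\<^bsub>V\<^esub> Assoc V P Q R"
proof -
  note [simp] = V.hom_facts[OF u] V.hom_facts[OF v] V.hom_facts[OF w]
  have "cmp W X Z (cmp X Y Z u v) w
      = (VComp A W X Z \<cdot>\<^bsub>V\<^esub> (VComp A X Y Z \<boxtimes>\<^bsub>V\<^esub> Ident V (SHom A W X))) \<cdot>\<^bsub>V\<^esub> ((u \<boxtimes>\<^bsub>V\<^esub> v) \<boxtimes>\<^bsub>V\<^esub> w)"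
    by (simp add: cmp_def)
  also have "\<dots> = VComp A W Y Z \<cdot>\<^bsub>V\<^esub> (Ident V (SHom A Y Z) \<boxtimes>\<^bsub>V\<^esub> VComp A W X Y)
      \<cdot>\<^bsub>V\<^esub> (Assoc V (SHom A Y Z) (SHom A X Y) (SHom A W X) \<cdot>\<^bsub>V\<^esub> ((u \<boxtimes>\<^bsub>V\<^esub> v) \<boxtimes>\<^bsub>V\<^esub> w))"
    by (subst vcomp_assoc) auto
  also have "\<dots> = cmp W Y Z u (cmp W X Y v w) \<cdot>\<^bsub>V\<^esub> Assoc V P Q R"
    by (subst V.assoc_natural) (auto simp: cmp_def in_hom_iff)
  finally show ?thesis .
qed

text \<open>Law (iii) with the inverse of l moved to the other side, extended from the identity to
  any v by naturality of l.\<close>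

lemma cmp_vphi_left:
  assumes g: "g \<in> hom S Y Z" and v: "v \<in> hom V Q (SHom A X Y)" and [simp]: "X \<in> Obj S"
  shows "cmp X Y Z (VPhi A Y Z g) v = SHomA A (Ident S X) g \<cdot>\<^bsub>V\<^esub> v \<cdot>\<^bsub>V\<^esub> LUnit V Q"
proof -
  note [simp] = S.hom_facts[OF g] V.hom_facts[OF v]
  have "SHomA A (Ident S X) g \<cdot>\<^bsub>V\<^esub> (v \<cdot>\<^bsub>V\<^esub> LUnit V Q)
      = SHomA A (Ident S X) g \<cdot>\<^bsub>V\<^esub> (LUnit V (SHom A X Y) \<cdot>\<^bsub>V\<^esub> (Ident V (UnitObj V) \<boxtimes>\<^bsub>V\<^esub> v))"
    by (simp only: V.lunit_natural[OF v])
  also have "\<dots> = cmp X Y Z (VPhi A Y Z g) v"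
    by (simp add: shoma_right[OF _ g] cmp_def)
  finally show ?thesis by simp
qed

lemma cmp_vphi_right:
  assumes f: "f \<in> hom S X Y" and u: "u \<in> hom V P (SHom A Y Z)" and [simp]: "Z \<in> Obj S"
  shows "cmp X Y Z u (VPhi A X Y f) = SHomA A f (Ident S Z) \<cdot>\<^bsub>V\<^esub> u \<cdot>\<^bsub>V\<^esub> RUnit V P"
proof -
  note [simp] = S.hom_facts[OF f] V.hom_facts[OF u]
  have "SHomA A f (Ident S Z) \<cdot>\<^bsub>V\<^esub> (u \<cdot>\<^bsub>V\<^esub> RUnit V P)
      = SHomA A f (Ident S Z) \<cdot>\<^bsub>V\<^esub> (RUnit V (SHom A Y Z) \<cdot>\<^bsub>V\<^esub> (u \<boxtimes>\<^bsub>V\<^esub> Ident V (UnitObj V)))"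
    by (simp only: V.runit_natural[OF u])
  also have "\<dots> = cmp X Y Z u (VPhi A X Y f)"
    by (simp add: shoma_left[OF f] cmp_def)
  finally show ?thesis by simp
qed

lemma push_cmp:
  assumes f: "f \<in> hom S Z Z'" and u: "u \<in> hom V P (SHom A Y Z)" and v: "v \<in> hom V Q (SHom A X Y)"
    and [simp]: "X \<in> Obj S" "Y \<in> Obj S"
  shows "SHomA A (Ident S X) f \<cdot>\<^bsub>V\<^esub> cmp X Y Z u v = cmp X Y Z' (SHomA A (Ident S Y) f \<cdot>\<^bsub>V\<^esub> u) v"
proof -
  note [simp] = S.hom_facts[OF f] V.hom_facts[OF u] V.hom_facts[OF v]
  let ?l = "LUnit V (P \<otimes>\<^bsub>V\<^esub> Q)" let ?a = "Assoc V (UnitObj V) P Q"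
  have "(SHomA A (Ident S X) f \<cdot>\<^bsub>V\<^esub> cmp X Y Z u v) \<cdot>\<^bsub>V\<^esub> (?l \<cdot>\<^bsub>V\<^esub> ?a)
      = (SHomA A (Ident S X) f \<cdot>\<^bsub>V\<^esub> cmp X Y Z u v \<cdot>\<^bsub>V\<^esub> ?l) \<cdot>\<^bsub>V\<^esub> ?a"
    by simp
  also have "\<dots> = cmp X Z Z' (VPhi A Z Z' f) (cmp X Y Z u v) \<cdot>\<^bsub>V\<^esub> ?a"
    by (subst cmp_vphi_left[OF f]) (auto simp: in_hom_iff)
  also have "\<dots> = cmp X Y Z' (cmp Y Z Z' (VPhi A Z Z' f) u) v"
    by (rule cmp_assoc[symmetric, OF _ u v]) (auto simp: in_hom_iff)
  also have "\<dots> = cmp X Y Z' (SHomA A (Ident S Y) f \<cdot>\<^bsub>V\<^esub> u \<cdot>\<^bsub>V\<^esub> LUnit V P) v"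
    by (subst cmp_vphi_left[OF f u]) auto
  also have "\<dots> = cmp X Y Z' (SHomA A (Ident S Y) f \<cdot>\<^bsub>V\<^esub> u) v \<cdot>\<^bsub>V\<^esub> (LUnit V P \<boxtimes>\<^bsub>V\<^esub> Ident V Q)"
    by (subst cmp_comp) auto
  also have "\<dots> = cmp X Y Z' (SHomA A (Ident S Y) f \<cdot>\<^bsub>V\<^esub> u) v \<cdot>\<^bsub>V\<^esub> (?l \<cdot>\<^bsub>V\<^esub> ?a)"
    by (simp add: V.self.act_lunit_assoc)
  finally show ?thesis
    by (rule V.iso_cancel_right[OF V.isos_comp[OF V.assoc_isos V.lunit_isos], rotated -1]) auto
qed

lemma cmp_push:
  assumes f: "f \<in> hom S Y Y'" and u: "u \<in> hom V P (SHom A Y' Z)" and v: "v \<in> hom V Q (SHom A X Y)"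
    and [simp]: "X \<in> Obj S" "Z \<in> Obj S"
  shows "cmp X Y' Z u (SHomA A (Ident S X) f \<cdot>\<^bsub>V\<^esub> v) = cmp X Y Z (SHomA A f (Ident S Z) \<cdot>\<^bsub>V\<^esub> u) v"
proof -
  note [simp] = S.hom_facts[OF f] V.hom_facts[OF u] V.hom_facts[OF v]
  let ?e = "RUnit V P \<boxtimes>\<^bsub>V\<^esub> Ident V Q"
  have "cmp X Y Z (SHomA A f (Ident S Z) \<cdot>\<^bsub>V\<^esub> u) v \<cdot>\<^bsub>V\<^esub> ?e
      = cmp X Y Z (cmp Y Y' Z u (VPhi A Y Y' f)) v"
    by (subst cmp_vphi_right[OF f u]) (auto simp: cmp_comp)
  also have "\<dots> = cmp X Y' Z u (cmp X Y Y' (VPhi A Y Y' f) v) \<cdot>\<^bsub>V\<^esub> Assoc V P (UnitObj V) Q"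
    by (rule cmp_assoc[OF u _ v]) (auto simp: in_hom_iff)
  also have "\<dots> = cmp X Y' Z u (SHomA A (Ident S X) f \<cdot>\<^bsub>V\<^esub> v)
      \<cdot>\<^bsub>V\<^esub> ((Ident V P \<boxtimes>\<^bsub>V\<^esub> LUnit V Q) \<cdot>\<^bsub>V\<^esub> Assoc V P (UnitObj V) Q)"
    by (subst cmp_vphi_left[OF f v]) (auto simp: cmp_comp cmp_comp_tail)
  also have "\<dots> = cmp X Y' Z u (SHomA A (Ident S X) f \<cdot>\<^bsub>V\<^esub> v) \<cdot>\<^bsub>V\<^esub> ?e"
    by (simp add: V.triangle)
  finally show ?thesis
    by (rule V.iso_cancel_right[OF V.tens_iso_ident[OF V.runit_isos], symmetric, rotated -1]) auto
qed

lemma pull_cmp: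
  assumes f: "f \<in> hom S X' X" and u: "u \<in> hom V P (SHom A Y Z)" and v: "v \<in> hom V Q (SHom A X Y)"
    and [simp]: "Y \<in> Obj S" "Z \<in> Obj S"
  shows "SHomA A f (Ident S Z) \<cdot>\<^bsub>V\<^esub> cmp X Y Z u v = cmp X' Y Z u (SHomA A f (Ident S Y) \<cdot>\<^bsub>V\<^esub> v)"
proof -
  note [simp] = S.hom_facts[OF f] V.hom_facts[OF u] V.hom_facts[OF v]
  let ?r = "RUnit V (P \<otimes>\<^bsub>V\<^esub> Q)"
  have "(SHomA A f (Ident S Z) \<cdot>\<^bsub>V\<^esub> cmp X Y Z u v) \<cdot>\<^bsub>V\<^esub> ?r
      = cmp X' X Z (cmp X Y Z u v) (VPhi A X' X f)"
    by (subst cmp_vphi_right[OF f]) (auto simp: in_hom_iff)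
  also have "\<dots> = cmp X' Y Z u (cmp X' X Y v (VPhi A X' X f)) \<cdot>\<^bsub>V\<^esub> Assoc V P Q (UnitObj V)"
    by (rule cmp_assoc[OF u v]) (auto simp: in_hom_iff)
  also have "\<dots> = cmp X' Y Z u (SHomA A f (Ident S Y) \<cdot>\<^bsub>V\<^esub> v)
      \<cdot>\<^bsub>V\<^esub> ((Ident V P \<boxtimes>\<^bsub>V\<^esub> RUnit V Q) \<cdot>\<^bsub>V\<^esub> Assoc V P Q (UnitObj V))"
    by (subst cmp_vphi_right[OF f v]) (auto simp: cmp_comp cmp_comp_tail)
  also have "\<dots> = cmp X' Y Z u (SHomA A f (Ident S Y) \<cdot>\<^bsub>V\<^esub> v) \<cdot>\<^bsub>V\<^esub> ?r"
    by (simp add: V.runit_assoc)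
  finally show ?thesis
    by (rule V.iso_cancel_right[OF V.runit_isos, rotated -1]) auto
qed

lemma vphi_push:
  assumes "f \<in> hom S X Y" "y \<in> hom S Y Y'"
  shows "SHomA A (Ident S X) y \<cdot>\<^bsub>V\<^esub> VPhi A X Y f = VPhi A X Y' (y \<cdot>\<^bsub>S\<^esub> f)"
  using vphi_natural[OF S.ident_hom assms(2,1)] S.hom_facts[OF assms(1)] S.hom_facts[OF assms(2)]
  by simp

lemma vphi_pull:
  assumes "f \<in> hom S X Y" "x \<in> hom S X' X"
  shows "SHomA A x (Ident S Y) \<cdot>\<^bsub>V\<^esub> VPhi A X Y f = VPhi A X' Y (f \<cdot>\<^bsub>S\<^esub> x)"
  using vphi_natural[OF assms(2) S.ident_hom assms(1)] S.hom_facts[OF assms(1)] S.hom_facts[OF assms(2)]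
  by simp

lemma associated_vcat_simps [simp]:
  "VObj (associated_vcat S A) = Obj S" "VHom (associated_vcat S A) = SHom A"
  "VCmp (associated_vcat S A) = VComp A"
  "VUnit (associated_vcat S A) = (\<lambda>X. VPhi A X X (Ident S X))"
  by (simp_all add: associated_vcat_def)

lemma v_category_associated: "v_category V (associated_vcat S A)"
  unfolding v_category_def
proof (intro conjI ballI; unfold associated_vcat_simps)
  fix X Y assume [simp]: "X \<in> Obj S" "Y \<in> Obj S"
  show "VComp A X Y Y \<cdot>\<^bsub>V\<^esub> (VPhi A Y Y (Ident S Y) \<boxtimes>\<^bsub>V\<^esub> Ident V (SHom A X Y)) = LUnit V (SHom A X Y)"
    using cmp_vphi_left[of "Ident S Y" Y Y "Ident V (SHom A X Y)" "SHom A X Y" X]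
    by (simp add: cmp_def in_hom_iff)
  show "VComp A X X Y \<cdot>\<^bsub>V\<^esub> (Ident V (SHom A X Y) \<boxtimes>\<^bsub>V\<^esub> VPhi A X X (Ident S X)) = RUnit V (SHom A X Y)"
    using cmp_vphi_right[of "Ident S X" X X "Ident V (SHom A X Y)" "SHom A X Y" Y]
    by (simp add: cmp_def in_hom_iff)
qed (auto simp: in_hom_iff vcomp_assoc)

end

locale v_cylinder = v_structure V S A
  for V :: "('o, 'm) cmcat" and S :: "('p, 'n) cat" and A :: "('o, 'm, 'p, 'n, 'z) vstruct_scheme" +
  fixes T :: "'o \<Rightarrow> 'p \<Rightarrow> 'p"
    and \<alpha> :: "'o \<Rightarrow> 'p \<Rightarrow> 'm"
    and \<Phi> :: "'o \<Rightarrow> 'p \<Rightarrow> 'p \<Rightarrow> 'm"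
  assumes cylinder: "is_cylinder V S A T \<alpha> \<Phi>"
begin

lemma cyl_simps [simp]:
  assumes "K \<in> Obj V" "X \<in> Obj S"
  shows "T K X \<in> Obj S" "\<alpha> K X \<in> Arr V" "Dom V (\<alpha> K X) = K" "Cod V (\<alpha> K X) = SHom A X (T K X)"
proof -
  have "\<alpha> \<in> (\<Pi>\<^sub>E K \<in> Obj V. \<Pi>\<^sub>E X \<in> Obj S. hom V K (SHom A X (T K X)))"
    "T \<in> Obj V \<rightarrow>\<^sub>E (Obj S \<rightarrow>\<^sub>E Obj S)"
    using cylinder by (simp_all add: is_cylinder_def)
  from PiE2_mem[OF this(1) assms] PiE2_mem[OF this(2) assms]
  show "T K X \<in> Obj S" "\<alpha> K X \<in> Arr V" "Dom V (\<alpha> K X) = K" "Cod V (\<alpha> K X) = SHom A X (T K X)"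
    by (auto simp: in_hom_iff)
qed

lemma Phi_iso:
  assumes "K \<in> Obj V" "X \<in> Obj S" "Y \<in> Obj S"
  shows "\<Phi> K X Y \<in> isos V (SHom A (T K X) Y) (IHom V K (SHom A X Y))"
proof -
  have "\<Phi> \<in> (\<Pi>\<^sub>E K \<in> Obj V. \<Pi>\<^sub>E X \<in> Obj S. \<Pi>\<^sub>E Y \<in> Obj S.
      isos V (SHom A (T K X) Y) (IHom V K (SHom A X Y)))"
    using cylinder unfolding is_cylinder_def by (elim conjE)
  from PiE3_mem[OF this assms] show ?thesis .
qed

lemmas Phi_simps [simp] = V.iso_facts(1-3)[OF Phi_iso]

lemma Phi_eq:
  assumes [simp]: "K \<in> Obj V" "X \<in> Obj S" "Y \<in> Obj S"
  shows "\<Phi> K X Y = Cur V (SHom A (T K X) Y) K (SHom A X Y)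
    (cmp X (T K X) Y (Ident V (SHom A (T K X) Y)) (\<alpha> K X))"
proof -
  have "V.self.eps K (SHom A X Y) \<cdot>\<^bsub>V\<^esub> (\<Phi> K X Y \<boxtimes>\<^bsub>V\<^esub> Ident V K)
      = cmp X (T K X) Y (Ident V (SHom A (T K X) Y)) (\<alpha> K X)"
    using cylinder assms unfolding is_cylinder_def V.self_eps cmp_def by blast
  moreover have "Cur V (SHom A (T K X) Y) K (SHom A X Y)
      (V.self.eps K (SHom A X Y) \<cdot>\<^bsub>V\<^esub> (\<Phi> K X Y \<boxtimes>\<^bsub>V\<^esub> Ident V K)) = \<Phi> K X Y"
    by (rule V.self.phi_eps) (auto simp: in_hom_iff)
  ultimately show ?thesis by simp
qed

lemma Phi_comp:
  assumes u: "u \<in> hom V L (SHom A (T K X) Y)" and [simp]: "K \<in> Obj V" "X \<in> Obj S" "Y \<in> Obj S"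
  shows "\<Phi> K X Y \<cdot>\<^bsub>V\<^esub> u = Cur V L K (SHom A X Y) (cmp X (T K X) Y u (\<alpha> K X))"
proof -
  note [simp] = V.hom_facts[OF u]
  have "\<Phi> K X Y \<cdot>\<^bsub>V\<^esub> u = Cur V L K (SHom A X Y)
      (cmp X (T K X) Y (Ident V (SHom A (T K X) Y)) (\<alpha> K X) \<cdot>\<^bsub>V\<^esub> (u \<boxtimes>\<^bsub>V\<^esub> Ident V K))"
    unfolding Phi_eq[OF assms(2-4)] by (rule V.self.phi_natural[symmetric]) (auto simp: in_hom_iff)
  then show ?thesis by (simp add: cmp_comp)
qed

lemma v_natural_Phi:
  assumes [simp]: "K \<in> Obj V" "X \<in> Obj S"
  shows "v_natural V (associated_vcat S A) (self_vcat V)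
    (representable V (associated_vcat S A) (T K X))
    (vfunctor_comp V (representable V (self_vcat V) K) (representable V (associated_vcat S A) X))
    (\<lambda>Y. varpi V (SHom A (T K X) Y) (IHom V K (SHom A X Y)) (\<Phi> K X Y))"
proof -
  let ?A = "associated_vcat S A"
  have "v_functor V ?A (self_vcat V) (representable V ?A (T K X))"
    by (rule V.v_functor_representable[OF v_category_associated]) simp
  moreover have "v_functor V ?A (self_vcat V)
      (vfunctor_comp V (representable V (self_vcat V) K) (representable V ?A X))"
    by (intro V.v_functor_comp[where B = "self_vcat V"] V.v_functor_representable V.v_category_self v_category_associated) auto
  moreover have "V.self.cmp (SHom A (T K X) Y) (SHom A (T K X) Z) (IHom V K (SHom A X Z))
      \<cdot>\<^bsub>V\<^esub> (varpi V (SHom A (T K X) Z) (IHom V K (SHom A X Z)) (\<Phi> K X Z)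
        \<boxtimes>\<^bsub>V\<^esub> Cur V (SHom A Y Z) (SHom A (T K X) Y) (SHom A (T K X) Z) (VComp A (T K X) Y Z))
      \<cdot>\<^bsub>V\<^esub> cinv V (LUnit V (SHom A Y Z))
    = V.self.cmp (SHom A (T K X) Y) (IHom V K (SHom A X Y)) (IHom V K (SHom A X Z))
      \<cdot>\<^bsub>V\<^esub> ((Cur V (IHom V (SHom A X Y) (SHom A X Z)) (IHom V K (SHom A X Y)) (IHom V K (SHom A X Z))
              (V.self.cmp K (SHom A X Y) (SHom A X Z))
            \<cdot>\<^bsub>V\<^esub> Cur V (SHom A Y Z) (SHom A X Y) (SHom A X Z) (VComp A X Y Z))
        \<boxtimes>\<^bsub>V\<^esub> varpi V (SHom A (T K X) Y) (IHom V K (SHom A X Y)) (\<Phi> K X Y))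
      \<cdot>\<^bsub>V\<^esub> cinv V (RUnit V (SHom A Y Z))" (is "?lhs = ?rhs")
    if [simp]: "Y \<in> Obj S" "Z \<in> Obj S" for Y Z
  proof -
    let ?c = "Cur V (SHom A Y Z) (SHom A X Y) (SHom A X Z) (VComp A X Y Z)"
    let ?i = "Ident V (SHom A Y Z)" and ?j = "Ident V (SHom A (T K X) Y)"
    have "?lhs = Cur V (SHom A Y Z) (SHom A (T K X) Y) (IHom V K (SHom A X Z))
        (\<Phi> K X Z \<cdot>\<^bsub>V\<^esub> VComp A (T K X) Y Z)"
      by (simp add: V.self_cmp_varpi_left in_hom_iff flip: V.assoc) simp
    also have "\<Phi> K X Z \<cdot>\<^bsub>V\<^esub> VComp A (T K X) Y Z
        = Cur V (SHom A Y Z \<otimes>\<^bsub>V\<^esub> SHom A (T K X) Y) K (SHom A X Z)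
            (cmp X (T K X) Z (cmp (T K X) Y Z ?i ?j) (\<alpha> K X))"
      by (subst Phi_comp) (auto simp: in_hom_iff cmp_def)
    also have "cmp X (T K X) Z (cmp (T K X) Y Z ?i ?j) (\<alpha> K X)
        = cmp X Y Z ?i (cmp X (T K X) Y ?j (\<alpha> K X)) \<cdot>\<^bsub>V\<^esub> Assoc V (SHom A Y Z) (SHom A (T K X) Y) K"
      by (rule cmp_assoc) (auto simp: in_hom_iff)
    finally have l: "?lhs = Cur V (SHom A Y Z) (SHom A (T K X) Y) (IHom V K (SHom A X Z))
        (Cur V (SHom A Y Z \<otimes>\<^bsub>V\<^esub> SHom A (T K X) Y) K (SHom A X Z)
          (cmp X Y Z ?i (cmp X (T K X) Y ?j (\<alpha> K X)) \<cdot>\<^bsub>V\<^esub> Assoc V (SHom A Y Z) (SHom A (T K X) Y) K))" .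
    have "Cur V (IHom V (SHom A X Y) (SHom A X Z)) (IHom V K (SHom A X Y)) (IHom V K (SHom A X Z))
          (V.self.cmp K (SHom A X Y) (SHom A X Z)) \<cdot>\<^bsub>V\<^esub> ?c
        = Cur V (SHom A Y Z) (IHom V K (SHom A X Y)) (IHom V K (SHom A X Z))
          (V.self.cmp K (SHom A X Y) (SHom A X Z) \<cdot>\<^bsub>V\<^esub> (?c \<boxtimes>\<^bsub>V\<^esub> Ident V (IHom V K (SHom A X Y))))"
      by (rule V.self.phi_natural[symmetric]) (auto simp: in_hom_iff)
    then have "?rhs = Cur V (SHom A Y Z) (SHom A (T K X) Y) (IHom V K (SHom A X Z))
        (V.self.cmp K (SHom A X Y) (SHom A X Z) \<cdot>\<^bsub>V\<^esub> (?c \<boxtimes>\<^bsub>V\<^esub> \<Phi> K X Y))"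
      by (simp add: V.self_cmp_varpi_right in_hom_iff flip: V.assoc) simp
    also have "V.self.cmp K (SHom A X Y) (SHom A X Z) \<cdot>\<^bsub>V\<^esub> (?c \<boxtimes>\<^bsub>V\<^esub> \<Phi> K X Y)
        = Cur V (SHom A Y Z \<otimes>\<^bsub>V\<^esub> SHom A (T K X) Y) K (SHom A X Z)
          (VComp A X Y Z \<cdot>\<^bsub>V\<^esub> (?i \<boxtimes>\<^bsub>V\<^esub> cmp X (T K X) Y ?j (\<alpha> K X)) \<cdot>\<^bsub>V\<^esub> Assoc V (SHom A Y Z) (SHom A (T K X) Y) K)"
      unfolding Phi_eq[OF assms \<open>Y \<in> Obj S\<close>] by (rule V.self.cmp_phi) (auto simp: in_hom_iff)
    finally show ?thesis using l by (simp add: cmp_def)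
  qed
  ultimately show ?thesis
    unfolding v_natural_def by (auto simp: representable_def vfunctor_comp_def in_hom_iff)
qed

lemma tensoring_cylinder: "tensoring V (associated_vcat S A) T \<Phi>"
  unfolding tensoring_def using v_natural_Phi by (auto simp: Phi_iso)

end

section \<open>The canonical V-structure with cylinder of a tensor-closed module\<close>

lemma (in closed_monoidal_category) varpi_bij:
  assumes [simp]: "X \<in> Obj V" "Y \<in> Obj V"
  shows "bij_betw (varpi V X Y) (hom V X Y) (hom V (UnitObj V) (IHom V X Y))"
proof -
  have "varpi V X Y = Cur V (UnitObj V) X Y \<circ> (\<lambda>f. f \<cdot> LUnit V X)"
    by (auto simp: varpi_def)
  then show ?thesis
    using bij_betw_trans[OF iso_precomp_bij[OF lunit_isos] cur_bij] by simp
qed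

context tensor_closed_module
begin

lemma mhom_simps [simp]:
  shows "\<lbrakk>X \<in> Obj S; Y \<in> Obj S\<rbrakk> \<Longrightarrow> SHom M X Y \<in> Obj V"
    and "\<lbrakk>f \<in> Arr S; g \<in> Arr S\<rbrakk> \<Longrightarrow> SHomA M f g \<in> Arr V"
    and "\<lbrakk>f \<in> Arr S; g \<in> Arr S\<rbrakk> \<Longrightarrow> Dom V (SHomA M f g) = SHom M (Cod S f) (Dom S g)"
    and "\<lbrakk>f \<in> Arr S; g \<in> Arr S\<rbrakk> \<Longrightarrow> Cod V (SHomA M f g) = SHom M (Dom S f) (Cod S g)"
    and "\<lbrakk>X \<in> Obj S; Y \<in> Obj S\<rbrakk> \<Longrightarrow> SHomA M (Ident S X) (Ident S Y) = Ident V (SHom M X Y)"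
  using hom_bifunctorD[OF shom_bifunctor] by auto

sublocale act: action V S "MTens M" "MTensA M" "MAssoc M" "MLUnit M"
  by unfold_locales
    (simp_all add: mtens_bifunctor PiE3_mem[OF massoc_iso] massoc_natural PiE_mem[OF mlunit_iso]
      mlunit_natural mpentagon mtriangle del: S.assoc V.assoc)

lemma mphi_natural':
  assumes k: "k \<in> hom V K' K" and x: "x \<in> hom S X' X" and y: "y \<in> hom S Y Y'"
    and f: "f \<in> hom S (K \<odot>\<^bsub>M\<^esub> X) Y"
  shows "MPhi M K' X' Y' (y \<cdot>\<^bsub>S\<^esub> (f \<cdot>\<^bsub>S\<^esub> (k \<boxdot>\<^bsub>M\<^esub> x)))
    = SHomA M x y \<cdot>\<^bsub>V\<^esub> (MPhi M K X Y f \<cdot>\<^bsub>V\<^esub> k)"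
proof -
  note [simp] = V.hom_facts[OF k] S.hom_facts[OF x] S.hom_facts[OF y] S.hom_facts[OF f]
  have "MPhi M K X Y f \<in> hom V K (SHom M X Y)"
    using bij_betwE[OF mphi_bij, of K X Y] f by auto
  note V.hom_facts[OF this, simp]
  show ?thesis using mphi_natural[OF assms] by simp
qed

sublocale act: closed_action V S "MTens M" "MTensA M" "MAssoc M" "MLUnit M" "SHom M" "MPhi M"
proof
  fix k K' K X f Y
  assume a: "k \<in> hom V K' K" "X \<in> Obj S" "f \<in> hom S (K \<odot>\<^bsub>M\<^esub> X) Y"
  note [simp] = V.hom_facts[OF a(1)] S.hom_facts[OF a(3)] a(2)
  have "MPhi M K X Y f \<in> hom V K (SHom M X Y)"
    using bij_betwE[OF mphi_bij, of K X Y] a(3) by auto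
  note V.hom_facts[OF this, simp]
  show "MPhi M K' X Y (f \<cdot>\<^bsub>S\<^esub> (k \<boxdot>\<^bsub>M\<^esub> Ident S X)) = MPhi M K X Y f \<cdot>\<^bsub>V\<^esub> k"
    using mphi_natural'[OF a(1) S.ident_hom S.ident_hom a(3)] by simp
qed (simp_all add: mphi_bij)

lemma mphi_push:
  assumes f: "f \<in> hom S (K \<odot>\<^bsub>M\<^esub> X) Y" and y: "y \<in> hom S Y Y'"
    and [simp]: "K \<in> Obj V" "X \<in> Obj S"
  shows "SHomA M (Ident S X) y \<cdot>\<^bsub>V\<^esub> MPhi M K X Y f = MPhi M K X Y' (y \<cdot>\<^bsub>S\<^esub> f)"
  using mphi_natural'[OF V.ident_hom S.ident_hom y f] S.hom_facts[OF f] S.hom_facts[OF y] by simp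

lemma mphi_pull:
  assumes f: "f \<in> hom S (K \<odot>\<^bsub>M\<^esub> X) Y" and x: "x \<in> hom S X' X" and [simp]: "K \<in> Obj V"
  shows "SHomA M x (Ident S Y) \<cdot>\<^bsub>V\<^esub> MPhi M K X Y f = MPhi M K X' Y (f \<cdot>\<^bsub>S\<^esub> (Ident V K \<boxdot>\<^bsub>M\<^esub> x))"
  using mphi_natural'[OF V.ident_hom x S.ident_hom f] S.hom_facts[OF f] S.hom_facts[OF x] by simp

lemma mev_eq: "mev V S M = act.eps"
  by (intro ext) (simp add: mev_def act.eps_def)

lemma canonical_simps:
  "SHom (canonical V S M) = SHom M" "SHomA (canonical V S M) = SHomA M"
  "\<lbrakk>X \<in> Obj S; Y \<in> Obj S; Z \<in> Obj S\<rbrakk> \<Longrightarrow> VComp (canonical V S M) X Y Z = act.cmp X Y Z"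
  "f \<in> hom S X Y \<Longrightarrow> VPhi (canonical V S M) X Y f = MPhi M (UnitObj V) X Y (f \<cdot>\<^bsub>S\<^esub> MLUnit M X)"
  using S.hom_facts by (auto simp: canonical_def act.cmp_def mev_eq)

lemma v_structure_canonical: "v_structure V S (canonical V S M)"
proof (unfold_locales, unfold canonical_simps(1,2))
  show "bifunctor (op_cat S) S V (SHom M) (SHomA M)" by (rule shom_bifunctor)
  show "VComp (canonical V S M) \<in> (\<Pi>\<^sub>E X \<in> Obj S. \<Pi>\<^sub>E Y \<in> Obj S. \<Pi>\<^sub>E Z \<in> Obj S.
      hom V (SHom M Y Z \<otimes>\<^bsub>V\<^esub> SHom M X Y) (SHom M X Z))"
    unfolding canonical_def vstruct.select_convs
    by (auto simp: mev_eq in_hom_iff)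
  show bij: "bij_betw (VPhi (canonical V S M) X Y) (hom S X Y) (hom V (UnitObj V) (SHom M X Y))"
    if [simp]: "X \<in> Obj S" "Y \<in> Obj S" for X Y
  proof -
    have "bij_betw (MPhi M (UnitObj V) X Y \<circ> (\<lambda>f. f \<cdot>\<^bsub>S\<^esub> MLUnit M X)) (hom S X Y) (hom V (UnitObj V) (SHom M X Y))"
      by (rule bij_betw_trans[OF S.iso_precomp_bij[OF act.act_lunit_iso] act.phi_bij]) auto
    then show ?thesis
      by (rule bij_betw_cong[THEN iffD1, rotated]) (simp add: canonical_simps)
  qed
  show "VPhi (canonical V S M) \<in> (\<Pi>\<^sub>E X \<in> Obj S. \<Pi>\<^sub>E Y \<in> Obj S.
      hom S X Y \<rightarrow>\<^sub>E hom V (UnitObj V) (SHom M X Y))"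
  proof (intro PiE_I)
    show "VPhi (canonical V S M) X Y f \<in> hom V (UnitObj V) (SHom M X Y)"
      if "X \<in> Obj S" "Y \<in> Obj S" "f \<in> hom S X Y" for X Y f
      using bij_betwE[OF bij] that by auto
  qed (auto simp: canonical_def)
next
  fix x y f X X' Y Y' assume a: "x \<in> hom S X' X" "y \<in> hom S Y Y'" "f \<in> hom S X Y"
  note [simp] = S.hom_facts[OF a(1)] S.hom_facts[OF a(2)] S.hom_facts[OF a(3)]
  have "VPhi (canonical V S M) X' Y' (y \<cdot>\<^bsub>S\<^esub> f \<cdot>\<^bsub>S\<^esub> x)
      = MPhi M (UnitObj V) X' Y' (y \<cdot>\<^bsub>S\<^esub> f \<cdot>\<^bsub>S\<^esub> (x \<cdot>\<^bsub>S\<^esub> MLUnit M X'))"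
    by (subst canonical_simps) (auto simp: in_hom_iff)
  also have "x \<cdot>\<^bsub>S\<^esub> MLUnit M X' = MLUnit M X \<cdot>\<^bsub>S\<^esub> (Ident V (UnitObj V) \<boxdot>\<^bsub>M\<^esub> x)"
    using act.act_lunit_natural[OF a(1)] by simp
  also have "MPhi M (UnitObj V) X' Y' (y \<cdot>\<^bsub>S\<^esub> f \<cdot>\<^bsub>S\<^esub> \<dots>)
      = MPhi M (UnitObj V) X' Y' (y \<cdot>\<^bsub>S\<^esub> (f \<cdot>\<^bsub>S\<^esub> MLUnit M X) \<cdot>\<^bsub>S\<^esub> (Ident V (UnitObj V) \<boxdot>\<^bsub>M\<^esub> x))"
    by simp
  also have "\<dots> = SHomA M x y \<cdot>\<^bsub>V\<^esub> VPhi (canonical V S M) X Y f"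
    by (subst mphi_natural[OF V.ident_hom a(1,2)]) (auto simp: in_hom_iff canonical_simps)
  finally show "VPhi (canonical V S M) X' Y' (y \<cdot>\<^bsub>S\<^esub> f \<cdot>\<^bsub>S\<^esub> x)
      = SHomA M x y \<cdot>\<^bsub>V\<^esub> VPhi (canonical V S M) X Y f" .
next
  fix W X Y Z assume "W \<in> Obj S" "X \<in> Obj S" "Y \<in> Obj S" "Z \<in> Obj S"
  then show "VComp (canonical V S M) W X Z \<cdot>\<^bsub>V\<^esub> (VComp (canonical V S M) X Y Z \<boxtimes>\<^bsub>V\<^esub> Ident V (SHom M W X))
      = VComp (canonical V S M) W Y Z \<cdot>\<^bsub>V\<^esub> (Ident V (SHom M Y Z) \<boxtimes>\<^bsub>V\<^esub> VComp (canonical V S M) W X Y)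
        \<cdot>\<^bsub>V\<^esub> Assoc V (SHom M Y Z) (SHom M X Y) (SHom M W X)"
    using act.cmp_assoc by (simp only: canonical_simps)
next
  fix f X Y Z assume f: "f \<in> hom S X Y" and [simp]: "Z \<in> Obj S"
  note [simp] = S.hom_facts[OF f]
  have "VComp (canonical V S M) X Y Z \<cdot>\<^bsub>V\<^esub> (Ident V (SHom M Y Z) \<boxtimes>\<^bsub>V\<^esub> VPhi (canonical V S M) X Y f)
      = act.cmp X Y Z \<cdot>\<^bsub>V\<^esub> (MPhi M (SHom M Y Z) Y Z (act.eps Y Z) \<boxtimes>\<^bsub>V\<^esub> MPhi M (UnitObj V) X Y (f \<cdot>\<^bsub>S\<^esub> MLUnit M X))"
    using f by (simp add: canonical_simps)
  also have "\<dots> = MPhi M (SHom M Y Z) X Z (act.eps Y Z \<cdot>\<^bsub>S\<^esub> (Ident V (SHom M Y Z) \<boxdot>\<^bsub>M\<^esub> f)) \<cdot>\<^bsub>V\<^esub> RUnit V (SHom M Y Z)"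
    by (rule act.cmp_unit_right[OF _ f]) (auto simp: in_hom_iff)
  also have "MPhi M (SHom M Y Z) X Z (act.eps Y Z \<cdot>\<^bsub>S\<^esub> (Ident V (SHom M Y Z) \<boxdot>\<^bsub>M\<^esub> f)) = SHomA M f (Ident S Z)"
    by (subst mphi_pull[OF _ f, symmetric]) (auto simp: in_hom_iff)
  finally have "(VComp (canonical V S M) X Y Z \<cdot>\<^bsub>V\<^esub> (Ident V (SHom M Y Z) \<boxtimes>\<^bsub>V\<^esub> VPhi (canonical V S M) X Y f))
      \<cdot>\<^bsub>V\<^esub> cinv V (RUnit V (SHom M Y Z)) = SHomA M f (Ident S Z)"
    by simp
  then show "SHomA M f (Ident S Z) = VComp (canonical V S M) X Y Z
      \<cdot>\<^bsub>V\<^esub> (Ident V (SHom M Y Z) \<boxtimes>\<^bsub>V\<^esub> VPhi (canonical V S M) X Y f) \<cdot>\<^bsub>V\<^esub> cinv V (RUnit V (SHom M Y Z))"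
    by (rule sym)
next
  fix g X Y Z assume [simp]: "X \<in> Obj S" and g: "g \<in> hom S Y Z"
  note [simp] = S.hom_facts[OF g]
  have "VComp (canonical V S M) X Y Z \<cdot>\<^bsub>V\<^esub> (VPhi (canonical V S M) Y Z g \<boxtimes>\<^bsub>V\<^esub> Ident V (SHom M X Y))
      = act.cmp X Y Z \<cdot>\<^bsub>V\<^esub> (MPhi M (UnitObj V) Y Z (g \<cdot>\<^bsub>S\<^esub> MLUnit M Y) \<boxtimes>\<^bsub>V\<^esub> MPhi M (SHom M X Y) X Y (act.eps X Y))"
    using g by (simp add: canonical_simps)
  also have "\<dots> = MPhi M (SHom M X Y) X Z (g \<cdot>\<^bsub>S\<^esub> act.eps X Y) \<cdot>\<^bsub>V\<^esub> LUnit V (SHom M X Y)"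
    by (rule act.cmp_unit_left[OF g]) (auto simp: in_hom_iff)
  also have "MPhi M (SHom M X Y) X Z (g \<cdot>\<^bsub>S\<^esub> act.eps X Y) = SHomA M (Ident S X) g"
    by (subst mphi_push[OF _ g, symmetric]) (auto simp: in_hom_iff)
  finally have "(VComp (canonical V S M) X Y Z \<cdot>\<^bsub>V\<^esub> (VPhi (canonical V S M) Y Z g \<boxtimes>\<^bsub>V\<^esub> Ident V (SHom M X Y)))
      \<cdot>\<^bsub>V\<^esub> cinv V (LUnit V (SHom M X Y)) = SHomA M (Ident S X) g"
    by simp
  then show "SHomA M (Ident S X) g = VComp (canonical V S M) X Y Z
      \<cdot>\<^bsub>V\<^esub> (VPhi (canonical V S M) Y Z g \<boxtimes>\<^bsub>V\<^esub> Ident V (SHom M X Y)) \<cdot>\<^bsub>V\<^esub> cinv V (LUnit V (SHom M X Y))"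
    by (rule sym)
qed

lemma is_uphi_Cur:
  assumes [simp]: "K \<in> Obj V" "X \<in> Obj S" "Y \<in> Obj S"
  shows "is_uphi V S M K X Y (Cur V (SHom M (K \<odot>\<^bsub>M\<^esub> X) Y) K (SHom M X Y)
    (MPhi M (SHom M (K \<odot>\<^bsub>M\<^esub> X) Y \<otimes>\<^bsub>V\<^esub> K) X Y
      (act.eps (K \<odot>\<^bsub>M\<^esub> X) Y \<cdot>\<^bsub>S\<^esub> MAssoc M (SHom M (K \<odot>\<^bsub>M\<^esub> X) Y) K X)))"
    (is "is_uphi V S M K X Y (Cur V ?H K _ (MPhi M _ X Y ?e))")
  unfolding is_uphi_def
proof (intro conjI ballI)
  fix L h assume [simp]: "L \<in> Obj V" and h: "h \<in> hom S (L \<odot>\<^bsub>M\<^esub> (K \<odot>\<^bsub>M\<^esub> X)) Y"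
  note [simp] = S.hom_facts[OF h]
  let ?u = "MPhi M L (K \<odot>\<^bsub>M\<^esub> X) Y h"
  have "Cur V ?H K (SHom M X Y) (MPhi M (?H \<otimes>\<^bsub>V\<^esub> K) X Y ?e) \<cdot>\<^bsub>V\<^esub> ?u
      = Cur V L K (SHom M X Y) (MPhi M (?H \<otimes>\<^bsub>V\<^esub> K) X Y ?e \<cdot>\<^bsub>V\<^esub> (?u \<boxtimes>\<^bsub>V\<^esub> Ident V K))"
    by (rule V.self.phi_natural[symmetric]) (auto simp: in_hom_iff)
  also have "MPhi M (?H \<otimes>\<^bsub>V\<^esub> K) X Y ?e \<cdot>\<^bsub>V\<^esub> (?u \<boxtimes>\<^bsub>V\<^esub> Ident V K)
      = MPhi M (L \<otimes>\<^bsub>V\<^esub> K) X Y (?e \<cdot>\<^bsub>S\<^esub> ((?u \<boxtimes>\<^bsub>V\<^esub> Ident V K) \<boxdot>\<^bsub>M\<^esub> Ident S X))"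
    by (rule act.phi_natural[symmetric]) (auto simp: in_hom_iff)
  also have "?e \<cdot>\<^bsub>S\<^esub> ((?u \<boxtimes>\<^bsub>V\<^esub> Ident V K) \<boxdot>\<^bsub>M\<^esub> Ident S X)
      = act.eps (K \<odot>\<^bsub>M\<^esub> X) Y \<cdot>\<^bsub>S\<^esub> (MAssoc M ?H K X \<cdot>\<^bsub>S\<^esub> ((?u \<boxtimes>\<^bsub>V\<^esub> Ident V K) \<boxdot>\<^bsub>M\<^esub> Ident S X))"
    by simp
  also have "\<dots> = (act.eps (K \<odot>\<^bsub>M\<^esub> X) Y \<cdot>\<^bsub>S\<^esub> (?u \<boxdot>\<^bsub>M\<^esub> Ident S (K \<odot>\<^bsub>M\<^esub> X))) \<cdot>\<^bsub>S\<^esub> MAssoc M L K X"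
    by (subst act.act_assoc_natural) (auto simp: in_hom_iff)
  also have "\<dots> = h \<cdot>\<^bsub>S\<^esub> MAssoc M L K X"
    by (subst act.eps_phi[OF h]) auto
  finally show "Cur V ?H K (SHom M X Y) (MPhi M (?H \<otimes>\<^bsub>V\<^esub> K) X Y ?e) \<cdot>\<^bsub>V\<^esub> ?u
      = Cur V L K (SHom M X Y) (MPhi M (L \<otimes>\<^bsub>V\<^esub> K) X Y (h \<cdot>\<^bsub>S\<^esub> MAssoc M L K X))" .
qed (auto simp: in_hom_iff)

text \<open>Evaluating the defining equation at the counit shows uniqueness.\<close>

lemma is_uphi_unique:
  assumes p: "is_uphi V S M K X Y p" and [simp]: "K \<in> Obj V" "X \<in> Obj S" "Y \<in> Obj S"
  shows "p = Cur V (SHom M (K \<odot>\<^bsub>M\<^esub> X) Y) K (SHom M X Y)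
    (MPhi M (SHom M (K \<odot>\<^bsub>M\<^esub> X) Y \<otimes>\<^bsub>V\<^esub> K) X Y
      (act.eps (K \<odot>\<^bsub>M\<^esub> X) Y \<cdot>\<^bsub>S\<^esub> MAssoc M (SHom M (K \<odot>\<^bsub>M\<^esub> X) Y) K X))"
proof -
  let ?H = "SHom M (K \<odot>\<^bsub>M\<^esub> X) Y"
  have "act.eps (K \<odot>\<^bsub>M\<^esub> X) Y \<in> hom S (?H \<odot>\<^bsub>M\<^esub> (K \<odot>\<^bsub>M\<^esub> X)) Y" by (auto simp: in_hom_iff)
  then have "p \<cdot>\<^bsub>V\<^esub> MPhi M ?H (K \<odot>\<^bsub>M\<^esub> X) Y (act.eps (K \<odot>\<^bsub>M\<^esub> X) Y)
      = Cur V ?H K (SHom M X Y) (MPhi M (?H \<otimes>\<^bsub>V\<^esub> K) X Y (act.eps (K \<odot>\<^bsub>M\<^esub> X) Y \<cdot>\<^bsub>S\<^esub> MAssoc M ?H K X))"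
    using p by (auto simp: is_uphi_def simp del: act.eps_simps(4))
  then show ?thesis using p by (simp add: is_uphi_def in_hom_iff)
qed

lemma uphi_eqI:
  assumes "is_uphi V S M K X Y p" "K \<in> Obj V" "X \<in> Obj S" "Y \<in> Obj S"
  shows "uphi V S M K X Y = p"
proof -
  have "(THE p. is_uphi V S M K X Y p) = p"
    using assms(1) by (rule the_equality) (metis assms is_uphi_unique)
  then show ?thesis using assms(2-) by (simp add: uphi_def)
qed

lemma ex1_is_uphi:
  assumes "K \<in> Obj V" "X \<in> Obj S" "Y \<in> Obj S"
  shows "\<exists>!p. is_uphi V S M K X Y p"
  using is_uphi_Cur[OF assms] is_uphi_unique[OF _ assms] by blast

lemma is_uphi_uphi:
  assumes "K \<in> Obj V" "X \<in> Obj S" "Y \<in> Obj S"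
  shows "is_uphi V S M K X Y (uphi V S M K X Y)"
  using is_uphi_Cur[OF assms] uphi_eqI[OF _ assms] by simp

lemma uphi_iso:
  assumes [simp]: "K \<in> Obj V" "X \<in> Obj S" "Y \<in> Obj S"
  shows "uphi V S M K X Y \<in> isos V (SHom M (K \<odot>\<^bsub>M\<^esub> X) Y) (IHom V K (SHom M X Y))"
proof (rule V.iso_if_postcomp_bij)
  have u: "is_uphi V S M K X Y (uphi V S M K X Y)" by (simp add: is_uphi_uphi)
  then show "uphi V S M K X Y \<in> hom V (SHom M (K \<odot>\<^bsub>M\<^esub> X) Y) (IHom V K (SHom M X Y))"
    by (simp add: is_uphi_def)
  fix L assume [simp]: "L \<in> Obj V"
  have "bij_betw (Cur V L K (SHom M X Y) \<circ> (MPhi M (L \<otimes>\<^bsub>V\<^esub> K) X Y \<circ> (\<lambda>h. h \<cdot>\<^bsub>S\<^esub> MAssoc M L K X)))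
      (hom S (L \<odot>\<^bsub>M\<^esub> (K \<odot>\<^bsub>M\<^esub> X)) Y) (hom V L (IHom V K (SHom M X Y)))"
    by (intro bij_betw_trans[OF bij_betw_trans[OF S.iso_precomp_bij[OF act.act_assoc_iso] act.phi_bij] V.cur_bij]) auto
  then have "bij_betw ((\<lambda>g. uphi V S M K X Y \<cdot>\<^bsub>V\<^esub> g) \<circ> MPhi M L (K \<odot>\<^bsub>M\<^esub> X) Y)
      (hom S (L \<odot>\<^bsub>M\<^esub> (K \<odot>\<^bsub>M\<^esub> X)) Y) (hom V L (IHom V K (SHom M X Y)))"
    by (rule bij_betw_cong[THEN iffD1, rotated]) (use u in \<open>auto simp: is_uphi_def\<close>)
  then show "bij_betw (\<lambda>g. uphi V S M K X Y \<cdot>\<^bsub>V\<^esub> g) (hom V L (SHom M (K \<odot>\<^bsub>M\<^esub> X) Y))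
      (hom V L (IHom V K (SHom M X Y)))"
    by (subst bij_betw_comp_iff[OF act.phi_bij[of L "K \<odot>\<^bsub>M\<^esub> X" Y]]) auto
qed

lemma ualpha_eq:
  assumes [simp]: "K \<in> Obj V" "X \<in> Obj S"
  shows "ualpha V S M K X = MPhi M K X (K \<odot>\<^bsub>M\<^esub> X) (Ident S (K \<odot>\<^bsub>M\<^esub> X))"
proof -
  let ?KX = "K \<odot>\<^bsub>M\<^esub> X" let ?I = "UnitObj V"
  have "uphi V S M K X ?KX \<cdot>\<^bsub>V\<^esub> VUnit (associated_vcat S (canonical V S M)) ?KX
      = uphi V S M K X ?KX \<cdot>\<^bsub>V\<^esub> MPhi M ?I ?KX ?KX (MLUnit M ?KX)"
    by (simp add: associated_vcat_def canonical_simps in_hom_iff)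
  also have "\<dots> = Cur V ?I K (SHom M X ?KX) (MPhi M (?I \<otimes>\<^bsub>V\<^esub> K) X ?KX (MLUnit M ?KX \<cdot>\<^bsub>S\<^esub> MAssoc M ?I K X))"
    using is_uphi_uphi[of K X ?KX] by (auto simp: is_uphi_def in_hom_iff)
  also have "MLUnit M ?KX \<cdot>\<^bsub>S\<^esub> MAssoc M ?I K X = Ident S ?KX \<cdot>\<^bsub>S\<^esub> (LUnit V K \<boxdot>\<^bsub>M\<^esub> Ident S X)"
    by (simp add: act.act_lunit_assoc)
  also have "MPhi M (?I \<otimes>\<^bsub>V\<^esub> K) X ?KX \<dots> = MPhi M K X ?KX (Ident S ?KX) \<cdot>\<^bsub>V\<^esub> LUnit V K"
    by (rule act.phi_natural) (auto simp: in_hom_iff)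
  also have "Cur V ?I K (SHom M X ?KX) \<dots> = varpi V K (SHom M X ?KX) (MPhi M K X ?KX (Ident S ?KX))"
    by (simp add: varpi_def)
  finally show ?thesis
    unfolding ualpha_def varpi_inv_def
    using V.varpi_bij[of K "SHom M X ?KX"] by (auto simp: bij_betw_def in_hom_iff intro!: inv_into_f_f)
qed

lemma is_cylinder_canonical:
  "is_cylinder V S (canonical V S M) (MTens M) (ualpha V S M) (uphi V S M)"
  unfolding is_cylinder_def canonical_simps(1)
proof (intro conjI ballI)
  show "MTens M \<in> Obj V \<rightarrow>\<^sub>E Obj S \<rightarrow>\<^sub>E Obj S"
    using mtens_bifunctor by (simp add: bifunctor_def)
  show "ualpha V S M \<in> (\<Pi>\<^sub>E K \<in> Obj V. \<Pi>\<^sub>E X \<in> Obj S. hom V K (SHom M X (K \<odot>\<^bsub>M\<^esub> X)))"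
    by (intro PiE_I) (auto simp: ualpha_eq in_hom_iff, auto simp: ualpha_def)
  show "uphi V S M \<in> (\<Pi>\<^sub>E K \<in> Obj V. \<Pi>\<^sub>E X \<in> Obj S. \<Pi>\<^sub>E Y \<in> Obj S.
      isos V (SHom M (K \<odot>\<^bsub>M\<^esub> X) Y) (IHom V K (SHom M X Y)))"
    by (intro PiE_I uphi_iso) (auto simp: uphi_def)
next
  fix K X Y assume [simp]: "K \<in> Obj V" "X \<in> Obj S" "Y \<in> Obj S"
  let ?H = "SHom M (K \<odot>\<^bsub>M\<^esub> X) Y"
  have "ev V K (SHom M X Y) \<cdot>\<^bsub>V\<^esub> (uphi V S M K X Y \<boxtimes>\<^bsub>V\<^esub> Ident V K)
      = MPhi M (?H \<otimes>\<^bsub>V\<^esub> K) X Y (act.eps (K \<odot>\<^bsub>M\<^esub> X) Y \<cdot>\<^bsub>S\<^esub> MAssoc M ?H K X)"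
    by (subst uphi_eqI[OF is_uphi_Cur]; (subst V.self_eps[symmetric])?; (rule V.self.eps_phi)?)
      (auto simp: in_hom_iff)
  also have "\<dots> = act.cmp X (K \<odot>\<^bsub>M\<^esub> X) Y \<cdot>\<^bsub>V\<^esub> (MPhi M ?H (K \<odot>\<^bsub>M\<^esub> X) Y (act.eps (K \<odot>\<^bsub>M\<^esub> X) Y) \<boxtimes>\<^bsub>V\<^esub> ualpha V S M K X)"
    unfolding ualpha_eq[OF \<open>K \<in> Obj V\<close> \<open>X \<in> Obj S\<close>] by (subst act.cmp_phi) (auto simp: in_hom_iff)
  finally show "ev V K (SHom M X Y) \<cdot>\<^bsub>V\<^esub> (uphi V S M K X Y \<boxtimes>\<^bsub>V\<^esub> Ident V K)
      = VComp (canonical V S M) X (K \<odot>\<^bsub>M\<^esub> X) Y \<cdot>\<^bsub>V\<^esub> (Ident V ?H \<boxtimes>\<^bsub>V\<^esub> ualpha V S M K X)"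
    by (simp add: canonical_simps)
qed

lemma v_cylinder_canonical:
  "v_cylinder V S (canonical V S M) (MTens M) (ualpha V S M) (uphi V S M)"
  using v_structure_canonical is_cylinder_canonical
  by (simp add: v_cylinder_def v_cylinder_axioms_def)

end

section \<open>The tensor-closed module of a V-structure with cylinder\<close>

lemma PiE2_ext:
  assumes f: "f \<in> (\<Pi>\<^sub>E x \<in> A. \<Pi>\<^sub>E y \<in> B x. C x y)"
    and g: "g \<in> (\<Pi>\<^sub>E x \<in> A. \<Pi>\<^sub>E y \<in> B x. D x y)"
    and eq: "\<And>x y. x \<in> A \<Longrightarrow> y \<in> B x \<Longrightarrow> f x y = g x y"
  shows "f = g"
proof
  fix x
  show "f x = g x"
  proof (cases "x \<in> A")
    case True
    then show ?thesis
      using PiE_mem[OF f True] PiE_mem[OF g True] eq by (metis PiE_arb ext)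
  qed (simp add: PiE_arb[OF f] PiE_arb[OF g])
qed

lemma PiE3_ext:
  assumes f: "f \<in> (\<Pi>\<^sub>E x \<in> A. \<Pi>\<^sub>E y \<in> B x. \<Pi>\<^sub>E z \<in> C x y. F x y z)"
    and g: "g \<in> (\<Pi>\<^sub>E x \<in> A. \<Pi>\<^sub>E y \<in> B x. \<Pi>\<^sub>E z \<in> C x y. G x y z)"
    and eq: "\<And>x y z. x \<in> A \<Longrightarrow> y \<in> B x \<Longrightarrow> z \<in> C x y \<Longrightarrow> f x y z = g x y z"
  shows "f = g"
proof
  fix x
  show "f x = g x"
  proof (cases "x \<in> A")
    case True
    then show ?thesis
      by (intro PiE2_ext[OF PiE_mem[OF f] PiE_mem[OF g]] eq)
  qed (simp add: PiE_arb[OF f] PiE_arb[OF g])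
qed

context v_cylinder
begin

definition phi :: "'o \<Rightarrow> 'p \<Rightarrow> 'p \<Rightarrow> 'n \<Rightarrow> 'm" where
  "phi K X Y f = SHomA A (Ident S X) f \<cdot>\<^bsub>V\<^esub> \<alpha> K X"

definition lift :: "'o \<Rightarrow> 'p \<Rightarrow> 'p \<Rightarrow> 'm \<Rightarrow> 'n" where
  "lift K X Y = inv_into (hom S (T K X) Y) (phi K X Y)"

lemma phi_simps [simp]:
  assumes "K \<in> Obj V" "X \<in> Obj S" "f \<in> Arr S" "Dom S f = T K X" "Cod S f = Y"
  shows "phi K X Y f \<in> Arr V" "Dom V (phi K X Y f) = K" "Cod V (phi K X Y f) = SHom A X Y"
  using assms by (auto simp: phi_def)

lemma Phi_vphi:
  assumes f: "f \<in> hom S (T K X) Y" and [simp]: "K \<in> Obj V" "X \<in> Obj S"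
  shows "\<Phi> K X Y \<cdot>\<^bsub>V\<^esub> VPhi A (T K X) Y f = varpi V K (SHom A X Y) (phi K X Y f)"
proof -
  note [simp] = S.hom_facts[OF f]
  have "\<Phi> K X Y \<cdot>\<^bsub>V\<^esub> VPhi A (T K X) Y f
      = Cur V (UnitObj V) K (SHom A X Y) (cmp X (T K X) Y (VPhi A (T K X) Y f) (\<alpha> K X))"
    by (rule Phi_comp) (auto simp: in_hom_iff)
  also have "cmp X (T K X) Y (VPhi A (T K X) Y f) (\<alpha> K X) = phi K X Y f \<cdot>\<^bsub>V\<^esub> LUnit V K"
    unfolding phi_def by (rule cmp_vphi_left[OF f]) (auto simp: in_hom_iff)
  finally show ?thesis by (simp add: varpi_def)
qed

lemma phi_bij:
  assumes [simp]: "K \<in> Obj V" "X \<in> Obj S" "Y \<in> Obj S"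
  shows "bij_betw (phi K X Y) (hom S (T K X) Y) (hom V K (SHom A X Y))"
proof -
  have "bij_betw ((\<lambda>g. \<Phi> K X Y \<cdot>\<^bsub>V\<^esub> g) \<circ> VPhi A (T K X) Y) (hom S (T K X) Y)
      (hom V (UnitObj V) (IHom V K (SHom A X Y)))"
    by (rule bij_betw_trans[OF vphi_bij V.iso_postcomp_bij[OF Phi_iso]]) auto
  then have "bij_betw (varpi V K (SHom A X Y) \<circ> phi K X Y) (hom S (T K X) Y)
      (hom V (UnitObj V) (IHom V K (SHom A X Y)))"
    by (rule bij_betw_cong[THEN iffD1, rotated]) (simp add: Phi_vphi)
  moreover have "phi K X Y ` hom S (T K X) Y \<subseteq> hom V K (SHom A X Y)"
    by (auto simp: in_hom_iff)
  ultimately show ?thesis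
    using bij_betw_comp_iff2[OF V.varpi_bij[of K "SHom A X Y"], of "phi K X Y"] by simp
qed

lemma phi_inject:
  assumes "phi K X Y f = phi K X Y g" "f \<in> hom S (T K X) Y" "g \<in> hom S (T K X) Y"
    "K \<in> Obj V" "X \<in> Obj S"
  shows "f = g"
  using phi_bij[of K X Y] assms S.hom_facts(5)[OF assms(2)] by (auto simp: bij_betw_def inj_on_def)

lemma lift_simps [simp]:
  assumes "u \<in> Arr V" "Dom V u = K" "Cod V u = SHom A X Y" "X \<in> Obj S" "Y \<in> Obj S"
  shows "lift K X Y u \<in> Arr S" "Dom S (lift K X Y u) = T K X" "Cod S (lift K X Y u) = Y"
    "phi K X Y (lift K X Y u) = u"
proof -
  have "u \<in> phi K X Y ` hom S (T K X) Y"
    using phi_bij[of K X Y] assms by (auto simp: bij_betw_def in_hom_iff)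
  from inv_into_into[OF this] f_inv_into_f[OF this]
  show "lift K X Y u \<in> Arr S" "Dom S (lift K X Y u) = T K X" "Cod S (lift K X Y u) = Y"
    "phi K X Y (lift K X Y u) = u"
    by (auto simp: in_hom_iff lift_def)
qed

definition tensA :: "'m \<Rightarrow> 'n \<Rightarrow> 'n" where
  "tensA = (\<lambda>k \<in> Arr V. \<lambda>x \<in> Arr S. lift (Dom V k) (Dom S x) (T (Cod V k) (Cod S x))
     (SHomA A x (Ident S (T (Cod V k) (Cod S x))) \<cdot>\<^bsub>V\<^esub> \<alpha> (Cod V k) (Cod S x) \<cdot>\<^bsub>V\<^esub> k))"

definition assoc :: "'o \<Rightarrow> 'o \<Rightarrow> 'p \<Rightarrow> 'n" where
  "assoc = (\<lambda>K \<in> Obj V. \<lambda>L \<in> Obj V. \<lambda>X \<in> Obj S. lift (K \<otimes>\<^bsub>V\<^esub> L) X (T K (T L X))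
     (cmp X (T L X) (T K (T L X)) (\<alpha> K (T L X)) (\<alpha> L X)))"

definition lunit :: "'p \<Rightarrow> 'n" where
  "lunit = (\<lambda>X \<in> Obj S. lift (UnitObj V) X X (VPhi A X X (Ident S X)))"

definition cyl_module :: "('o, 'm, 'p, 'n) tcmod" where
  "cyl_module = \<lparr>SHom = SHom A, SHomA = SHomA A, MTens = T, MTensA = tensA, MAssoc = assoc,
     MLUnit = lunit,
     MPhi = (\<lambda>K \<in> Obj V. \<lambda>X \<in> Obj S. \<lambda>Y \<in> Obj S. \<lambda>f \<in> hom S (T K X) Y. phi K X Y f)\<rparr>"

lemma tensA_simps [simp]:
  assumes "k \<in> Arr V" "x \<in> Arr S"
  shows "tensA k x \<in> Arr S" "Dom S (tensA k x) = T (Dom V k) (Dom S x)"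
    "Cod S (tensA k x) = T (Cod V k) (Cod S x)"
  using assms by (simp_all add: tensA_def)

lemma assoc_simps [simp]:
  assumes "K \<in> Obj V" "L \<in> Obj V" "X \<in> Obj S"
  shows "assoc K L X \<in> Arr S" "Dom S (assoc K L X) = T (K \<otimes>\<^bsub>V\<^esub> L) X"
    "Cod S (assoc K L X) = T K (T L X)"
    "phi (K \<otimes>\<^bsub>V\<^esub> L) X (T K (T L X)) (assoc K L X) = cmp X (T L X) (T K (T L X)) (\<alpha> K (T L X)) (\<alpha> L X)"
  using assms by (simp_all add: assoc_def)

lemma lunit_simps [simp]:
  assumes "X \<in> Obj S"
  shows "lunit X \<in> Arr S" "Dom S (lunit X) = T (UnitObj V) X" "Cod S (lunit X) = X"
    "phi (UnitObj V) X X (lunit X) = VPhi A X X (Ident S X)"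
  using assms by (simp_all add: lunit_def)

lemma phi_tensA:
  assumes "k \<in> Arr V" "x \<in> Arr S" "Dom V k = K" "Dom S x = X"
  shows "phi K X (T (Cod V k) (Cod S x)) (tensA k x)
    = SHomA A x (Ident S (T (Cod V k) (Cod S x))) \<cdot>\<^bsub>V\<^esub> (\<alpha> (Cod V k) (Cod S x) \<cdot>\<^bsub>V\<^esub> k)"
  using assms by (auto simp: tensA_def)

lemma phi_ident [simp]:
  assumes "K \<in> Obj V" "X \<in> Obj S"
  shows "phi K X (T K X) (Ident S (T K X)) = \<alpha> K X"
  using assms by (simp add: phi_def)

lemma phi_comp:
  assumes "f \<in> Arr S" "g \<in> Arr S" "Dom S f = T K X" "Cod S f = Y" "Dom S g = Y" "Cod S g = Z"
    "K \<in> Obj V" "X \<in> Obj S"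
  shows "phi K X Z (g \<cdot>\<^bsub>S\<^esub> f) = SHomA A (Ident S X) g \<cdot>\<^bsub>V\<^esub> phi K X Y f"
  using assms by (auto simp: phi_def)

lemma phi_comp_tensA:
  assumes "k \<in> Arr V" "x \<in> Arr S" "f \<in> Arr S" "Dom S f = T (Cod V k) (Cod S x)"
    "Dom V k = K" "Dom S x = X" "Cod S f = Z"
  shows "phi K X Z (f \<cdot>\<^bsub>S\<^esub> tensA k x)
    = SHomA A x (Ident S Z) \<cdot>\<^bsub>V\<^esub> (phi (Cod V k) (Cod S x) Z f \<cdot>\<^bsub>V\<^esub> k)"
proof -
  have "phi K X Z (f \<cdot>\<^bsub>S\<^esub> tensA k x)
      = SHomA A (Ident S X) f \<cdot>\<^bsub>V\<^esub> phi K X (T (Cod V k) (Cod S x)) (tensA k x)"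
    by (rule phi_comp) (use assms in auto)
  also have "\<dots> = SHomA A (Ident S X) f \<cdot>\<^bsub>V\<^esub> (SHomA A x (Ident S (T (Cod V k) (Cod S x)))
      \<cdot>\<^bsub>V\<^esub> (\<alpha> (Cod V k) (Cod S x) \<cdot>\<^bsub>V\<^esub> k))"
    using assms by (simp add: phi_tensA)
  also have "\<dots> = SHomA A x (Ident S Z) \<cdot>\<^bsub>V\<^esub> (phi (Cod V k) (Cod S x) Z f \<cdot>\<^bsub>V\<^esub> k)"
    using assms by (auto simp: phi_def)
  finally show ?thesis .
qed

lemma phi_comp_assoc:
  assumes "f \<in> Arr S" "Dom S f = T K (T L X)" "Cod S f = Z" and [simp]: "K \<in> Obj V" "L \<in> Obj V" "X \<in> Obj S"
  shows "phi (K \<otimes>\<^bsub>V\<^esub> L) X Z (f \<cdot>\<^bsub>S\<^esub> assoc K L X) = cmp X (T L X) Z (phi K (T L X) Z f) (\<alpha> L X)"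
proof -
  have "phi (K \<otimes>\<^bsub>V\<^esub> L) X Z (f \<cdot>\<^bsub>S\<^esub> assoc K L X)
      = SHomA A (Ident S X) f \<cdot>\<^bsub>V\<^esub> cmp X (T L X) (T K (T L X)) (\<alpha> K (T L X)) (\<alpha> L X)"
    by (subst phi_comp) (use assms in auto)
  also have "\<dots> = cmp X (T L X) Z (SHomA A (Ident S (T L X)) f \<cdot>\<^bsub>V\<^esub> \<alpha> K (T L X)) (\<alpha> L X)"
    by (rule push_cmp) (use assms in \<open>auto simp: in_hom_iff\<close>)
  finally show ?thesis by (simp add: phi_def)
qed

lemma phi_comp_lunit:
  assumes "f \<in> Arr S" "Dom S f = X" "Cod S f = Z"
  shows "phi (UnitObj V) X Z (f \<cdot>\<^bsub>S\<^esub> lunit X) = VPhi A X Z f"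
  using assms vphi_push[of "Ident S X" X X f Z] by (auto simp: phi_comp in_hom_iff)

lemma cmp_phi_tensA:
  assumes [simp]: "k \<in> Arr V" "y \<in> Arr S" "Dom V k = K" "Cod V k = K'" "Dom S y = T L X" "Cod S y = Y"
    "L \<in> Obj V" "X \<in> Obj S"
  shows "cmp X (T L X) (T K' Y) (phi K (T L X) (T K' Y) (tensA k y)) (\<alpha> L X)
    = cmp X Y (T K' Y) (\<alpha> K' Y \<cdot>\<^bsub>V\<^esub> k) (phi L X Y y)"
proof -
  have "K \<in> Obj V" "K' \<in> Obj V" "Y \<in> Obj S"
    using V.arr_simps[of k] S.arr_simps[of y] by simp_all
  note [simp] = this
  have "cmp X (T L X) (T K' Y) (phi K (T L X) (T K' Y) (tensA k y)) (\<alpha> L X)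
      = cmp X (T L X) (T K' Y) (SHomA A y (Ident S (T K' Y)) \<cdot>\<^bsub>V\<^esub> (\<alpha> K' Y \<cdot>\<^bsub>V\<^esub> k)) (\<alpha> L X)"
    using phi_tensA[of k y K "T L X"] by simp
  also have "\<dots> = cmp X Y (T K' Y) (\<alpha> K' Y \<cdot>\<^bsub>V\<^esub> k) (SHomA A (Ident S X) y \<cdot>\<^bsub>V\<^esub> \<alpha> L X)"
    by (rule cmp_push[symmetric]) (auto simp: in_hom_iff)
  finally show ?thesis by (simp add: phi_def)
qed

lemma assoc_iso:
  assumes [simp]: "K \<in> Obj V" "L \<in> Obj V" "X \<in> Obj S"
  shows "assoc K L X \<in> isos S (T (K \<otimes>\<^bsub>V\<^esub> L) X) (T K (T L X))"
proof (rule S.iso_if_precomp_bij)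
  show "assoc K L X \<in> hom S (T (K \<otimes>\<^bsub>V\<^esub> L) X) (T K (T L X))" by (simp add: in_hom_iff)
  fix Z assume [simp]: "Z \<in> Obj S"
  have "bij_betw ((\<lambda>g. \<Phi> L X Z \<cdot>\<^bsub>V\<^esub> g) \<circ> phi K (T L X) Z) (hom S (T K (T L X)) Z)
      (hom V K (IHom V L (SHom A X Z)))"
    by (rule bij_betw_trans[OF phi_bij V.iso_postcomp_bij[OF Phi_iso]]) auto
  then have "bij_betw ((Cur V K L (SHom A X Z) \<circ> phi (K \<otimes>\<^bsub>V\<^esub> L) X Z) \<circ> (\<lambda>g. g \<cdot>\<^bsub>S\<^esub> assoc K L X))
      (hom S (T K (T L X)) Z) (hom V K (IHom V L (SHom A X Z)))"
    by (rule bij_betw_cong[THEN iffD1, rotated])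
      (auto simp: in_hom_iff phi_comp_assoc Phi_comp)
  moreover have "bij_betw (Cur V K L (SHom A X Z) \<circ> phi (K \<otimes>\<^bsub>V\<^esub> L) X Z)
      (hom S (T (K \<otimes>\<^bsub>V\<^esub> L) X) Z) (hom V K (IHom V L (SHom A X Z)))"
    by (rule bij_betw_trans[OF phi_bij V.cur_bij]) auto
  moreover have "(\<lambda>g. g \<cdot>\<^bsub>S\<^esub> assoc K L X) ` hom S (T K (T L X)) Z \<subseteq> hom S (T (K \<otimes>\<^bsub>V\<^esub> L) X) Z"
    by (auto simp: in_hom_iff)
  ultimately show "bij_betw (\<lambda>g. g \<cdot>\<^bsub>S\<^esub> assoc K L X) (hom S (T K (T L X)) Z) (hom S (T (K \<otimes>\<^bsub>V\<^esub> L) X) Z)"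
    using bij_betw_comp_iff2 by blast
qed

lemma lunit_iso:
  assumes [simp]: "X \<in> Obj S"
  shows "lunit X \<in> isos S (T (UnitObj V) X) X"
proof (rule S.iso_if_precomp_bij)
  show "lunit X \<in> hom S (T (UnitObj V) X) X" by (simp add: in_hom_iff)
  fix Z assume [simp]: "Z \<in> Obj S"
  have "bij_betw (phi (UnitObj V) X Z \<circ> (\<lambda>g. g \<cdot>\<^bsub>S\<^esub> lunit X)) (hom S X Z)
      (hom V (UnitObj V) (SHom A X Z))"
    by (rule bij_betw_cong[THEN iffD1, rotated, OF vphi_bij]) (auto simp: in_hom_iff phi_comp_lunit)
  moreover have "(\<lambda>g. g \<cdot>\<^bsub>S\<^esub> lunit X) ` hom S X Z \<subseteq> hom S (T (UnitObj V) X) Z"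
    by (auto simp: in_hom_iff)
  ultimately show "bij_betw (\<lambda>g. g \<cdot>\<^bsub>S\<^esub> lunit X) (hom S X Z) (hom S (T (UnitObj V) X) Z)"
    using bij_betw_comp_iff2[OF phi_bij[of "UnitObj V" X Z], of "\<lambda>g. g \<cdot>\<^bsub>S\<^esub> lunit X"] by simp
qed

lemma tensA_bifunctor: "bifunctor V S S T tensA"
  unfolding bifunctor_def
proof (intro conjI allI ballI)
  show "T \<in> Obj V \<rightarrow>\<^sub>E Obj S \<rightarrow>\<^sub>E Obj S"
    using cylinder by (simp add: is_cylinder_def)
  show "tensA \<in> Arr V \<rightarrow>\<^sub>E Arr S \<rightarrow>\<^sub>E Arr S"
    by (intro PiE_I) (simp, simp_all add: tensA_def)
  show "tensA (Ident V X) (Ident S Y) = Ident S (T X Y)" if [simp]: "X \<in> Obj V" "Y \<in> Obj S" for X Y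
    by (rule phi_inject[where K = X and X = Y and Y = "T X Y"])
      (use phi_tensA[of "Ident V X" "Ident S Y" X Y] in \<open>auto simp: in_hom_iff\<close>)
next
  fix X X' X'' Y Y' Y'' f f' g g'
  assume a: "f \<in> hom V X X'" "f' \<in> hom V X' X''" "g \<in> hom S Y Y'" "g' \<in> hom S Y' Y''"
  note [simp] = V.hom_facts[OF a(1)] V.hom_facts[OF a(2)] S.hom_facts[OF a(3)] S.hom_facts[OF a(4)]
  show "tensA (f' \<cdot>\<^bsub>V\<^esub> f) (g' \<cdot>\<^bsub>S\<^esub> g) = tensA f' g' \<cdot>\<^bsub>S\<^esub> tensA f g"
  proof (rule phi_inject[where K = X and X = Y and Y = "T X'' Y''"])
    have "phi X Y (T X'' Y'') (tensA f' g' \<cdot>\<^bsub>S\<^esub> tensA f g)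
        = SHomA A g (Ident S (T X'' Y'')) \<cdot>\<^bsub>V\<^esub> (phi X' Y' (T X'' Y'') (tensA f' g') \<cdot>\<^bsub>V\<^esub> f)"
      by (subst phi_comp_tensA) auto
    also have "\<dots> = phi X Y (T X'' Y'') (tensA (f' \<cdot>\<^bsub>V\<^esub> f) (g' \<cdot>\<^bsub>S\<^esub> g))"
      using phi_tensA[of f' g' X' Y'] phi_tensA[of "f' \<cdot>\<^bsub>V\<^esub> f" "g' \<cdot>\<^bsub>S\<^esub> g" X Y] by simp
    finally show "phi X Y (T X'' Y'') (tensA (f' \<cdot>\<^bsub>V\<^esub> f) (g' \<cdot>\<^bsub>S\<^esub> g))
        = phi X Y (T X'' Y'') (tensA f' g' \<cdot>\<^bsub>S\<^esub> tensA f g)" by (rule sym)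
  qed (auto simp: in_hom_iff)
qed (auto simp: in_hom_iff)

lemma assoc_natural:
  assumes k: "k \<in> hom V K K'" and l: "l \<in> hom V L L'" and x: "x \<in> hom S X X'"
  shows "assoc K' L' X' \<cdot>\<^bsub>S\<^esub> tensA (k \<boxtimes>\<^bsub>V\<^esub> l) x = tensA k (tensA l x) \<cdot>\<^bsub>S\<^esub> assoc K L X"
proof (rule phi_inject[where K = "K \<otimes>\<^bsub>V\<^esub> L" and X = X and Y = "T K' (T L' X')"])
  note [simp] = V.hom_facts[OF k] V.hom_facts[OF l] S.hom_facts[OF x]
  let ?Z = "T K' (T L' X')"
  have "phi (K \<otimes>\<^bsub>V\<^esub> L) X ?Z (assoc K' L' X' \<cdot>\<^bsub>S\<^esub> tensA (k \<boxtimes>\<^bsub>V\<^esub> l) x)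
      = SHomA A x (Ident S ?Z) \<cdot>\<^bsub>V\<^esub> (cmp X' (T L' X') ?Z (\<alpha> K' (T L' X')) (\<alpha> L' X') \<cdot>\<^bsub>V\<^esub> (k \<boxtimes>\<^bsub>V\<^esub> l))"
    by (subst phi_comp_tensA) auto
  also have "\<dots> = SHomA A x (Ident S ?Z) \<cdot>\<^bsub>V\<^esub> cmp X' (T L' X') ?Z (\<alpha> K' (T L' X') \<cdot>\<^bsub>V\<^esub> k) (\<alpha> L' X' \<cdot>\<^bsub>V\<^esub> l)"
    by (simp add: cmp_comp)
  also have "\<dots> = cmp X (T L' X') ?Z (\<alpha> K' (T L' X') \<cdot>\<^bsub>V\<^esub> k)
      (SHomA A x (Ident S (T L' X')) \<cdot>\<^bsub>V\<^esub> (\<alpha> L' X' \<cdot>\<^bsub>V\<^esub> l))"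
    by (rule pull_cmp[OF x]) (auto simp: in_hom_iff)
  also have "\<dots> = cmp X (T L' X') ?Z (\<alpha> K' (T L' X') \<cdot>\<^bsub>V\<^esub> k) (phi L X (T L' X') (tensA l x))"
    using phi_tensA[of l x L X] by simp
  also have "\<dots> = cmp X (T L X) ?Z (phi K (T L X) ?Z (tensA k (tensA l x))) (\<alpha> L X)"
    by (rule cmp_phi_tensA[symmetric]) auto
  also have "\<dots> = phi (K \<otimes>\<^bsub>V\<^esub> L) X ?Z (tensA k (tensA l x) \<cdot>\<^bsub>S\<^esub> assoc K L X)"
    by (rule phi_comp_assoc[symmetric]) auto
  finally show "phi (K \<otimes>\<^bsub>V\<^esub> L) X ?Z (assoc K' L' X' \<cdot>\<^bsub>S\<^esub> tensA (k \<boxtimes>\<^bsub>V\<^esub> l) x)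
      = phi (K \<otimes>\<^bsub>V\<^esub> L) X ?Z (tensA k (tensA l x) \<cdot>\<^bsub>S\<^esub> assoc K L X)" .
qed (use V.hom_facts[OF k] V.hom_facts[OF l] S.hom_facts[OF x] in \<open>auto simp: in_hom_iff\<close>)

lemma lunit_natural:
  assumes x: "x \<in> hom S X X'"
  shows "lunit X' \<cdot>\<^bsub>S\<^esub> tensA (Ident V (UnitObj V)) x = x \<cdot>\<^bsub>S\<^esub> lunit X"
proof (rule phi_inject[where K = "UnitObj V" and X = X and Y = X'])
  note [simp] = S.hom_facts[OF x]
  have "phi (UnitObj V) X X' (lunit X' \<cdot>\<^bsub>S\<^esub> tensA (Ident V (UnitObj V)) x)
      = SHomA A x (Ident S X') \<cdot>\<^bsub>V\<^esub> VPhi A X' X' (Ident S X')"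
    by (subst phi_comp_tensA) auto
  also have "\<dots> = phi (UnitObj V) X X' (x \<cdot>\<^bsub>S\<^esub> lunit X)"
    by (subst vphi_pull[OF _ x]) (auto simp: in_hom_iff phi_comp_lunit)
  finally show "phi (UnitObj V) X X' (lunit X' \<cdot>\<^bsub>S\<^esub> tensA (Ident V (UnitObj V)) x)
      = phi (UnitObj V) X X' (x \<cdot>\<^bsub>S\<^esub> lunit X)" .
qed (use S.hom_facts[OF x] in \<open>auto simp: in_hom_iff\<close>)

lemma pentagon:
  assumes [simp]: "K \<in> Obj V" "L \<in> Obj V" "N \<in> Obj V" "X \<in> Obj S"
  shows "assoc K L (T N X) \<cdot>\<^bsub>S\<^esub> assoc (K \<otimes>\<^bsub>V\<^esub> L) N X
    = tensA (Ident V K) (assoc L N X) \<cdot>\<^bsub>S\<^esub> assoc K (L \<otimes>\<^bsub>V\<^esub> N) X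
        \<cdot>\<^bsub>S\<^esub> tensA (Assoc V K L N) (Ident S X)" (is "?l = ?r")
proof (rule phi_inject[where K = "(K \<otimes>\<^bsub>V\<^esub> L) \<otimes>\<^bsub>V\<^esub> N" and X = X and Y = "T K (T L (T N X))"])
  let ?Y = "T K (T L (T N X))"
  have "phi ((K \<otimes>\<^bsub>V\<^esub> L) \<otimes>\<^bsub>V\<^esub> N) X ?Y ?l
      = cmp X (T N X) ?Y (cmp (T N X) (T L (T N X)) ?Y (\<alpha> K (T L (T N X))) (\<alpha> L (T N X))) (\<alpha> N X)"
    by (subst phi_comp_assoc) auto
  also have "\<dots> = cmp X (T L (T N X)) ?Y (\<alpha> K (T L (T N X)))
      (cmp X (T N X) (T L (T N X)) (\<alpha> L (T N X)) (\<alpha> N X)) \<cdot>\<^bsub>V\<^esub> Assoc V K L N"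
    by (rule cmp_assoc) (auto simp: in_hom_iff)
  also have "\<dots> = cmp X (T L (T N X)) ?Y (\<alpha> K (T L (T N X)) \<cdot>\<^bsub>V\<^esub> Ident V K)
      (phi (L \<otimes>\<^bsub>V\<^esub> N) X (T L (T N X)) (assoc L N X)) \<cdot>\<^bsub>V\<^esub> Assoc V K L N"
    by simp
  also have "cmp X (T L (T N X)) ?Y (\<alpha> K (T L (T N X)) \<cdot>\<^bsub>V\<^esub> Ident V K)
        (phi (L \<otimes>\<^bsub>V\<^esub> N) X (T L (T N X)) (assoc L N X))
      = cmp X (T (L \<otimes>\<^bsub>V\<^esub> N) X) ?Y
          (phi K (T (L \<otimes>\<^bsub>V\<^esub> N) X) ?Y (tensA (Ident V K) (assoc L N X))) (\<alpha> (L \<otimes>\<^bsub>V\<^esub> N) X)"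
    by (rule cmp_phi_tensA[symmetric]) auto
  also have "\<dots> = phi (K \<otimes>\<^bsub>V\<^esub> (L \<otimes>\<^bsub>V\<^esub> N)) X ?Y (tensA (Ident V K) (assoc L N X) \<cdot>\<^bsub>S\<^esub> assoc K (L \<otimes>\<^bsub>V\<^esub> N) X)"
    by (rule phi_comp_assoc[symmetric]) auto
  also have "\<dots> \<cdot>\<^bsub>V\<^esub> Assoc V K L N = phi ((K \<otimes>\<^bsub>V\<^esub> L) \<otimes>\<^bsub>V\<^esub> N) X ?Y
      ((tensA (Ident V K) (assoc L N X) \<cdot>\<^bsub>S\<^esub> assoc K (L \<otimes>\<^bsub>V\<^esub> N) X) \<cdot>\<^bsub>S\<^esub> tensA (Assoc V K L N) (Ident S X))"
    by (subst phi_comp_tensA) auto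
  finally show "phi ((K \<otimes>\<^bsub>V\<^esub> L) \<otimes>\<^bsub>V\<^esub> N) X ?Y ?l = phi ((K \<otimes>\<^bsub>V\<^esub> L) \<otimes>\<^bsub>V\<^esub> N) X ?Y ?r"
    by simp
qed (auto simp: in_hom_iff)

lemma triangle:
  assumes [simp]: "K \<in> Obj V" "X \<in> Obj S"
  shows "tensA (Ident V K) (lunit X) \<cdot>\<^bsub>S\<^esub> assoc K (UnitObj V) X = tensA (RUnit V K) (Ident S X)"
    (is "?l = ?r")
proof (rule phi_inject[where K = "K \<otimes>\<^bsub>V\<^esub> UnitObj V" and X = X and Y = "T K X"])
  have "phi (K \<otimes>\<^bsub>V\<^esub> UnitObj V) X (T K X) ?l
      = cmp X (T (UnitObj V) X) (T K X) (phi K (T (UnitObj V) X) (T K X) (tensA (Ident V K) (lunit X)))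
          (\<alpha> (UnitObj V) X)"
    by (rule phi_comp_assoc) auto
  also have "\<dots> = cmp X X (T K X) (\<alpha> K X \<cdot>\<^bsub>V\<^esub> Ident V K) (phi (UnitObj V) X X (lunit X))"
    by (rule cmp_phi_tensA) auto
  also have "\<dots> = cmp X X (T K X) (\<alpha> K X) (VPhi A X X (Ident S X))"
    by simp
  also have "\<dots> = SHomA A (Ident S X) (Ident S (T K X)) \<cdot>\<^bsub>V\<^esub> \<alpha> K X \<cdot>\<^bsub>V\<^esub> RUnit V K"
    by (rule cmp_vphi_right) (auto simp: in_hom_iff)
  also have "\<dots> = phi (K \<otimes>\<^bsub>V\<^esub> UnitObj V) X (T K X) ?r"
    using phi_tensA[of "RUnit V K" "Ident S X" "K \<otimes>\<^bsub>V\<^esub> UnitObj V" X] by simp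
  finally show "phi (K \<otimes>\<^bsub>V\<^esub> UnitObj V) X (T K X) ?l = phi (K \<otimes>\<^bsub>V\<^esub> UnitObj V) X (T K X) ?r" .
qed (auto simp: in_hom_iff)

lemma cyl_module_simps [simp]:
  "SHom cyl_module = SHom A" "SHomA cyl_module = SHomA A" "MTens cyl_module = T"
  "MTensA cyl_module = tensA" "MAssoc cyl_module = assoc" "MLUnit cyl_module = lunit"
  by (simp_all add: cyl_module_def)

lemma MPhi_cyl_module:
  assumes "f \<in> hom S (T K X) Y" "K \<in> Obj V" "X \<in> Obj S"
  shows "MPhi cyl_module K X Y f = phi K X Y f"
  using assms S.hom_facts(5)[OF assms(1)] by (simp add: cyl_module_def)

lemma tensor_closed_cyl_module: "tensor_closed_module V S cyl_module"
proof (unfold_locales, unfold cyl_module_simps)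
  show "bifunctor V S S T tensA" by (rule tensA_bifunctor)
  show "assoc \<in> (\<Pi>\<^sub>E K \<in> Obj V. \<Pi>\<^sub>E L \<in> Obj V. \<Pi>\<^sub>E X \<in> Obj S.
      isos S (T (K \<otimes>\<^bsub>V\<^esub> L) X) (T K (T L X)))"
    by (intro PiE_I assoc_iso) (auto simp: assoc_def)
  show "lunit \<in> (\<Pi>\<^sub>E X \<in> Obj S. isos S (T (UnitObj V) X) X)"
    by (intro PiE_I lunit_iso) (auto simp: lunit_def)
  show "bifunctor (op_cat S) S V (SHom A) (SHomA A)" by (rule shom_bifunctor)
  show "MPhi cyl_module \<in> (\<Pi>\<^sub>E K \<in> Obj V. \<Pi>\<^sub>E X \<in> Obj S. \<Pi>\<^sub>E Y \<in> Obj S.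
      hom S (T K X) Y \<rightarrow>\<^sub>E hom V K (SHom A X Y))"
    by (auto simp: cyl_module_def in_hom_iff)
  show "bij_betw (MPhi cyl_module K X Y) (hom S (T K X) Y) (hom V K (SHom A X Y))"
    if "K \<in> Obj V" "X \<in> Obj S" "Y \<in> Obj S" for K X Y
    using phi_bij[OF that]
    by (rule bij_betw_cong[THEN iffD1, rotated]) (use that in \<open>auto simp: MPhi_cyl_module\<close>)
next
  fix k K' K x X' X y Y Y' f
  assume a: "k \<in> hom V K' K" "x \<in> hom S X' X" "y \<in> hom S Y Y'" "f \<in> hom S (T K X) Y"
  note [simp] = V.hom_facts[OF a(1)] S.hom_facts[OF a(2)] S.hom_facts[OF a(3)] S.hom_facts[OF a(4)]
  have "phi K' X' Y' ((y \<cdot>\<^bsub>S\<^esub> f) \<cdot>\<^bsub>S\<^esub> tensA k x) = SHomA A x (Ident S Y') \<cdot>\<^bsub>V\<^esub> (phi K X Y' (y \<cdot>\<^bsub>S\<^esub> f) \<cdot>\<^bsub>V\<^esub> k)"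
    by (subst phi_comp_tensA) auto
  also have "\<dots> = SHomA A x y \<cdot>\<^bsub>V\<^esub> phi K X Y f \<cdot>\<^bsub>V\<^esub> k"
    by (simp add: phi_comp)
  finally show "MPhi cyl_module K' X' Y' (y \<cdot>\<^bsub>S\<^esub> f \<cdot>\<^bsub>S\<^esub> tensA k x)
      = SHomA A x y \<cdot>\<^bsub>V\<^esub> MPhi cyl_module K X Y f \<cdot>\<^bsub>V\<^esub> k"
    by (simp add: MPhi_cyl_module in_hom_iff)
qed (fact assoc_natural lunit_natural pentagon triangle)+

sublocale cmod: tensor_closed_module V S cyl_module
  by (rule tensor_closed_cyl_module)

lemma VComp_cyl_module:
  assumes [simp]: "X \<in> Obj S" "Y \<in> Obj S" "Z \<in> Obj S"
  shows "VComp (canonical V S cyl_module) X Y Z = VComp A X Y Z"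
proof -
  define e where "e = mev V S cyl_module"
  have [simp]: "e U W \<in> Arr S" "Dom S (e U W) = T (SHom A U W) U" "Cod S (e U W) = W"
    "phi (SHom A U W) U W (e U W) = Ident V (SHom A U W)" if "U \<in> Obj S" "W \<in> Obj S" for U W
    unfolding e_def cmod.mev_eq using cmod.act.eps_simps[OF that] that
    by (simp_all add: MPhi_cyl_module in_hom_iff)
  let ?H = "SHom A Y Z" and ?G = "SHom A X Y"
  let ?f = "e Y Z \<cdot>\<^bsub>S\<^esub> tensA (Ident V ?H) (e X Y)"
  have "VComp (canonical V S cyl_module) X Y Z = phi (?H \<otimes>\<^bsub>V\<^esub> ?G) X Z (?f \<cdot>\<^bsub>S\<^esub> assoc ?H ?G X)"
    by (simp add: canonical_def e_def[symmetric] MPhi_cyl_module in_hom_iff)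
  also have "\<dots> = cmp X (T ?G X) Z (phi ?H (T ?G X) Z ?f) (\<alpha> ?G X)"
    by (rule phi_comp_assoc) auto
  also have "phi ?H (T ?G X) Z ?f = SHomA A (e X Y) (Ident S Z) \<cdot>\<^bsub>V\<^esub> Ident V ?H"
    by (subst phi_comp_tensA) auto
  also have "cmp X (T ?G X) Z \<dots> (\<alpha> ?G X)
      = cmp X Y Z (Ident V ?H) (SHomA A (Ident S X) (e X Y) \<cdot>\<^bsub>V\<^esub> \<alpha> ?G X)"
    by (rule cmp_push[symmetric]) (auto simp: in_hom_iff)
  also have "\<dots> = cmp X Y Z (Ident V ?H) (Ident V ?G)"
    by (simp flip: phi_def[of _ _ Y])
  finally show ?thesis by (simp add: cmp_def)
qed

lemma VPhi_cyl_module: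
  assumes f: "f \<in> hom S X Y"
  shows "VPhi (canonical V S cyl_module) X Y f = VPhi A X Y f"
  using S.hom_facts[OF f] f
  by (simp add: cmod.canonical_simps MPhi_cyl_module phi_comp_lunit in_hom_iff)

lemma uphi_cyl_module:
  assumes [simp]: "K \<in> Obj V" "X \<in> Obj S" "Y \<in> Obj S"
  shows "uphi V S cyl_module K X Y = \<Phi> K X Y"
proof (rule cmod.uphi_eqI)
  show "is_uphi V S cyl_module K X Y (\<Phi> K X Y)"
    unfolding is_uphi_def
    by (auto simp: MPhi_cyl_module in_hom_iff Phi_comp phi_comp_assoc)
qed auto

lemma ualpha_cyl_module:
  assumes "K \<in> Obj V" "X \<in> Obj S"
  shows "ualpha V S cyl_module K X = \<alpha> K X"
  using assms by (simp add: cmod.ualpha_eq MPhi_cyl_module in_hom_iff)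

end

lemma canonical_with_cylinder_simps:
  "SHom (canonical_with_cylinder V S M) = SHom (canonical V S M)"
  "SHomA (canonical_with_cylinder V S M) = SHomA (canonical V S M)"
  "VComp (canonical_with_cylinder V S M) = VComp (canonical V S M)"
  "VPhi (canonical_with_cylinder V S M) = VPhi (canonical V S M)"
  "CTens (canonical_with_cylinder V S M) = MTens M"
  "CAlpha (canonical_with_cylinder V S M) = ualpha V S M"
  "CPhi (canonical_with_cylinder V S M) = uphi V S M"
  by (simp_all add: canonical_with_cylinder_def vstruct.extend_def cylstruct.fields_def canonical_def)

lemma v_structure_with_cylinder_iff:
  "v_structure_with_cylinder V S A \<longleftrightarrow> v_cylinder V S A (CTens A) (CAlpha A) (CPhi A)"
  by (simp add: v_structure_with_cylinder_def v_cylinder_def v_cylinder_axioms_def)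

lemma (in tensor_closed_module) v_cylinder_canonical_with_cylinder:
  "v_cylinder V S (canonical_with_cylinder V S M) (MTens M) (ualpha V S M) (uphi V S M)"
  using v_cylinder_canonical
  by (simp add: v_cylinder_def v_cylinder_axioms_def v_structure_def v_structure_axioms_def
      is_cylinder_def canonical_with_cylinder_simps)

lemma canonical_with_cylinder_cyl_module:
  assumes "v_structure_with_cylinder V S A"
  shows "canonical_with_cylinder V S (v_cylinder.cyl_module V S A (CTens A) (CAlpha A)) = A"
proof -
  interpret v_cylinder V S A "CTens A" "CAlpha A" "CPhi A"
    using assms by (simp add: v_structure_with_cylinder_iff)
  interpret can: v_cylinder V S "canonical V S cyl_module" "MTens cyl_module" "ualpha V S cyl_module" "uphi V S cyl_module"
    by (rule cmod.v_cylinder_canonical)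
  have "VComp (canonical V S cyl_module) = VComp A"
    by (rule PiE3_ext[OF can.vcomp_hom vcomp_hom]) (rule VComp_cyl_module)
  moreover have "VPhi (canonical V S cyl_module) = VPhi A"
    by (rule PiE3_ext[OF can.vphi_hom vphi_hom]) (rule VPhi_cyl_module)
  moreover have "ualpha V S cyl_module = CAlpha A"
    using can.cylinder cylinder unfolding is_cylinder_def
    by (elim conjE) (erule PiE2_ext, assumption, rule ualpha_cyl_module)
  moreover have "uphi V S cyl_module = CPhi A"
    using can.cylinder cylinder unfolding is_cylinder_def
    by (elim conjE) (rule PiE3_ext, assumption, assumption, rule uphi_cyl_module)
  ultimately show ?thesis
    by (intro cylstruct.equality) (simp_all add: canonical_with_cylinder_simps cmod.canonical_simps)
qed

lemma (in tensor_closed_module) cyl_module_canonical_with_cylinder: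
  "v_cylinder.cyl_module V S (canonical_with_cylinder V S M) (MTens M) (ualpha V S M) = M"
proof -
  let ?A = "canonical_with_cylinder V S M"
  interpret cyl: v_cylinder V S ?A "MTens M" "ualpha V S M" "uphi V S M"
    by (rule v_cylinder_canonical_with_cylinder)
  have H: "SHom ?A = SHom M" "SHomA ?A = SHomA M"
    by (simp_all add: canonical_with_cylinder_simps canonical_simps)
  have phi: "cyl.phi K X Y f = MPhi M K X Y f" if "f \<in> hom S (K \<odot>\<^bsub>M\<^esub> X) Y" "K \<in> Obj V" "X \<in> Obj S" for K X Y f
    using mphi_push[of "Ident S (K \<odot>\<^bsub>M\<^esub> X)" K X "K \<odot>\<^bsub>M\<^esub> X" f Y] that S.hom_facts[OF that(1)]
    by (simp add: cyl.phi_def H ualpha_eq in_hom_iff)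
  have "cyl.tensA k x = k \<boxdot>\<^bsub>M\<^esub> x" if [simp]: "k \<in> Arr V" "x \<in> Arr S" for k x
  proof (rule cyl.phi_inject)
    let ?KX = "Cod V k \<odot>\<^bsub>M\<^esub> Cod S x"
    have "cyl.phi (Dom V k) (Dom S x) ?KX (k \<boxdot>\<^bsub>M\<^esub> x)
        = MPhi M (Dom V k) (Dom S x) ?KX (Ident S ?KX \<cdot>\<^bsub>S\<^esub> (Ident S ?KX \<cdot>\<^bsub>S\<^esub> (k \<boxdot>\<^bsub>M\<^esub> x)))"
      by (simp add: phi in_hom_iff)
    also have "\<dots> = SHomA M x (Ident S ?KX) \<cdot>\<^bsub>V\<^esub> (ualpha V S M (Cod V k) (Cod S x) \<cdot>\<^bsub>V\<^esub> k)"
      by (subst mphi_natural') (auto simp: in_hom_iff ualpha_eq)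
    finally show "cyl.phi (Dom V k) (Dom S x) ?KX (cyl.tensA k x)
        = cyl.phi (Dom V k) (Dom S x) ?KX (k \<boxdot>\<^bsub>M\<^esub> x)"
      by (simp add: cyl.phi_tensA H)
  qed (auto simp: in_hom_iff)
  then have tensA: "cyl.tensA = MTensA M"
    using cyl.tensA_bifunctor mtens_bifunctor unfolding bifunctor_def
    by (elim conjE) (rule PiE2_ext, assumption, assumption, simp)
  have assoc: "cyl.assoc = MAssoc M"
  proof (rule PiE3_ext[OF _ massoc_iso])
    show "cyl.assoc \<in> (\<Pi>\<^sub>E K \<in> Obj V. \<Pi>\<^sub>E L \<in> Obj V. \<Pi>\<^sub>E X \<in> Obj S.
        isos S ((K \<otimes>\<^bsub>V\<^esub> L) \<odot>\<^bsub>M\<^esub> X) (K \<odot>\<^bsub>M\<^esub> (L \<odot>\<^bsub>M\<^esub> X)))"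
      using cyl.cmod.massoc_iso by simp
    fix K L X assume [simp]: "K \<in> Obj V" "L \<in> Obj V" "X \<in> Obj S"
    let ?Z = "K \<odot>\<^bsub>M\<^esub> (L \<odot>\<^bsub>M\<^esub> X)"
    show "cyl.assoc K L X = MAssoc M K L X"
    proof (rule cyl.phi_inject)
      have "cyl.phi (K \<otimes>\<^bsub>V\<^esub> L) X ?Z (cyl.assoc K L X)
          = act.cmp X (L \<odot>\<^bsub>M\<^esub> X) ?Z \<cdot>\<^bsub>V\<^esub> (ualpha V S M K (L \<odot>\<^bsub>M\<^esub> X) \<boxtimes>\<^bsub>V\<^esub> ualpha V S M L X)"
        by (simp add: cyl.cmp_def canonical_with_cylinder_simps canonical_simps)
      also have "\<dots> = MPhi M (K \<otimes>\<^bsub>V\<^esub> L) X ?Z (Ident S ?Z \<cdot>\<^bsub>S\<^esub> (Ident V K \<boxdot>\<^bsub>M\<^esub> Ident S (L \<odot>\<^bsub>M\<^esub> X)) \<cdot>\<^bsub>S\<^esub> MAssoc M K L X)"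
        unfolding ualpha_eq[OF \<open>K \<in> Obj V\<close> act.act_simps(1)[OF \<open>L \<in> Obj V\<close> \<open>X \<in> Obj S\<close>]]
          ualpha_eq[OF \<open>L \<in> Obj V\<close> \<open>X \<in> Obj S\<close>]
        by (rule act.cmp_phi) (auto simp: in_hom_iff)
      also have "\<dots> = cyl.phi (K \<otimes>\<^bsub>V\<^esub> L) X ?Z (MAssoc M K L X)"
        by (simp add: phi in_hom_iff)
      finally show "cyl.phi (K \<otimes>\<^bsub>V\<^esub> L) X ?Z (cyl.assoc K L X) = cyl.phi (K \<otimes>\<^bsub>V\<^esub> L) X ?Z (MAssoc M K L X)" .
    qed (auto simp: in_hom_iff)
  qed
  have lunit: "cyl.lunit = MLUnit M"
  proof (rule PiE_ext[OF _ mlunit_iso])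
    show "cyl.lunit \<in> (\<Pi>\<^sub>E X \<in> Obj S. isos S (UnitObj V \<odot>\<^bsub>M\<^esub> X) X)"
      using cyl.cmod.mlunit_iso by simp
    fix X assume [simp]: "X \<in> Obj S"
    show "cyl.lunit X = MLUnit M X"
    proof (rule cyl.phi_inject)
      have "cyl.phi (UnitObj V) X X (cyl.lunit X) = VPhi ?A X X (Ident S X)"
        by (rule cyl.lunit_simps) simp
      also have "\<dots> = cyl.phi (UnitObj V) X X (MLUnit M X)"
        by (simp add: phi canonical_with_cylinder_simps canonical_simps in_hom_iff)
      finally show "cyl.phi (UnitObj V) X X (cyl.lunit X) = cyl.phi (UnitObj V) X X (MLUnit M X)" .
    qed (auto simp: in_hom_iff)
  qed
  have "MPhi cyl.cyl_module = MPhi M"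
  proof (rule PiE3_ext[OF _ mphi_hom])
    show "MPhi cyl.cyl_module \<in> (\<Pi>\<^sub>E K \<in> Obj V. \<Pi>\<^sub>E X \<in> Obj S. \<Pi>\<^sub>E Y \<in> Obj S.
        hom S (K \<odot>\<^bsub>M\<^esub> X) Y \<rightarrow>\<^sub>E hom V K (SHom M X Y))"
      using cyl.cmod.mphi_hom by (simp add: H)
    fix K X Y assume o: "K \<in> Obj V" "X \<in> Obj S" "Y \<in> Obj S"
    show "MPhi cyl.cyl_module K X Y = MPhi M K X Y"
    proof (rule PiE_ext)
      show "MPhi M K X Y \<in> hom S (K \<odot>\<^bsub>M\<^esub> X) Y \<rightarrow>\<^sub>E hom V K (SHom M X Y)"
        using PiE3_mem[OF mphi_hom o] .
      show "MPhi cyl.cyl_module K X Y \<in> hom S (K \<odot>\<^bsub>M\<^esub> X) Y \<rightarrow>\<^sub>E hom V K (SHom M X Y)"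
        using PiE3_mem[OF cyl.cmod.mphi_hom] o by (simp add: H)
    qed (use o in \<open>simp add: cyl.MPhi_cyl_module phi\<close>)
  qed
  then show ?thesis
    by (intro tcmod.equality) (simp_all add: H tensA assoc lunit)
qed

theorem theorem1p19:
  fixes V :: "('o, 'm) cmcat" and S :: "('p, 'n) cat"
  assumes "closed_monoidal_category V" and "category S"
  shows "(\<forall>M. tensor_closed_module V S M \<longrightarrow>
            v_structure V S (canonical V S M) \<and>
            tensored V (associated_vcat S (canonical V S M)) \<and>
            has_cylinder V S (canonical V S M) \<and>
            (\<forall>K \<in> Obj V. \<forall>X \<in> Obj S. \<forall>Y \<in> Obj S. \<exists>!p. is_uphi V S M K X Y p) \<and>
            tensoring V (associated_vcat S (canonical V S M)) (MTens M) (uphi V S M) \<and>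
            is_cylinder V S (canonical V S M) (MTens M) (ualpha V S M) (uphi V S M))
         \<and>
         bij_betw (canonical_with_cylinder V S)
           {M. tensor_closed_module V S M}
           {A. v_structure_with_cylinder V S A}"
proof (intro conjI allI impI)
  fix M assume M: "tensor_closed_module V S M"
  interpret tensor_closed_module V S M by (rule M)
  interpret can: v_cylinder V S "canonical V S M" "MTens M" "ualpha V S M" "uphi V S M"
    by (rule v_cylinder_canonical)
  show "v_structure V S (canonical V S M)" by (rule v_structure_canonical)
  show t: "tensoring V (associated_vcat S (canonical V S M)) (MTens M) (uphi V S M)"
    by (rule can.tensoring_cylinder)
  show "tensored V (associated_vcat S (canonical V S M))"
    unfolding tensored_def using t can.v_category_associated by blast
  show c: "is_cylinder V S (canonical V S M) (MTens M) (ualpha V S M) (uphi V S M)"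
    by (rule is_cylinder_canonical)
  show "has_cylinder V S (canonical V S M)"
    unfolding has_cylinder_def using c by blast
  show "\<forall>K \<in> Obj V. \<forall>X \<in> Obj S. \<forall>Y \<in> Obj S. \<exists>!p. is_uphi V S M K X Y p"
    by (simp add: ex1_is_uphi)
next
  let ?mod = "\<lambda>A. v_cylinder.cyl_module V S A (CTens A) (CAlpha A)"
  show "bij_betw (canonical_with_cylinder V S) {M. tensor_closed_module V S M}
      {A. v_structure_with_cylinder V S A}"
  proof (rule bij_betw_byWitness[where f' = ?mod])
    show "\<forall>M \<in> {M. tensor_closed_module V S M}. ?mod (canonical_with_cylinder V S M) = M"
      by (simp add: canonical_with_cylinder_simps tensor_closed_module.cyl_module_canonical_with_cylinder)
    show "\<forall>A \<in> {A. v_structure_with_cylinder V S A}. canonical_with_cylinder V S (?mod A) = A"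
      by (simp add: canonical_with_cylinder_cyl_module)
    show "canonical_with_cylinder V S ` {M. tensor_closed_module V S M} \<subseteq> {A. v_structure_with_cylinder V S A}"
      by (auto simp: v_structure_with_cylinder_iff canonical_with_cylinder_simps
          tensor_closed_module.v_cylinder_canonical_with_cylinder)
    show "?mod ` {A. v_structure_with_cylinder V S A} \<subseteq> {M. tensor_closed_module V S M}"
      by (auto simp: v_structure_with_cylinder_iff v_cylinder.tensor_closed_cyl_module)
  qed
qed

end
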